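(* For $k\in\{1,2\}$ and all integers $n\ge 6$, \[ 4\big(\Delta_k(n)^2-\Delta_k(n-1)\Delta_k(n+1)\big)\big(\Delta_k(n+1)^2-\Delta_k(n)\Delta_k(n+2)\big)-\big(\Delta_k(n)\Delta_k(n+1)-\Delta_k(n-1)\Delta_k(n+2)\big)^2>0, \] i.e. the sequence $\{\Delta_k(n)\}$ satisfies the higher order Turán inequalities for $n\ge 6$.
   Context: For an integer $k\ge 0$, $\Delta_k(n)$ denotes the number of broken $k$-diamond partitions of $n$ (Andrews–Paule), defined equivalently by the generating function \[ \sum_{n\ge 0}\Delta_k(n)q^n=\prod_{n\ge1}\frac{(1-q^{2n})(1-q^{(2k+1)n})}{(1-q^n)^3(1-q^{(4k+2)n})}. \] *)

theory Defs
  imports "HOL-Analysis.Analysis"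
begin

text \<open>
  The \<^term>\<open>n\<close>-th factor of the generating function for broken \<^term>\<open>k\<close>-diamond partitions, as a formal
  power series in \<open>q = fps_X\<close>. For \<^term>\<open>n > 0\<close> the denominator has constant coefficient 1, so the division
  of power series is multiplication by the inverse series.
\<close>
definition broken_diamond_factor :: "nat \<Rightarrow> nat \<Rightarrow> real fps" where
  "broken_diamond_factor k n =
     ((1 - fps_X ^ (2 * n)) * (1 - fps_X ^ ((2 * k + 1) * n))) /
     ((1 - fps_X ^ n) ^ 3 * (1 - fps_X ^ ((4 * k + 2) * n)))"

text \<open>
  The infinite product is taken in the usual (X-adic) topology on formal power series.
  \<^term>\<open>prodinf\<close> starts at index 0, whereas the product here starts at \<open>n = 1\<close>; hence \<open>Suc n\<close>.
\<close>
definition broken_diamond_gf :: "nat \<Rightarrow> real fps" where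
  "broken_diamond_gf k = (\<Prod>n. broken_diamond_factor k (Suc n))"

definition broken_diamond :: "nat \<Rightarrow> nat \<Rightarrow> real" where
  "broken_diamond k n = fps_nth (broken_diamond_gf k) n"


text \<open>
  The product does converge, so \<^term>\<open>broken_diamond_gf\<close> is not the arbitrary default value of \<^term>\<open>prodinf\<close>.
\<close>

lemma fps_X_power_dvd_broken_diamond_factor_minus_1:
  assumes "n > 0"
  shows "fps_X ^ n dvd broken_diamond_factor k n - 1"
proof -
  define x :: "real fps" where "x = fps_X ^ n"
  define N where "N = (1 - x ^ 2) * (1 - x ^ (2 * k + 1))"
  define D where "D = (1 - x) ^ 3 * (1 - x ^ (4 * k + 2))"
  have x0: "fps_nth x 0 = 0"
    using assms by (simp add: x_def)
  have D0: "fps_nth D 0 = 1"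
    using x0 by (simp add: D_def fps_nth_power_0)
  have f: "broken_diamond_factor k n = N / D"
    unfolding broken_diamond_factor_def N_def D_def x_def power_mult [symmetric]
    by (simp only: mult.commute [of n])
  have one: "x dvd (a * b - 1)" if "x dvd (a - 1)" "x dvd (b - 1)" for a b
  proof -
    have "a * b - 1 = (a - 1) * b + (b - 1)" by (simp add: algebra_simps)
    thus ?thesis using that by (simp only: dvd_add dvd_mult2)
  qed
  have pw: "x dvd (1 - x ^ m) - 1" if "m > 0" for m
    using that by simp
  have x1: "x dvd (1 - x) - 1" by simp
  have N: "x dvd N - 1"
    unfolding N_def by (intro one pw) auto
  have "x dvd D - 1"
    unfolding D_def power3_eq_cube by (intro one pw x1) auto
  hence "x dvd N - D"
    using N dvd_diff[of x "N - 1" "D - 1"] by simp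
  hence "x dvd (N - D) * inverse D"
    by (rule dvd_mult2)
  also have "(N - D) * inverse D = N / D - 1"
    using D0 by (simp add: fps_divide_unit left_diff_distrib inverse_mult_eq_1')
  finally show ?thesis
    by (simp add: f x_def)
qed

lemma has_prod_broken_diamond_gf:
  "(\<lambda>n. broken_diamond_factor k (Suc n)) has_prod broken_diamond_gf k"
proof -
  let ?f = "\<lambda>n. broken_diamond_factor k (Suc n)"
  define P where "P = (\<lambda>N. \<Prod>i\<le>N. ?f i)"
  define L where "L = Abs_fps (\<lambda>n. fps_nth (P n) n)"
  have step: "fps_nth (P (Suc N)) n = fps_nth (P N) n" if "n \<le> N" for N n
  proof -
    obtain h where h: "?f (Suc N) - 1 = fps_X ^ Suc (Suc N) * h"
      using fps_X_power_dvd_broken_diamond_factor_minus_1[of "Suc (Suc N)" k] by blast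
    have "P (Suc N) - P N = P N * (?f (Suc N) - 1)"
      by (simp add: P_def algebra_simps)
    also have "\<dots> = fps_X ^ Suc (Suc N) * (P N * h)"
      by (simp only: h mult.left_commute)
    finally have "fps_nth (P (Suc N) - P N) n = 0"
      using that by (simp only: fps_X_power_mult_nth) simp
    thus ?thesis by simp
  qed
  have stable: "fps_nth (P N) n = fps_nth (P n) n" if "n \<le> N" for N n
    using that by (induction N rule: dec_induct) (auto simp: step)
  have "P \<longlonglongrightarrow> L"
  proof (rule tendsto_fpsI)
    fix n
    show "eventually (\<lambda>N. fps_nth (P N) n = fps_nth L n) sequentially"
      using eventually_ge_at_top[of n] by eventually_elim (metis L_def fps_nth_Abs_fps stable)
  qed
  moreover have "fps_nth L 0 = 1"
    by (simp add: L_def P_def broken_diamond_factor_def fps_divide_unit fps_nth_power_0)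
  hence "L \<noteq> 0" by auto
  ultimately have "?f has_prod L"
    by (simp add: has_prod_def raw_has_prod_def P_def)
  thus ?thesis
    using has_prod_unique[of ?f L] by (simp add: broken_diamond_gf_def)
qed

end

theory Submission
  imports Defs "HOL-Complex_Analysis.Complex_Analysis" "HOL-Real_Asymp.Real_Asymp"
begin

text \<open>
  Put \<open>m = 2 * k + 1\<close> and \<open>q = exp (- t)\<close>. The transformation \<open>t \<mapsto> 4 * pi\<^sup>2 / t\<close> of the partition product shows
  that the generating function is \<open>t / (2 * pi) * exp (A / t - (m + 1) / 24 * t)\<close> up to a factor that tends to 1
  extremely fast as \<open>t\<close> approaches 0. Cauchy's formula on \<open>Re t = A / z\<close>, where \<open>X = n - (m + 1) / 24\<close> and
  \<open>z = sqrt (A * X)\<close>, then gives \<open>\<Delta>\<^sub>k(n) = A * I\<^sub>2 (2 * z) / (2 * pi * X)\<close> up to a relative error which for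
  \<open>n > 800\<close> is less than \<open>3 / 8 * A ^ 3 / z ^ 5\<close>. For \<open>y\<^sub>j = \<Delta>\<^sub>k(n - 1 + j)\<close> and \<open>e\<^sub>j = 1 - y\<^sub>j\<^sub>-\<^sub>1 * y\<^sub>j\<^sub>+\<^sub>1 / y\<^sub>j\<^sup>2\<close> the
  inequality says that \<open>e\<^sub>1\<close> and \<open>e\<^sub>2\<close> are positive, small and close to each other. They are second differences of
  the logarithm, which for the Bessel function are controlled by the Riccati equation of its logarithmic derivative,
  and the error above is small enough to preserve the conclusion. For \<open>n \<le> 800\<close> the coefficients are computed with
  the pentagonal number theorem; the inequality is tested exactly for small \<open>n\<close> and afterwards on leading binary digits.
\<close>

section \<open>The logarithm of the partition product and its modular transformation\<close>

text \<open>The scale of the errors decides the outcome. Each \<open>e\<^sub>j\<close> is about A^2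
  / (2 z^3), and the difference \<open>e\<^sub>1 - e\<^sub>2\<close> is essentially a third
  difference, of order A^3 / z^5. The terms of second order in the \<open>e\<^sub>j\<close> collapse
  to minus the square of this difference, of order A^6 / z^10, while the positive cubic terms have
  order A^6 / z^9; so logarithmic errors of order A^3 / z^5 are affordable. Near the real axis the
  dual factor differs from 1 by O(exp (- (2 pi^2 / m) Re (1 / t))), against a main term growing like
  exp (A Re (1 / t)). Their product stays bounded if A <= 2 pi^2 / m, that is m <= 5, which holds
  for k = 1, 2 and fails from k = 3 on. Away from the real axis no other cusp is examined: the
  generating function is compared with its value at Re t, and the first term of the series
  \<open>lam\<close> supplies the gain exp (- 7 z / (4 A)). That this crude gain must beat a power
  of z is what pushes the threshold up to 800. Modularity is obtained by integrating the
  transformation of the weight two Eisenstein series, derived from Euler's product for sinh.\<close>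

lemma sinh_product_formula_real:
  fixes x :: real
  shows "(\<lambda>n. pi * x * (\<Prod>k=1..n. 1 + x\<^sup>2 / (real k)\<^sup>2)) \<longlonglongrightarrow> sinh (pi * x)"
proof -
  define z where "z = \<i> * complex_of_real x"
  have "(\<lambda>n. of_real pi * z * (\<Prod>k=1..n. 1 - z^2 / of_nat k^2)) \<longlonglongrightarrow> sin (of_real pi * z)"
    by (rule sin_product_formula_complex)
  also have "(\<lambda>n. of_real pi * z * (\<Prod>k=1..n. 1 - z^2 / of_nat k^2)) =
      (\<lambda>n. \<i> * of_real (pi * x * (\<Prod>k=1..n. 1 + x\<^sup>2 / (real k)\<^sup>2)))"
    by (simp add: z_def power_mult_distrib mult_ac)
  also have "sin (of_real pi * z) = \<i> * of_real (sinh (pi * x))"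
    by (simp add: z_def sin_exp_eq sinh_field_def exp_of_real mult_ac flip: exp_of_real) (simp add: field_simps)
  finally have "(\<lambda>n. \<i> * of_real (pi * x * (\<Prod>k=1..n. 1 + x\<^sup>2 / (real k)\<^sup>2)) / \<i>)
       \<longlonglongrightarrow> \<i> * of_real (sinh (pi * x)) / \<i>"
    by (rule tendsto_divide) auto
  then show ?thesis
    by (simp only: nonzero_mult_div_cancel_left[OF complex_i_not_zero] tendsto_of_real_iff)
qed

lemma summable_inverse_Suc_squared: "summable (\<lambda>n. 1 / (real (Suc n))\<^sup>2)"
  using inverse_power_summable[of 2, where 'a = real] summable_Suc_iff[of "\<lambda>n. inverse (real n ^ 2)"]
  by (simp add: divide_inverse)

text \<open>Logarithms turn Euler's product into a series that can be differentiated term by term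
  twice; this produces the partial fractions of coth and of 1 / sinh^2 below.\<close>

lemma sums_ln_sinh:
  fixes x :: real
  assumes "x > 0"
  shows "(\<lambda>k. ln (1 + x\<^sup>2 / (real (Suc k))\<^sup>2)) sums ln (sinh (pi * x) / (pi * x))"
proof -
  have "(\<lambda>n. (pi * x * (\<Prod>k=1..n. 1 + x\<^sup>2 / (real k)\<^sup>2)) / (pi * x)) \<longlonglongrightarrow> sinh (pi * x) / (pi * x)"
    by (intro tendsto_divide sinh_product_formula_real tendsto_const) (use assms in auto)
  then have "(\<lambda>n. \<Prod>k=1..n. 1 + x\<^sup>2 / (real k)\<^sup>2) \<longlonglongrightarrow> sinh (pi * x) / (pi * x)"
    using assms by simp
  then have "(\<lambda>n. ln (\<Prod>k=1..n. 1 + x\<^sup>2 / (real k)\<^sup>2)) \<longlonglongrightarrow> ln (sinh (pi * x) / (pi * x))"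
    by (rule tendsto_ln) (use assms in auto)
  moreover have "ln (\<Prod>k=1..n. 1 + x\<^sup>2 / (real k)\<^sup>2) = (\<Sum>k<n. ln (1 + x\<^sup>2 / (real (Suc k))\<^sup>2))" for n
  proof -
    have "1 + x\<^sup>2 / (real k)\<^sup>2 \<noteq> 0" for k
      using add_pos_nonneg[of 1 "x\<^sup>2 / (real k)\<^sup>2"] by simp
    then have "ln (\<Prod>k=1..n. 1 + x\<^sup>2 / (real k)\<^sup>2) = (\<Sum>k=1..n. ln (1 + x\<^sup>2 / (real k)\<^sup>2))"
      by (intro ln_prod) auto
    also have "\<dots> = (\<Sum>k<n. ln (1 + x\<^sup>2 / (real (Suc k))\<^sup>2))"
      by (rule sum.reindex_bij_witness[of _ Suc "\<lambda>k. k - 1"]) auto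
    finally show ?thesis .
  qed
  ultimately show ?thesis by (simp add: sums_def)
qed

text \<open>Termwise derivative of \<open>sums_ln_sinh\<close>. Staying below x + 1 gives a majorant
  of order 1 / k^2 for the differentiated series.\<close>

lemma sums_coth_partial_fractions:
  fixes x :: real
  assumes "x > 0"
  shows "(\<lambda>k. 2 * x / (x\<^sup>2 + (real (Suc k))\<^sup>2)) sums (pi * cosh (pi * x) / sinh (pi * x) - 1 / x)"
proof -
  define S where "S = {0<..<x+1}"
  have x: "x \<in> interior S" using assms by (simp add: S_def interior_open)
  have sub: "((\<lambda>x. ln (1 + x\<^sup>2 / (real (Suc k))\<^sup>2)) has_field_derivative
        2 * y / (y\<^sup>2 + (real (Suc k))\<^sup>2)) (at y within S)" if "y \<in> S" for k y
  proof -
    define b where "b = (real (Suc k))\<^sup>2"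
    have b: "b > 0" unfolding b_def by simp
    then have "1 + y\<^sup>2 / b > 0" "y\<^sup>2 + b > 0" by (auto intro: add_pos_nonneg add_nonneg_pos)
    with b show ?thesis unfolding b_def[symmetric]
      by (auto intro!: derivative_eq_intros simp: field_simps)
  qed
  have unif: "uniformly_convergent_on S (\<lambda>n y. \<Sum>k<n. 2 * y / (y\<^sup>2 + (real (Suc k))\<^sup>2))"
  proof (rule Weierstrass_m_test')
    show "summable (\<lambda>k. 2 * (x+1) * (1 / (real (Suc k))\<^sup>2))"
      by (intro summable_mult summable_inverse_Suc_squared)
    show "norm (2 * y / (y\<^sup>2 + (real (Suc k))\<^sup>2)) \<le> 2 * (x+1) * (1 / (real (Suc k))\<^sup>2)" if "y \<in> S" for k y
    proof -
      have "2 * y / (y\<^sup>2 + (real (Suc k))\<^sup>2) \<le> 2 * (x+1) / (real (Suc k))\<^sup>2"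
        by (rule frac_le) (use that in \<open>auto simp: S_def\<close>)
      then show ?thesis using that by (simp add: S_def)
    qed
  qed
  note D = has_field_derivative_series'[of S, OF _ sub unif _ _ x, of x]
  have sm: "summable (\<lambda>k. ln (1 + x\<^sup>2 / (real (Suc k))\<^sup>2))"
    using sums_ln_sinh[OF assms] by (rule sums_summable)
  have der: "((\<lambda>x. \<Sum>k. ln (1 + x\<^sup>2 / (real (Suc k))\<^sup>2)) has_field_derivative
      (\<Sum>k. 2 * x / (x\<^sup>2 + (real (Suc k))\<^sup>2))) (at x)"
    by (rule D(2)) (use assms sm in \<open>auto simp: S_def\<close>)
  have "eventually (\<lambda>y. y \<in> S) (nhds x)"
    using assms by (intro eventually_nhds_in_open) (auto simp: S_def)
  then have ev: "eventually (\<lambda>y. (\<Sum>k. ln (1 + y\<^sup>2 / (real (Suc k))\<^sup>2)) = ln (sinh (pi * y) / (pi * y))) (nhds x)"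
    by eventually_elim (use sums_ln_sinh in \<open>auto simp: S_def sums_iff\<close>)
  have sp: "sinh (pi * x) > 0" using assms by simp
  have "((\<lambda>y. ln (sinh (pi * y) / (pi * y))) has_field_derivative
         (pi * cosh (pi * x) / sinh (pi * x) - 1 / x)) (at x)"
    using assms sp by (auto intro!: derivative_eq_intros simp: field_simps power2_eq_square)
  then have "((\<lambda>x. \<Sum>k. ln (1 + x\<^sup>2 / (real (Suc k))\<^sup>2)) has_field_derivative
         (pi * cosh (pi * x) / sinh (pi * x) - 1 / x)) (at x)"
    by (subst DERIV_cong_ev[OF refl ev refl])
  with der have "(\<Sum>k. 2 * x / (x\<^sup>2 + (real (Suc k))\<^sup>2)) = pi * cosh (pi * x) / sinh (pi * x) - 1 / x"
    by (rule DERIV_unique)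
  moreover have "summable (\<lambda>k. 2 * x / (x\<^sup>2 + (real (Suc k))\<^sup>2))"
    using uniformly_convergent_imp_convergent[OF unif, of x] assms by (simp add: S_def summable_iff_convergent)
  ultimately show ?thesis by (simp add: sums_iff)
qed

text \<open>Minus half the termwise derivative of the coth expansion. The summand is the real part
  of 1 / (x + i k)^2, so for x = m \<tau> the identity evaluates one row of the lattice sum behind
  the Eisenstein series of weight two.\<close>

lemma sums_inverse_sinh_squared:
  fixes x :: real
  assumes "x > 0"
  shows "(\<lambda>k. (x\<^sup>2 - (real (Suc k))\<^sup>2) / (x\<^sup>2 + (real (Suc k))\<^sup>2)\<^sup>2)
           sums ((pi\<^sup>2 / (sinh (pi * x))\<^sup>2 - 1 / x\<^sup>2) / 2)"
proof -
  have h1: "- 1 / 2 * (2 * (u - v) / w) = (v - u) / w" for u v w :: real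
    by (cases "w = 0") (simp_all add: field_simps)
  have h2: "- 1 / 2 * (- u / v + w) = (u / v - w) / 2" for u v w :: real
    by (simp add: field_simps)
  define S where "S = {0<..<x+1}"
  have x: "x \<in> interior S" using assms by (simp add: S_def interior_open)
  let ?d = "\<lambda>k y. 2 * ((real (Suc k))\<^sup>2 - y\<^sup>2) / (y\<^sup>2 + (real (Suc k))\<^sup>2)\<^sup>2"
  have sub: "((\<lambda>x. 2 * x / (x\<^sup>2 + (real (Suc k))\<^sup>2)) has_field_derivative ?d k y) (at y within S)" 
    if "y \<in> S" for k y
  proof -
    have "y\<^sup>2 + (real (Suc k))\<^sup>2 > 0" by (simp add: add_nonneg_pos)
    then show ?thesis
      by (auto intro!: derivative_eq_intros simp: field_simps power2_eq_square simp del: of_nat_Suc)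
  qed
  have unif: "uniformly_convergent_on S (\<lambda>n y. \<Sum>k<n. ?d k y)"
  proof (rule Weierstrass_m_test')
    show "summable (\<lambda>k. 2 * (1 / (real (Suc k))\<^sup>2))"
      by (intro summable_mult summable_inverse_Suc_squared)
    show "norm (?d k y) \<le> 2 * (1 / (real (Suc k))\<^sup>2)" if "y \<in> S" for k y
    proof -
      define b where "b = (real (Suc k))\<^sup>2"
      have b: "b > 0" unfolding b_def by simp
      have N: "y\<^sup>2 + b > 0" using b by (simp add: add_nonneg_pos)
      have "\<bar>b - y\<^sup>2\<bar> \<le> y\<^sup>2 + b" using b by (auto simp: abs_le_iff)
      then have "\<bar>b - y\<^sup>2\<bar> / (y\<^sup>2 + b)\<^sup>2 \<le> (y\<^sup>2 + b) / (y\<^sup>2 + b)\<^sup>2"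
        by (rule divide_right_mono) simp
      also have "\<dots> = 1 / (y\<^sup>2 + b)" using N by (simp add: power2_eq_square)
      also have "\<dots> \<le> 1 / b" using b by (simp add: frac_le)
      finally show ?thesis unfolding b_def[symmetric] by (simp add: abs_mult del: right_diff_distrib_numeral)
    qed
  qed
  note D = has_field_derivative_series'[of S, OF _ sub unif _ _ x, of x]
  have sm: "summable (\<lambda>k. 2 * x / (x\<^sup>2 + (real (Suc k))\<^sup>2))"
    using sums_coth_partial_fractions[OF assms] by (rule sums_summable)
  have der: "((\<lambda>x. \<Sum>k. 2 * x / (x\<^sup>2 + (real (Suc k))\<^sup>2)) has_field_derivative (\<Sum>k. ?d k x)) (at x)"
    by (rule D(2)) (use assms sm in \<open>auto simp: S_def\<close>)
  have "eventually (\<lambda>y. y \<in> S) (nhds x)"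
    using assms by (intro eventually_nhds_in_open) (auto simp: S_def)
  then have ev: "eventually (\<lambda>y. (\<Sum>k. 2 * y / (y\<^sup>2 + (real (Suc k))\<^sup>2)) = pi * cosh (pi * y) / sinh (pi * y) - 1 / y) (nhds x)"
    by eventually_elim (use sums_coth_partial_fractions in \<open>auto simp: S_def sums_iff\<close>)
  have sp: "sinh (pi * x) > 0" using assms by simp
  have "((\<lambda>y. pi * cosh (pi * y) / sinh (pi * y) - 1 / y) has_field_derivative
         (pi * (pi * sinh (pi * x)) * sinh (pi * x) - pi * cosh (pi * x) * (pi * cosh (pi * x))) / (sinh (pi * x))\<^sup>2 + 1 / x\<^sup>2) (at x)"
    using assms sp by (auto intro!: derivative_eq_intros simp: power2_eq_square)
  also have "(pi * (pi * sinh (pi * x)) * sinh (pi * x) - pi * cosh (pi * x) * (pi * cosh (pi * x)))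
     = - pi\<^sup>2 * ((cosh (pi * x))\<^sup>2 - (sinh (pi * x))\<^sup>2)" by (simp add: power2_eq_square algebra_simps)
  also have "\<dots> = - pi\<^sup>2" by (simp only: hyperbolic_pythagoras mult_1_right)
  finally have "((\<lambda>x. \<Sum>k. 2 * x / (x\<^sup>2 + (real (Suc k))\<^sup>2)) has_field_derivative
         (- pi\<^sup>2 / (sinh (pi * x))\<^sup>2 + 1 / x\<^sup>2)) (at x)"
    by (subst DERIV_cong_ev[OF refl ev refl])
  with der have "(\<Sum>k. ?d k x) = - pi\<^sup>2 / (sinh (pi * x))\<^sup>2 + 1 / x\<^sup>2"
    by (rule DERIV_unique)
  moreover have "summable (\<lambda>k. ?d k x)"
    using uniformly_convergent_imp_convergent[OF unif, of x] assms by (simp add: S_def summable_iff_convergent)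
  ultimately have "(\<lambda>k. ?d k x) sums (- pi\<^sup>2 / (sinh (pi * x))\<^sup>2 + 1 / x\<^sup>2)" by (simp add: sums_iff)
  from sums_mult[OF this, of "- 1 / 2"] show ?thesis
    unfolding h1 h2 .
qed

section \<open>Interchange of summation in a conditionally convergent lattice sum\<close>

text \<open>Fubini for double series dominated by a product of two summable sequences. Row and
  column sums enter as \<open>sums\<close> facts, so that their closed forms can be compared
  directly.\<close>

lemma sums_swap:
  fixes f :: "nat \<Rightarrow> nat \<Rightarrow> 'a :: banach"
  assumes bound: "\<And>m l. norm (f m l) \<le> a m * b l"
    and a: "summable a" "\<And>m. a m \<ge> 0" and b: "summable b" "\<And>l. b l \<ge> 0"
    and r: "\<And>m. f m sums r m" and c: "\<And>l. (\<lambda>m. f m l) sums c l"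
  shows "summable r" "c sums suminf r"
proof -
  have has: "(g has_sum suminf g) UNIV" if "summable g" "\<And>n. g n \<ge> 0" for g :: "nat \<Rightarrow> real"
    using norm_summable_imp_has_sum[of g "suminf g"] that by (simp add: summable_sums)
  have ab: "(\<lambda>(m, l). a m * b l) summable_on (UNIV \<times> UNIV)"
  proof (rule summable_on_SigmaI)
    show "((\<lambda>l. case (m, l) of (m, l) \<Rightarrow> a m * b l) has_sum a m * suminf b) UNIV" for m
      by (simp add: has_sum_cmult_right has[OF b])
    show "(\<lambda>m. a m * suminf b) summable_on UNIV"
      using has[OF a] by (intro summable_on_cmult_left) (auto simp: summable_on_def)
  qed (use a b in auto)
  have "(\<lambda>x. norm ((\<lambda>(m, l). f m l) x)) summable_on (UNIV \<times> UNIV)"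
    by (rule Infinite_Sum.abs_summable_on_comparison_test'[OF ab]) (use bound in auto)
  then have S: "(\<lambda>(m, l). f m l) summable_on (UNIV \<times> UNIV)"
    by (rule Infinite_Sum.abs_summable_summable)
  then have S': "(\<lambda>(l, m). f m l) summable_on (UNIV \<times> UNIV)"
    by (subst (asm) summable_on_swap) (simp add: case_prod_unfold)
  have sums_inf: "infsum g UNIV = s" if "g summable_on UNIV" "g sums s" for g :: "nat \<Rightarrow> 'a" and s
    using has_sum_imp_sums[OF has_sum_infsum[OF that(1)]] that(2) sums_unique2 by blast
  have nb: "summable (\<lambda>l. norm (f m l))" for m
    by (rule summable_comparison_test'[of "\<lambda>l. a m * b l"]) (use bound b in \<open>auto intro: summable_mult\<close>)
  have na: "summable (\<lambda>m. norm (f m l))" for l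
    by (rule summable_comparison_test'[of "\<lambda>m. a m * b l"]) (use bound a in \<open>auto intro: summable_mult2\<close>)
  have row: "infsum (\<lambda>l. f m l) UNIV = r m" for m
    by (intro sums_inf norm_summable_imp_summable_on nb r)
  have col: "infsum (\<lambda>m. f m l) UNIV = c l" for l
    by (intro sums_inf norm_summable_imp_summable_on na c)
  have r': "r summable_on UNIV" using summable_on_Sigma_banach[OF S] by (simp add: row)
  have c': "c summable_on UNIV" using summable_on_Sigma_banach[OF S'] by (simp add: col)
  have rs: "r sums infsum r UNIV" and cs: "c sums infsum c UNIV"
    using has_sum_infsum[OF r'] has_sum_infsum[OF c'] by (auto intro: has_sum_imp_sums)
  show "summable r" using rs by (rule sums_summable)
  have "infsum r UNIV = infsum c UNIV"
    using infsum_swap_banach[OF S] by (simp add: row col)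
  then show "c sums suminf r" using rs cs by (simp add: sums_iff)
qed

text \<open>The lattice sum of \<open>Re (1 / (m \<tau> + i l)\<^sup>2)\<close> converges only conditionally. Replacing the summand by its
  average over the cell \<open>[l - 1/2, l + 1/2]\<close>, which telescopes in \<open>l\<close>, leaves an absolutely convergent
  difference; the two orders of summation therefore differ by an explicit boundary term.\<close>

lemma lattice_sum_cell_bound:
  fixes a b :: real
  assumes "a > 0" "b \<ge> 1"
  shows "\<bar>(a\<^sup>2 - b\<^sup>2) / (a\<^sup>2 + b\<^sup>2)\<^sup>2 - ((b + 1/2) / (a\<^sup>2 + (b + 1/2)\<^sup>2) - (b - 1/2) / (a\<^sup>2 + (b - 1/2)\<^sup>2))\<bar>
         \<le> 1 / (2 * (a\<^sup>2 * b\<^sup>2))"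
proof -
  define N where "N = a\<^sup>2 + b\<^sup>2"
  define d where "d = a\<^sup>2 - b\<^sup>2"
  \<comment> \<open>The product of the two denominators at the ends of the cell, see
    \<open>DD\<close>.\<close>
  define D where "D = N\<^sup>2 + d / 2 + 1 / 16"
  have b2: "b\<^sup>2 \<ge> 1" using assms by (simp add: one_le_power)
  then have N1: "N > 1" unfolding N_def using assms by (smt (verit) zero_less_power)
  have dN: "\<bar>d\<bar> \<le> N" unfolding d_def N_def by (simp add: abs_le_iff)
  have NN: "N \<le> N\<^sup>2" using N1 by (simp add: power2_eq_square)
  have D1: "D \<ge> N\<^sup>2 / 2" using dN NN N1 unfolding D_def by linarith
  have "N\<^sup>2 > 0" using N1 by simp
  with D1 have D: "D \<ge> N\<^sup>2 / 2" "D > 0" by linarith+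
  have p1: "a\<^sup>2 + (b + 1/2)\<^sup>2 > 0" "a\<^sup>2 + (b - 1/2)\<^sup>2 > 0" using assms by (auto intro: add_pos_nonneg)
  have DD: "(a\<^sup>2 + (b + 1/2)\<^sup>2) * (a\<^sup>2 + (b - 1/2)\<^sup>2) = D"
    unfolding D_def N_def d_def by (simp add: power2_eq_square field_simps)
  have "(b + 1/2) / (a\<^sup>2 + (b + 1/2)\<^sup>2) - (b - 1/2) / (a\<^sup>2 + (b - 1/2)\<^sup>2)
     = ((b + 1/2) * (a\<^sup>2 + (b - 1/2)\<^sup>2) - (b - 1/2) * (a\<^sup>2 + (b + 1/2)\<^sup>2)) / D"
    unfolding DD[symmetric] using p1 by (subst diff_frac_eq) auto
  also have "(b + 1/2) * (a\<^sup>2 + (b - 1/2)\<^sup>2) - (b - 1/2) * (a\<^sup>2 + (b + 1/2)\<^sup>2) = d + 1/4"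
    unfolding d_def by (simp add: power2_eq_square algebra_simps)
  finally have "d / N\<^sup>2 - ((b + 1/2) / (a\<^sup>2 + (b + 1/2)\<^sup>2) - (b - 1/2) / (a\<^sup>2 + (b - 1/2)\<^sup>2))
     = (d * D - (d + 1/4) * N\<^sup>2) / (N\<^sup>2 * D)"
    using D N1 by (simp add: diff_frac_eq mult.commute)
  \<comment> \<open>The products of d with N^2 cancel. The remaining numerator has size N^2, so the
    difference is O(1 / D), a factor N smaller than the general size 1 / N of the kernel.\<close>
  also have "d * D - (d + 1/4) * N\<^sup>2 = d\<^sup>2 / 2 + d / 16 - N\<^sup>2 / 4"
    unfolding D_def by (simp add: power2_eq_square algebra_simps)
  finally have *: "\<bar>d / N\<^sup>2 - ((b + 1/2) / (a\<^sup>2 + (b + 1/2)\<^sup>2) - (b - 1/2) / (a\<^sup>2 + (b - 1/2)\<^sup>2))\<bar>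
     = \<bar>d\<^sup>2 / 2 + d / 16 - N\<^sup>2 / 4\<bar> / (N\<^sup>2 * D)" using D by (simp add: abs_mult)
  have "d\<^sup>2 \<le> N\<^sup>2" using dN by (simp add: abs_le_square_iff[symmetric] abs_le_iff)
  then have "\<bar>d\<^sup>2 / 2 + d / 16 - N\<^sup>2 / 4\<bar> \<le> N\<^sup>2"
    using dN NN zero_le_power2[of d] zero_le_power2[of N] unfolding abs_le_iff by (intro conjI; linarith)
  then have "\<bar>d\<^sup>2 / 2 + d / 16 - N\<^sup>2 / 4\<bar> / (N\<^sup>2 * D) \<le> N\<^sup>2 / (N\<^sup>2 * D)"
    by (rule divide_right_mono) (use D in auto)
  also have "\<dots> = 1 / D" using N1 by simp
  also have "\<dots> \<le> 1 / (N\<^sup>2 / 2)" by (rule divide_left_mono) (use D N1 in auto)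
  \<comment> \<open>The inequality of the means splits the bound into a function of a times a
    function of b, as \<open>sums_swap\<close> requires.\<close>
  also have "\<dots> \<le> 1 / ((4 * (a\<^sup>2 * b\<^sup>2)) / 2)"
  proof (rule divide_left_mono)
    have "0 \<le> (a\<^sup>2 - b\<^sup>2)\<^sup>2" by simp
    then show "4 * (a\<^sup>2 * b\<^sup>2) / 2 \<le> N\<^sup>2 / 2" unfolding N_def by (simp add: power2_eq_square algebra_simps)
  qed (use assms N1 in auto)
  finally show ?thesis using * unfolding d_def N_def by simp
qed

text \<open>In row order the averages telescope to \<open>- H m 0\<close>, because
  \<open>H m l\<close> vanishes as l grows. In column order the sum over m comes first and gives
  coth values, which make the averages tend to pi / (2 \<tau>) instead of 0. This limit is the whole
  discrepancy between the two orders and, doubled, becomes the term - pi / \<tau>.\<close>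

lemma lattice_sum_swap:
  fixes \<tau> :: real
  assumes "\<tau> > 0"
  defines "E \<equiv> \<lambda>x. pi\<^sup>2 / (sinh (pi * x))\<^sup>2"
  assumes sE: "summable (\<lambda>m. E (real (Suc m) * \<tau>))" "summable (\<lambda>l. E (real (Suc l) / \<tau>))"
  shows "(\<Sum>m. E (real (Suc m) * \<tau>)) + (\<Sum>l. E (real (Suc l) / \<tau>)) / \<tau>\<^sup>2
           = pi\<^sup>2 / (6 * \<tau>\<^sup>2) + pi\<^sup>2 / 6 - pi / \<tau>"
proof -
  define c where "c = (\<lambda>m. real (Suc m) * \<tau>)"
  have c: "c m > 0" for m using assms by (simp add: c_def)
  define k where "k = (\<lambda>m l. ((c m)\<^sup>2 - (real (Suc l))\<^sup>2) / ((c m)\<^sup>2 + (real (Suc l))\<^sup>2)\<^sup>2)"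
  \<comment> \<open>An antiderivative in l of the kernel \<open>k\<close>, taken at the lower end of
    the cell around \<open>Suc l\<close>; hence \<open>K m l\<close> is the average of the kernel
    over that cell.\<close>
  define H where "H = (\<lambda>m l. (real l + 1/2) / ((c m)\<^sup>2 + (real l + 1/2)\<^sup>2))"
  define K where "K = (\<lambda>m l. H m (Suc l) - H m l)"
  have z2: "(\<lambda>n. 1 / (real (Suc n))\<^sup>2) sums (pi\<^sup>2 / 6)"
    using inverse_squares_sums by simp
  have krow: "k m sums ((E (c m) - 1 / (c m)\<^sup>2) / 2)" for m
    unfolding k_def E_def using sums_inverse_sinh_squared[OF c] by simp
  \<comment> \<open>Exchanging m and l replaces \<tau> by 1 / \<tau> and multiplies the kernel by -
    1 / \<tau>^2, so the columns are rows of the inverted lattice.\<close>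
  have kcol: "(\<lambda>m. k m l) sums (- ((E (real (Suc l) / \<tau>) - \<tau>\<^sup>2 / (real (Suc l))\<^sup>2) / 2) / \<tau>\<^sup>2)" for l
  proof -
    define b where "b = real (Suc l)"
    have b: "b > 0" by (simp add: b_def)
    have "(\<lambda>m. ((b / \<tau>)\<^sup>2 - (real (Suc m))\<^sup>2) / ((b / \<tau>)\<^sup>2 + (real (Suc m))\<^sup>2)\<^sup>2) sums ((E (b / \<tau>) - 1 / (b / \<tau>)\<^sup>2) / 2)"
      unfolding E_def using b assms by (intro sums_inverse_sinh_squared) simp
    then have "(\<lambda>m. (- 1 / \<tau>\<^sup>2) * (((b / \<tau>)\<^sup>2 - (real (Suc m))\<^sup>2) / ((b / \<tau>)\<^sup>2 + (real (Suc m))\<^sup>2)\<^sup>2))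
         sums ((- 1 / \<tau>\<^sup>2) * ((E (b / \<tau>) - 1 / (b / \<tau>)\<^sup>2) / 2))"
      by (rule sums_mult)
    moreover have "(- 1 / \<tau>\<^sup>2) * (((b / \<tau>)\<^sup>2 - (real (Suc m))\<^sup>2) / ((b / \<tau>)\<^sup>2 + (real (Suc m))\<^sup>2)\<^sup>2) = k m l" for m
    proof -
      define M where "M = real (Suc m)"
      have M: "M > 0" by (simp add: M_def)
      have 1: "(b / \<tau>)\<^sup>2 + M\<^sup>2 = (M\<^sup>2 * \<tau>\<^sup>2 + b\<^sup>2) / \<tau>\<^sup>2" "(b / \<tau>)\<^sup>2 - M\<^sup>2 = - (M\<^sup>2 * \<tau>\<^sup>2 - b\<^sup>2) / \<tau>\<^sup>2"
        using assms(1) by (simp_all add: field_simps)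
      have "(- 1 / \<tau>\<^sup>2) * (- x / \<tau>\<^sup>2 / (y / \<tau>\<^sup>2)\<^sup>2) = x / y\<^sup>2" for x y :: real
        using assms(1) by (simp add: power_divide power2_eq_square)
      then show ?thesis
        unfolding k_def c_def M_def[symmetric] b_def[symmetric] 1 power_mult_distrib by blast
    qed
    ultimately show ?thesis unfolding b_def[symmetric] using b assms by (simp add: power_divide mult.commute)
  qed
  have bound: "\<bar>k m l - K m l\<bar> \<le> 1 / (2 * \<tau>\<^sup>2) * (1 / (real (Suc m))\<^sup>2 * (1 / (real (Suc l))\<^sup>2))" for m l
  proof -
    have "\<bar>k m l - K m l\<bar> \<le> 1 / (2 * ((c m)\<^sup>2 * (real (Suc l))\<^sup>2))"
      using lattice_sum_cell_bound[OF c[of m], of "real (Suc l)"]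
      unfolding k_def K_def H_def by (simp add: add.commute)
    then show ?thesis by (simp add: c_def power_mult_distrib mult_ac)
  qed
  have half: "(\<lambda>l. H m l) \<longlonglongrightarrow> 0" for m
    unfolding H_def using c[of m] by real_asymp
  have Krow: "K m sums (0 - H m 0)" for m
    unfolding K_def by (rule telescope_sums) (rule half)
  define T where "T = (\<lambda>l. pi / (2 * \<tau>) * (cosh (pi * ((real l + 1/2) / \<tau>)) / sinh (pi * ((real l + 1/2) / \<tau>))) - 1 / (2 * (real l + 1/2)))"
  have Hcol: "(\<lambda>m. H m l) sums T l" for l
  proof -
    define b where "b = real l + 1/2"
    have b: "b > 0" by (simp add: b_def add_nonneg_pos)
    have "(\<lambda>m. 1 / (2 * \<tau>) * (2 * (b / \<tau>) / ((b / \<tau>)\<^sup>2 + (real (Suc m))\<^sup>2))) sums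
       (1 / (2 * \<tau>) * (pi * cosh (pi * (b / \<tau>)) / sinh (pi * (b / \<tau>)) - 1 / (b / \<tau>)))"
      by (intro sums_mult sums_coth_partial_fractions) (use b assms in simp)
    also have "1 / (2 * \<tau>) * (pi * cosh (pi * (b / \<tau>)) / sinh (pi * (b / \<tau>)) - 1 / (b / \<tau>)) = T l"
      using b assms(1) unfolding T_def b_def[symmetric] by (simp add: right_diff_distrib)
    also have "(\<lambda>m. 1 / (2 * \<tau>) * (2 * (b / \<tau>) / ((b / \<tau>)\<^sup>2 + (real (Suc m))\<^sup>2))) = (\<lambda>m. H m l)"
    proof
      fix m
      have "b\<^sup>2 + (c m)\<^sup>2 > 0" using b by (simp add: add_pos_nonneg)
      then have "(b / \<tau>)\<^sup>2 + (real (Suc m))\<^sup>2 = (b\<^sup>2 + (c m)\<^sup>2) / \<tau>\<^sup>2"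
        using assms(1) unfolding c_def by (simp add: power_mult_distrib power_divide add_divide_distrib)
      then show "1 / (2 * \<tau>) * (2 * (b / \<tau>) / ((b / \<tau>)\<^sup>2 + (real (Suc m))\<^sup>2)) = H m l"
        unfolding H_def b_def[symmetric] using assms(1) by (simp add: add.commute power2_eq_square)
    qed
    finally show ?thesis .
  qed
  have "(\<lambda>l. cosh (pi * ((real l + 1/2) / \<tau>)) / sinh (pi * ((real l + 1/2) / \<tau>))) \<longlonglongrightarrow> 1"
    unfolding cosh_field_def sinh_field_def using assms(1) by real_asymp
  then have "T \<longlonglongrightarrow> pi / (2 * \<tau>) * 1 - 0"
    unfolding T_def by (intro tendsto_diff tendsto_mult tendsto_const) (assumption, real_asymp)
  then have TT: "(\<lambda>l. T (Suc l) - T l) sums (pi / (2 * \<tau>) - T 0)"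
    using telescope_sums[of T] by simp
  define kr where "kr = (\<lambda>m. (E (c m) - 1 / (c m)\<^sup>2) / 2)"
  define kc where "kc = (\<lambda>l. - ((E (real (Suc l) / \<tau>) - \<tau>\<^sup>2 / (real (Suc l))\<^sup>2) / 2) / \<tau>\<^sup>2)"
  have row: "(\<lambda>l. k m l - K m l) sums (kr m + H m 0)" for m
    using sums_diff[OF krow[of m] Krow[of m]] unfolding kr_def by simp
  have col: "(\<lambda>m. k m l - K m l) sums (kc l - (T (Suc l) - T l))" for l
    unfolding K_def kc_def by (intro sums_diff kcol Hcol)
  have "(\<lambda>l. kc l - (T (Suc l) - T l)) sums (\<Sum>m. kr m + H m 0)"
    by (rule sums_swap(2)[OF _ _ _ _ _ row col, where a = "\<lambda>m. 1 / (2 * \<tau>\<^sup>2) * (1 / (real (Suc m))\<^sup>2)" and b = "\<lambda>l. 1 / (real (Suc l))\<^sup>2"])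
      (use bound in \<open>auto intro!: summable_mult[OF summable_inverse_Suc_squared] summable_inverse_Suc_squared simp del: of_nat_Suc times_divide_eq_right times_divide_eq_left simp: mult.assoc\<close>)
  moreover have "kr sums ((suminf (\<lambda>m. E (c m)) - pi\<^sup>2 / 6 / \<tau>\<^sup>2) / 2)"
  proof -
    have "(\<lambda>m. (E (c m) - 1 / (real (Suc m))\<^sup>2 / \<tau>\<^sup>2) / 2) sums ((suminf (\<lambda>m. E (c m)) - pi\<^sup>2 / 6 / \<tau>\<^sup>2) / 2)"
      by (intro sums_divide sums_diff summable_sums z2) (use sE in \<open>simp add: c_def\<close>)
    then show ?thesis by (simp add: kr_def c_def power_mult_distrib)
  qed
  then have "(\<lambda>m. kr m + H m 0) sums ((suminf (\<lambda>m. E (c m)) - pi\<^sup>2 / 6 / \<tau>\<^sup>2) / 2 + T 0)"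
    by (intro sums_add Hcol)
  moreover have "kc sums (- ((suminf (\<lambda>l. E (real (Suc l) / \<tau>)) - \<tau>\<^sup>2 * (pi\<^sup>2 / 6)) / 2) / \<tau>\<^sup>2)"
  proof -
    have "(\<lambda>l. - ((E (real (Suc l) / \<tau>) - \<tau>\<^sup>2 * (1 / (real (Suc l))\<^sup>2)) / 2) / \<tau>\<^sup>2) sums
      (- ((suminf (\<lambda>l. E (real (Suc l) / \<tau>)) - \<tau>\<^sup>2 * (pi\<^sup>2 / 6)) / 2) / \<tau>\<^sup>2)"
      by (intro sums_divide sums_minus sums_mult sums_diff summable_sums z2 sE)
    then show ?thesis by (simp add: kc_def)
  qed
  then have "(\<lambda>l. kc l - (T (Suc l) - T l)) sums
     (- ((suminf (\<lambda>l. E (real (Suc l) / \<tau>)) - \<tau>\<^sup>2 * (pi\<^sup>2 / 6)) / 2) / \<tau>\<^sup>2 - (pi / (2 * \<tau>) - T 0))"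
    by (intro sums_diff TT)
  ultimately have "(suminf (\<lambda>m. E (c m)) - pi\<^sup>2 / 6 / \<tau>\<^sup>2) / 2 =
     - ((suminf (\<lambda>l. E (real (Suc l) / \<tau>)) - \<tau>\<^sup>2 * (pi\<^sup>2 / 6)) / 2) / \<tau>\<^sup>2 - pi / (2 * \<tau>)"
    by (simp add: sums_iff)
  then show ?thesis using assms(1) unfolding c_def by (simp add: field_simps)
qed

text \<open>\<open>lam t\<close> is the logarithm of \<open>1 / (\<Prod>n\<ge>1. 1 - q ^ n)\<close> at \<open>q = exp (- t)\<close>.\<close>

definition lam_term :: "nat \<Rightarrow> complex \<Rightarrow> complex" where
  "lam_term m t = exp (- (of_nat (Suc m) * t)) / (1 - exp (- (of_nat (Suc m) * t))) / of_nat (Suc m)"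

definition lam :: "complex \<Rightarrow> complex" where
  "lam t = (\<Sum>m. lam_term m t)"

section \<open>Holomorphy and modular transformation of \<open>lam\<close>\<close>

lemma norm_exp_Suc: "norm (exp (- (of_nat (Suc m) * t))) = exp (- Re t) ^ Suc m" for t :: complex
proof -
  have "norm (exp (- (of_nat (Suc m) * t))) = exp (- (of_nat (Suc m) * Re t))"
    by (simp del: of_nat_Suc)
  also have "\<dots> = exp (- Re t) ^ Suc m" by (simp only: exp_of_nat_mult flip: mult_minus_right)
  finally show ?thesis .
qed

lemma norm_one_minus_exp_ge:
  fixes t :: complex
  assumes "Re t \<ge> r" "r > 0"
  shows "norm (1 - exp (- (of_nat (Suc m) * t))) \<ge> 1 - exp (- r)"
    and "norm (exp (- (of_nat (Suc m) * t))) \<le> exp (- r) ^ Suc m"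
    and "1 - exp (- (of_nat (Suc m) * t)) \<noteq> 0"
proof -
  show 1: "norm (exp (- (of_nat (Suc m) * t))) \<le> exp (- r) ^ Suc m"
    unfolding norm_exp_Suc using assms by (intro power_mono) auto
  have "exp (- r) ^ Suc m \<le> exp (- r) ^ 1" using assms by (intro power_decreasing) auto
  with 1 show 2: "norm (1 - exp (- (of_nat (Suc m) * t))) \<ge> 1 - exp (- r)"
    using norm_triangle_ineq2[of 1 "exp (- (of_nat (Suc m) * t))"] by (simp only: norm_one power_one_right)
  have "exp (- r) < 1" using assms by simp
  then show "1 - exp (- (of_nat (Suc m) * t)) \<noteq> 0"
    using 2 by (metis diff_gt_0_iff_gt norm_zero not_le)
qed

lemma summable_exp_Suc: "r > 0 \<Longrightarrow> summable (\<lambda>m. exp (- r :: real) ^ Suc m)"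
  by (simp add: summable_Suc_iff[of "\<lambda>m. exp (- r) ^ m"] del: power_Suc)

lemma norm_lam_term_le:
  assumes "Re t \<ge> r" "r > 0"
  shows "norm (lam_term m t) \<le> exp (- r) ^ Suc m * (1 / (1 - exp (- r)))"
proof -
  have "norm (lam_term m t) \<le> exp (- r) ^ Suc m / (1 - exp (- r)) / real (Suc m)"
    unfolding lam_term_def norm_divide norm_of_nat using assms
    by (intro divide_right_mono frac_le norm_one_minus_exp_ge[OF assms]) auto
  also have "\<dots> \<le> exp (- r) ^ Suc m / (1 - exp (- r)) / 1"
    using assms by (intro divide_left_mono) auto
  finally show ?thesis by simp
qed

lemma summable_norm_lam_term:
  assumes "Re t > 0"
  shows "summable (\<lambda>m. norm (lam_term m t))"
  by (rule summable_comparison_test'[of "\<lambda>m. exp (- Re t) ^ Suc m * (1 / (1 - exp (- Re t)))"])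
    (use assms norm_lam_term_le[of "Re t" t] in \<open>simp_all only: summable_mult2[OF summable_exp_Suc] real_norm_def abs_norm_cancel order_refl\<close>)

lemma lam_sums: "Re t > 0 \<Longrightarrow> (\<lambda>m. lam_term m t) sums lam t"
  unfolding lam_def by (rule summable_sums[OF summable_norm_cancel[OF summable_norm_lam_term]])

text \<open>The inner derivative cancels the denominator \<open>Suc m\<close> of
  \<open>lam_term\<close>. On the real axis each remaining w / (1 - w)^2 is a value of 1 / (4
  sinh^2), which links the derivative to the lattice sum.\<close>

lemma DERIV_lam:
  assumes "Re t > 0"
  defines "w \<equiv> \<lambda>m t. exp (- (of_nat (Suc m) * t))"
  shows "(lam has_field_derivative (\<Sum>m. - (w m t / (1 - w m t)\<^sup>2))) (at t)"
    and "summable (\<lambda>m. - (w m t / (1 - w m t)\<^sup>2))"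
proof -
  define r where "r = Re t / 2"
  have r: "r > 0" "Re t > r" using assms by (auto simp: r_def)
  define S where "S = {z. Re z > r}"
  have op: "open S" unfolding S_def by (simp add: open_halfspace_Re_gt)
  have cS: "convex S" unfolding S_def by (rule convex_halfspace_Re_gt)
  have t: "t \<in> interior S" using op r by (simp add: interior_open S_def)
  have sub: "((\<lambda>z. lam_term m z) has_field_derivative - (w m z / (1 - w m z)\<^sup>2)) (at z within S)" if "z \<in> S" for m z
  proof -
    have "1 - w m z \<noteq> 0"
      unfolding w_def by (rule norm_one_minus_exp_ge(3)[of r]) (use that r in \<open>auto simp: S_def\<close>)
    then have "((\<lambda>u. u / (1 - u)) has_field_derivative 1 / (1 - w m z)\<^sup>2) (at (w m z))"
      by (auto intro!: derivative_eq_intros simp: field_simps power2_eq_square)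
    then have "((\<lambda>u. u / (1 - u) / of_nat (Suc m)) has_field_derivative 1 / (1 - w m z)\<^sup>2 / of_nat (Suc m)) (at (w m z))"
      by (rule DERIV_cdivide)
    moreover have "(w m has_field_derivative - of_nat (Suc m) * w m z) (at z within S)"
      unfolding w_def by (auto intro!: derivative_eq_intros simp del: of_nat_Suc)
    ultimately have "((\<lambda>z. w m z / (1 - w m z) / of_nat (Suc m)) has_field_derivative
        1 / (1 - w m z)\<^sup>2 / of_nat (Suc m) * (- of_nat (Suc m) * w m z)) (at z within S)"
      by (rule DERIV_chain2)
    moreover have "1 / (1 - w m z)\<^sup>2 / of_nat (Suc m) * (- of_nat (Suc m) * w m z) = - (w m z / (1 - w m z)\<^sup>2)"
      by (simp del: of_nat_Suc)
    ultimately show ?thesis unfolding lam_term_def w_def by simp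
  qed
  have unif: "uniformly_convergent_on S (\<lambda>n z. \<Sum>m<n. - (w m z / (1 - w m z)\<^sup>2))"
  proof (rule Weierstrass_m_test')
    show "summable (\<lambda>m. exp (- r) ^ Suc m * (1 / (1 - exp (- r))\<^sup>2))"
      by (intro summable_mult2 summable_exp_Suc r)
    show "norm (- (w m z / (1 - w m z)\<^sup>2)) \<le> exp (- r) ^ Suc m * (1 / (1 - exp (- r))\<^sup>2)" if "z \<in> S" for m z
    proof -
      have "Re z \<ge> r" using that by (simp add: S_def)
      note * = norm_one_minus_exp_ge[OF this r(1), of m]
      have "norm (- (w m z / (1 - w m z)\<^sup>2)) = norm (w m z) / norm (1 - w m z) ^ 2"
        by (simp add: norm_divide norm_power)
      also have "\<dots> \<le> exp (- r) ^ Suc m / (1 - exp (- r))\<^sup>2"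
        unfolding w_def using * r by (intro frac_le power_mono) auto
      finally show ?thesis by simp
    qed
  qed
  have "t \<in> S" using r by (simp add: S_def)
  have sm: "summable (\<lambda>m. lam_term m t)" using lam_sums[OF assms(1)] by (rule sums_summable)
  show "(lam has_field_derivative (\<Sum>m. - (w m t / (1 - w m t)\<^sup>2))) (at t)"
    unfolding lam_def[abs_def]
    by (rule has_field_derivative_series'(2)[OF cS sub unif \<open>t \<in> S\<close> sm t])
  show "summable (\<lambda>m. - (w m t / (1 - w m t)\<^sup>2))"
    using uniformly_convergent_imp_convergent[OF unif \<open>t \<in> S\<close>] by (simp add: summable_iff_convergent)
qed

lemma holomorphic_on_lam: "lam holomorphic_on {t. Re t > 0}"
  using DERIV_lam(1) by (auto simp: holomorphic_on_open open_halfspace_Re_gt)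

lemma lam_of_real: "lam (of_real x) = of_real (Re (lam (of_real x)))" if "x > 0"
proof -
  have "lam_term m (of_real x) = of_real (exp (- (real (Suc m) * x)) / (1 - exp (- (real (Suc m) * x))) / real (Suc m))" for m
    unfolding lam_term_def
    by (simp only: of_real_divide of_real_diff of_real_1 of_real_of_nat_eq of_real_minus of_real_mult flip: exp_of_real)
  then have "Im (lam_term m (of_real x)) = 0" for m
    by (simp only: Im_complex_of_real)
  then have "Im (lam (of_real x)) = 0"
    using sums_Im[OF lam_sums[of "of_real x"]] that by (simp add: sums_iff)
  then show ?thesis by (simp add: complex_eq_iff)
qed

text \<open>By \<open>lattice_sum_swap\<close> the difference of the two sides has derivative zero
  in \<tau>, and it vanishes at the fixed point \<tau> = 1 of the inversion.\<close>

lemma lam_transformation_real: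
  fixes \<tau> :: real
  assumes "\<tau> > 0"
  shows "Re (lam (of_real (2 * pi * \<tau>))) =
           Re (lam (of_real (2 * pi / \<tau>))) + pi / (12 * \<tau>) - pi * \<tau> / 12 + ln \<tau> / 2"
proof -
  define E where "E = (\<lambda>x::real. pi\<^sup>2 / (sinh (pi * x))\<^sup>2)"
  define L where "L = (\<lambda>x. Re (lam (of_real (2 * pi * x))))"
  have w: "exp (- (of_nat (Suc m) * of_real (2 * pi * x))) / (1 - exp (- (of_nat (Suc m) * of_real (2 * pi * x))))\<^sup>2
     = complex_of_real (E (real (Suc m) * x) / (4 * pi\<^sup>2))" if "x > 0" for m x
  proof -
    define y where "y = pi * (real (Suc m) * x)"
    have y: "y > 0" using that by (simp add: y_def)
    have "exp (- (of_nat (Suc m) * complex_of_real (2 * pi * x))) = of_real (exp (- (2 * y)))"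
      unfolding y_def by (simp add: mult_ac flip: exp_of_real)
    moreover have "exp (- (2 * y)) / (1 - exp (- (2 * y)))\<^sup>2 = 1 / (4 * (sinh y)\<^sup>2)"
    proof -
      have e: "exp (- (2 * y)) = exp (- y) * exp (- y)" by (simp flip: exp_add)
      have "1 - exp (- (2 * y)) = exp (- y) * (exp y - exp (- y))"
        unfolding e by (simp add: right_diff_distrib exp_minus_inverse mult.commute[of _ "exp y"])
      also have "\<dots> = 2 * exp (- y) * sinh y" by (simp add: sinh_field_def)
      finally have "(1 - exp (- (2 * y)))\<^sup>2 = exp (- (2 * y)) * (4 * (sinh y)\<^sup>2)"
        unfolding e by (simp add: power2_eq_square)
      then show ?thesis by simp
    qed
    ultimately have "exp (- (of_nat (Suc m) * of_real (2 * pi * x))) / (1 - exp (- (of_nat (Suc m) * of_real (2 * pi * x))))\<^sup>2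
      = complex_of_real (1 / (4 * (sinh y)\<^sup>2))" by (metis of_real_1 of_real_diff of_real_divide of_real_power)
    then show ?thesis unfolding E_def y_def by simp
  qed
  have sE: "summable (\<lambda>m. E (real (Suc m) * x))"
    and DL: "(L has_real_derivative (- (\<Sum>m. E (real (Suc m) * x)) / (2 * pi))) (at x)" if "x > 0" for x
  proof -
    have pos: "Re (of_real (2 * pi * x)) > 0" using that by simp
    note D = DERIV_lam[OF pos, unfolded w[OF that]]
    from D(2) have "summable (\<lambda>m. (- 4 * pi\<^sup>2) * Re (- of_real (E (real (Suc m) * x) / (4 * pi\<^sup>2))))"
      by (intro summable_mult summable_Re)
    then show s: "summable (\<lambda>m. E (real (Suc m) * x))" by simp
    have "(\<Sum>m. - complex_of_real (E (real (Suc m) * x) / (4 * pi\<^sup>2))) = of_real (- (\<Sum>m. E (real (Suc m) * x)) / (4 * pi\<^sup>2))"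
    proof (rule sums_unique[symmetric])
      have "(\<lambda>m. - (E (real (Suc m) * x) / (4 * pi\<^sup>2))) sums (- ((\<Sum>m. E (real (Suc m) * x)) / (4 * pi\<^sup>2)))"
        by (intro sums_minus sums_divide summable_sums s)
      from sums_of_real[OF this, where 'a = complex]
      show "(\<lambda>m. - complex_of_real (E (real (Suc m) * x) / (4 * pi\<^sup>2))) sums of_real (- (\<Sum>m. E (real (Suc m) * x)) / (4 * pi\<^sup>2))"
        by simp
    qed
    with D(1) have "(lam has_field_derivative of_real (- (\<Sum>m. E (real (Suc m) * x)) / (4 * pi\<^sup>2))) (at (of_real (2 * pi * x)))"
      by simp
    then have "((\<lambda>x. lam (of_real x)) has_vector_derivative of_real (- (\<Sum>m. E (real (Suc m) * x)) / (4 * pi\<^sup>2))) (at (2 * pi * x))"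
      by (rule has_vector_derivative_real_field)
    from bounded_linear.has_vector_derivative[OF bounded_linear_Re this]
    have "((\<lambda>x. Re (lam (of_real x))) has_real_derivative - (\<Sum>m. E (real (Suc m) * x)) / (4 * pi\<^sup>2)) (at (2 * pi * x))"
      by (simp add: has_real_derivative_iff_has_vector_derivative)
    then have "(L has_real_derivative - (\<Sum>m. E (real (Suc m) * x)) / (4 * pi\<^sup>2) * (2 * pi)) (at x)"
      unfolding L_def by (rule DERIV_chain2[where g = "\<lambda>x. 2 * pi * x"]) (auto intro!: derivative_eq_intros)
    then show "(L has_real_derivative (- (\<Sum>m. E (real (Suc m) * x)) / (2 * pi))) (at x)"
      by (rule DERIV_cong) (simp add: power2_eq_square)
  qed
  define \<phi> where "\<phi> = (\<lambda>x. L x - L (1 / x) - pi / (12 * x) + pi * x / 12 - ln x / 2)"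
  have "(\<phi> has_real_derivative 0) (at x within {0<..})" if "x \<in> {0<..}" for x
  proof -
    have x: "x > 0" using that by simp
    let ?S1 = "\<Sum>m. E (real (Suc m) * x)" and ?S2 = "\<Sum>l. E (real (Suc l) / x)"
    have D2: "((\<lambda>x. L (1 / x)) has_real_derivative (- ?S2 / (2 * pi)) * (- 1 / x\<^sup>2)) (at x)"
      by (rule DERIV_chain2[where f = L and g = "\<lambda>x. 1 / x"])
        (use x DL[of "1 / x"] in \<open>auto intro!: derivative_eq_intros simp: power2_eq_square\<close>)
    have "((\<lambda>x. - pi / (12 * x) + pi * x / 12 - ln x / 2) has_real_derivative (pi / (12 * x\<^sup>2) + pi / 12 - 1 / (2 * x))) (at x)"
      using x by (auto intro!: derivative_eq_intros simp: power2_eq_square)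
    from DERIV_add[OF DERIV_diff[OF DL[OF x] D2] this]
    have D: "(\<phi> has_real_derivative (- ?S1 / (2 * pi) - (- ?S2 / (2 * pi)) * (- 1 / x\<^sup>2) + (pi / (12 * x\<^sup>2) + pi / 12 - 1 / (2 * x)))) (at x)"
      unfolding \<phi>_def by (simp add: algebra_simps)
    have S: "?S1 + ?S2 / x\<^sup>2 = pi\<^sup>2 / (6 * x\<^sup>2) + pi\<^sup>2 / 6 - pi / x"
      using lattice_sum_swap[of x] sE[OF x] sE[of "1 / x"] x unfolding E_def by simp
    have "- a / (2 * pi) - (- b / (2 * pi)) * (- 1 / x\<^sup>2) + (pi / (12 * x\<^sup>2) + pi / 12 - 1 / (2 * x)) = 0"
      if "a + b / x\<^sup>2 = pi\<^sup>2 / (6 * x\<^sup>2) + pi\<^sup>2 / 6 - pi / x" for a b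
    proof -
      have "- a / (2 * pi) - (- b / (2 * pi)) * (- 1 / x\<^sup>2) = - (a + b / x\<^sup>2) / (2 * pi)"
        using x by (simp add: field_simps)
      also have "\<dots> = - (pi / (12 * x\<^sup>2) + pi / 12 - 1 / (2 * x))"
        unfolding that using x by (simp add: field_simps power2_eq_square)
      finally show ?thesis by simp
    qed
    from D this[OF S] have "(\<phi> has_real_derivative 0) (at x)" by (rule back_subst)
    then show ?thesis by (rule has_field_derivative_at_within)
  qed
  then have "\<exists>c. \<forall>x\<in>{0<..}. \<phi> x = c"
    by (intro has_field_derivative_zero_constant convex_real_interval)
  then obtain c where c: "\<And>x. x \<in> {0<..} \<Longrightarrow> \<phi> x = c" by blast
  have "\<phi> 1 = 0" by (simp add: \<phi>_def)
  then have "\<phi> \<tau> = 0" using c[of 1] c[of \<tau>] assms by simp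
  then show ?thesis unfolding \<phi>_def L_def by simp
qed

text \<open>Continuation from the positive axis by the identity theorem. The principal logarithm is
  holomorphic here because t / (2 pi) stays in the right half-plane.\<close>

lemma lam_transformation:
  fixes t :: complex
  assumes t: "Re t > 0"
  shows "lam t = lam (of_real (4 * pi\<^sup>2) / t) + of_real (pi\<^sup>2 / 6) / t - t / 24 + Ln (t / of_real (2 * pi)) / 2"
proof -
  let ?S = "{t::complex. Re t > 0}"
  let ?g = "\<lambda>t::complex. lam t - (lam (of_real (4 * pi\<^sup>2) / t) + of_real (pi\<^sup>2 / 6) / t - t / 24 + Ln (t / of_real (2 * pi)) / 2)"
  have pos: "Re (of_real (4 * pi\<^sup>2) / t) > 0" if "Re t > 0" for t :: complex
    using that by (simp add: Re_divide zero_less_divide_iff add_pos_nonneg del: of_real_mult of_real_power)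
  have nz: "t \<noteq> 0" if "t \<in> ?S" for t using that by auto
  have h1: "(\<lambda>t. of_real c / t) holomorphic_on ?S" for c
    by (intro holomorphic_on_divide holomorphic_on_const holomorphic_on_ident nz)
  have h2: "(lam \<circ> (\<lambda>t. of_real (4 * pi\<^sup>2) / t)) holomorphic_on ?S"
    by (rule holomorphic_on_compose_gen[OF h1 holomorphic_on_lam]) (use pos in blast)
  have h3: "(\<lambda>t. Ln (t / of_real (2 * pi))) holomorphic_on ?S"
  proof (rule holomorphic_on_Ln')
    show "(\<lambda>t. t / complex_of_real (2 * pi)) holomorphic_on ?S"
      by (intro holomorphic_on_divide holomorphic_on_const holomorphic_on_ident) simp
    show "t / complex_of_real (2 * pi) \<notin> \<real>\<^sub>\<le>\<^sub>0" if "t \<in> ?S" for t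
    proof -
      have "Re (t / complex_of_real (2 * pi)) > 0" using that unfolding Re_divide_of_real by simp
      then show ?thesis unfolding complex_nonpos_Reals_iff by linarith
    qed
  qed
  have hol: "?g holomorphic_on ?S"
    using h2 unfolding o_def
    by (intro holomorphic_on_diff holomorphic_on_add holomorphic_on_lam h1 h3 holomorphic_on_divide
        holomorphic_on_const holomorphic_on_ident) simp_all
  have zero: "?g x = 0" if x: "x \<in> of_real ` {0<..}" for x
  proof -
    from x obtain y :: real where y: "x = of_real y" "y > 0" by auto
    have "2 * pi * (y / (2 * pi)) = y" "2 * pi / (y / (2 * pi)) = 4 * pi\<^sup>2 / y"
      "pi / (12 * (y / (2 * pi))) = pi\<^sup>2 / 6 / y" "pi * (y / (2 * pi)) / 12 = y / 24"
      by (simp_all add: power2_eq_square)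
    with lam_transformation_real[of "y / (2 * pi)"] y(2)
    have eq: "Re (lam (of_real y)) = Re (lam (of_real (4 * pi\<^sup>2 / y))) + pi\<^sup>2 / 6 / y - y / 24 + ln (y / (2 * pi)) / 2"
      by (simp only: zero_less_divide_iff zero_less_mult_iff) (simp add: pi_gt_zero)
    have "lam x = of_real (Re (lam (of_real y)))" using lam_of_real y by simp
    also have "\<dots> = of_real (Re (lam (of_real (4 * pi\<^sup>2 / y)))) + of_real (pi\<^sup>2 / 6) / of_real y - of_real y / 24
        + of_real (ln (y / (2 * pi))) / 2"
      unfolding eq by simp
    also have "of_real (Re (lam (of_real (4 * pi\<^sup>2 / y)))) = lam (of_real (4 * pi\<^sup>2) / x)"
      using lam_of_real[of "4 * pi\<^sup>2 / y"] y by simp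
    also have "complex_of_real (ln (y / (2 * pi))) = Ln (of_real (y / (2 * pi)))"
      using y by (intro Ln_of_real[symmetric]) simp
    also have "\<dots> = Ln (x / of_real (2 * pi))" using y by simp
    finally show ?thesis using y by simp
  qed
  have lim: "(1 :: complex) islimpt of_real ` {0<..}"
    unfolding islimpt_approachable
  proof (intro allI impI)
    fix e :: real assume e: "e > 0"
    have "dist (complex_of_real (1 + e / 2)) 1 < e"
      using e by (simp add: dist_norm)
    moreover have "1 + e / 2 \<in> {0<..}" "complex_of_real (1 + e / 2) \<noteq> 1" using e by (auto simp: complex_eq_iff)
    ultimately show "\<exists>x'\<in>complex_of_real ` {0<..}. x' \<noteq> 1 \<and> dist x' 1 < e" by blast
  qed
  have "?g t = 0"
  proof (rule analytic_continuation[OF hol _ _ _ _ lim zero])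
    show "open ?S" by (rule open_halfspace_Re_gt)
    show "connected ?S" by (rule convex_connected[OF convex_halfspace_Re_gt])
  qed (use t in auto)
  then show ?thesis by simp
qed

section \<open>From the infinite product to the Lambert series; norm bounds; the generating
  function\<close>

definition prod_log :: "complex \<Rightarrow> nat \<Rightarrow> complex" where
  "prod_log t n = - Ln (1 - exp (- (of_nat (Suc n) * t)))"

lemma exp_Suc_Suc: "exp (- (of_nat (Suc m) * (of_nat (Suc n) * t))) = exp (- (of_nat (Suc n) * t)) ^ Suc m" for t :: complex
  by (simp only: exp_of_nat_mult flip: mult_minus_right)

lemma sums_Ln_one_minus:
  fixes z :: complex
  assumes "norm z < 1"
  shows "(\<lambda>m. z ^ Suc m / of_nat (Suc m)) sums (- Ln (1 - z))"
proof -
  have a: "(\<lambda>n. (-1)^Suc n / of_nat n * (- z)^n) sums ln (1 + (- z))"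
    using assms by (intro Ln_series) simp
  have b: "- ((-1)^Suc n / of_nat n * (- z)^n) = z ^ n / of_nat n" for n
    by (cases "even n") simp_all
  have "(\<lambda>n. z ^ n / of_nat n) sums (- Ln (1 + - z))"
    using sums_minus[OF a] by (simp only: b)
  then show ?thesis using sums_Suc_iff[of "\<lambda>n. z ^ n / of_nat n" "- Ln (1 - z)"] by simp
qed

text \<open>Expanding every logarithm gives the double series of q^(m n) / m. Summing over m
  recovers \<open>prod_log\<close>, summing over n gives the geometric series inside
  \<open>lam_term\<close>.\<close>

lemma prod_log_sums:
  assumes "Re t > 0"
  shows "prod_log t sums lam t"
proof -
  define x where "x = exp (- Re t)"
  have x: "0 < x" "x < 1" using assms by (auto simp: x_def)
  define q where "q = (\<lambda>n. exp (- (of_nat (Suc n) * t)))"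
  have nq: "norm (q n) = x ^ Suc n" for n unfolding q_def x_def by (rule norm_exp_Suc)
  have x1: "x ^ Suc n < 1" for n using x by (simp add: power_less_one_iff del: power_Suc)
  define f where "f = (\<lambda>m n. q n ^ Suc m / of_nat (Suc m))"
  have f': "f m n = q m * q m ^ n / of_nat (Suc m)" for m n
  proof -
    have "q n ^ Suc m = exp (- (of_nat (Suc m) * (of_nat (Suc n) * t)))" unfolding q_def by (rule exp_Suc_Suc[symmetric])
    also have "of_nat (Suc m) * (of_nat (Suc n) * t) = of_nat (Suc n) * (of_nat (Suc m) * t)" by (rule mult.left_commute)
    also have "exp (- \<dots>) = q m ^ Suc n" unfolding q_def by (rule exp_Suc_Suc)
    finally show ?thesis unfolding f_def by simp
  qed
  have row: "f m sums lam_term m t" for m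
  proof -
    have "norm (q m) < 1" unfolding nq by (rule x1)
    from sums_divide[OF sums_mult[OF geometric_sums[OF this], of "q m"], of "of_nat (Suc m)"]
    show ?thesis unfolding f' lam_term_def q_def by simp
  qed
  have col: "(\<lambda>m. f m n) sums prod_log t n" for n
  proof -
    have "(\<lambda>m. f m n) sums (- Ln (1 - q n))"
      unfolding f_def by (rule sums_Ln_one_minus) (simp only: nq x1)
    then show ?thesis by (simp only: prod_log_def q_def)
  qed
  have bound: "norm (f m n) \<le> x ^ m * x ^ Suc n" for m n
  proof -
    have "norm (f m n) = (x ^ Suc n) ^ Suc m / real (Suc m)"
      unfolding f_def by (simp add: norm_divide norm_power norm_mult nq del: of_nat_Suc)
    also have "\<dots> \<le> (x ^ Suc n) ^ Suc m / 1" using x by (intro divide_left_mono) auto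
    also have "\<dots> = x ^ (Suc n * Suc m)" by (simp only: power_mult div_by_1)
    also have "\<dots> \<le> x ^ (m + Suc n)" using x by (intro power_decreasing) auto
    finally show ?thesis by (simp only: power_add)
  qed
  have "prod_log t sums suminf (\<lambda>m. lam_term m t)"
    by (rule sums_swap(2)[OF bound _ _ _ _ row col]) (use x in \<open>auto intro!: summable_geometric summable_mult\<close>)
  then show ?thesis by (simp add: lam_def)
qed

lemma lam_term_of_real:
  "lam_term m (of_real r) = of_real (exp (- r) ^ Suc m / (1 - exp (- r) ^ Suc m) / real (Suc m))"
proof -
  have "exp (- (of_nat (Suc m) * complex_of_real r)) = of_real (exp (- r) ^ Suc m)"
    using exp_of_real[of "- r", where 'a = complex]
    by (simp only: exp_of_nat_mult of_real_power of_real_minus flip: mult_minus_right)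
  then show ?thesis unfolding lam_term_def
    by (simp only: of_real_divide of_real_diff of_real_1 of_real_of_nat_eq)
qed

lemma norm_lam_term_le_real:
  assumes "Re t > 0"
  shows "norm (lam_term m t) \<le> Re (lam_term m (of_real (Re t)))"
proof -
  have x: "exp (- Re t) ^ Suc m < 1" using assms by (simp add: power_less_one_iff del: power_Suc)
  have "1 - exp (- Re t) ^ Suc m \<le> norm (1 - exp (- (of_nat (Suc m) * t)))"
    using norm_triangle_ineq2[of 1 "exp (- (of_nat (Suc m) * t))"] by (simp only: norm_one norm_exp_Suc)
  then show ?thesis
    unfolding lam_term_of_real Re_complex_of_real
    unfolding lam_term_def norm_divide norm_exp_Suc norm_of_nat
    using x by (intro divide_right_mono frac_le) auto
qed

lemma lamr_sums: "r > 0 \<Longrightarrow> (\<lambda>m. Re (lam_term m (of_real r))) sums Re (lam (of_real r))"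
  using sums_Re[OF lam_sums[of "of_real r"]] by simp

text \<open>Every term is bounded by its value at \<open>Re t\<close>; only for the first term is
  the loss kept. That loss is the entire gain used away from the real axis.\<close>

lemma norm_lam_le:
  assumes "Re t > 0"
  shows "norm (lam t) \<le> Re (lam (of_real (Re t))) - (1 / (exp (Re t) - 1) - 1 / norm (exp t - 1))"
proof -
  let ?b = "\<lambda>m. Re (lam_term m (of_real (Re t)))"
  let ?d = "1 / (exp (Re t) - 1) - 1 / norm (exp t - 1)"
  have e1: "exp t \<noteq> 1" "exp (Re t) > 1"
    using assms norm_exp_eq_Re[of t] by force+
  have b0: "?b 0 = 1 / (exp (Re t) - 1)"
    unfolding lam_term_of_real using e1 by (simp add: exp_minus field_simps)
  have "lam_term 0 t = 1 / (exp t - 1)"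
    unfolding lam_term_def using e1 by (simp add: exp_minus field_simps)
  then have n0: "norm (lam_term 0 t) = ?b 0 - ?d" unfolding b0 by (simp add: norm_divide)
  have s1: "(\<lambda>m. ?b m - (if m = 0 then ?d else 0)) sums (Re (lam (of_real (Re t))) - ?d)"
    using sums_diff[OF lamr_sums[OF assms] sums_single[of 0 "\<lambda>_. ?d"]] by simp
  have le: "norm (lam_term m t) \<le> ?b m - (if m = 0 then ?d else 0)" for m
    using n0 norm_lam_term_le_real[OF assms, of m] by (cases "m = 0") simp_all
  have s2: "(\<lambda>m. norm (lam_term m t)) sums (\<Sum>m. norm (lam_term m t))"
    by (rule summable_sums[OF summable_norm_lam_term[OF assms]])
  have "(\<Sum>m. norm (lam_term m t)) \<le> Re (lam (of_real (Re t))) - ?d"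
    by (rule sums_le[OF le s2 s1])
  then show ?thesis
    using summable_norm[OF summable_norm_lam_term[OF assms]] unfolding lam_def by linarith
qed

text \<open>Meant for the dual side, where \<open>Re t\<close> is bounded away from 0 and the bound
  decays like exp (- Re t).\<close>

lemma norm_lam_le_exp:
  assumes "Re t > 0"
  shows "norm (lam t) \<le> exp (- Re t) / (1 - exp (- Re t))\<^sup>2"
proof -
  define x where "x = exp (- Re t)"
  have x: "0 < x" "x < 1" using assms by (auto simp: x_def)
  have s1: "(\<lambda>m. x * x ^ m * (1 / (1 - x))) sums (x * (1 / (1 - x)) * (1 / (1 - x)))"
    by (intro sums_mult2 sums_mult geometric_sums) (use x in auto)
  have le: "norm (lam_term m t) \<le> x * x ^ m * (1 / (1 - x))" for m
    using norm_lam_term_le[OF order_refl assms, of m] by (simp add: x_def)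
  have s2: "(\<lambda>m. norm (lam_term m t)) sums (\<Sum>m. norm (lam_term m t))"
    by (rule summable_sums[OF summable_norm_lam_term[OF assms]])
  have "(\<Sum>m. norm (lam_term m t)) \<le> x * (1 / (1 - x)) * (1 / (1 - x))"
    by (rule sums_le[OF le s2 s1])
  then show ?thesis
    using summable_norm[OF summable_norm_lam_term[OF assms]] unfolding lam_def x_def[symmetric]
    by (simp add: power2_eq_square)
qed

text \<open>The logarithm of the generating function at \<open>q = exp (- t)\<close>, where \<open>m = 2 * k + 1\<close>.\<close>

definition bd_log :: "real \<Rightarrow> complex \<Rightarrow> complex" where
  "bd_log m t = 3 * lam t - lam (2 * t) - lam (of_real m * t) + lam (2 * of_real m * t)"

text \<open>Under \<open>t = 4 * pi\<^sup>2 / s\<close>, what remains of \<open>bd_log m t\<close> after its elementary part is split off.\<close>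

definition bd_dual :: "real \<Rightarrow> complex \<Rightarrow> complex" where
  "bd_dual m s = 3 * lam s - lam (s / 2) - lam (s / of_real m) + lam (s / (2 * of_real m))"

text \<open>The coefficients 3, - 1, - 1, 1 of \<open>bd_log\<close> sum to 2, so the half
  logarithms of \<open>lam_transformation\<close> add up to one full \<open>Ln\<close>, and ln 2 +
  ln m = ln (2 m) removes the constants. The resulting factor t / (2 pi) is the origin of the order
  2 of the Bessel function.\<close>

lemma exp_bd_log:
  assumes t: "Re t > 0" and m: "m > 0"
  shows "exp (bd_log m t) = t / of_real (2 * pi) *
     exp (of_real (pi\<^sup>2 * (5 * m - 1) / (12 * m)) / t - of_real ((m + 1) / 24) * t) *
     exp (bd_dual m (of_real (4 * pi\<^sup>2) / t))"
proof -
  define l where "l = Ln (t / of_real (2 * pi))"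
  have t0: "t \<noteq> 0" using t by auto
  have tr: "lam (of_real c * t) = lam (of_real (4 * pi\<^sup>2) / t / of_real c) + of_real (pi\<^sup>2 / 6 / c) / t - of_real (c / 24) * t + (of_real (ln c) + l) / 2"
    if c: "c > 0" for c
  proof -
    have "Ln (of_real c * t / of_real (2 * pi)) = Ln (of_real c * (t / of_real (2 * pi)))" by simp
    also have "\<dots> = of_real (ln c) + l"
      unfolding l_def using c t0 by (subst Ln_times_of_real) (auto simp: Ln_of_real)
    finally show ?thesis
      using lam_transformation[of "of_real c * t"] c t by (simp add: mult.commute)
  qed
  have T: "3 * l / 2 - (of_real (ln 2) + l) / 2 - (of_real (ln m) + l) / 2 + (of_real (ln (2 * m)) + l) / 2 = l"
    using m by (simp add: ln_mult field_simps)
  have L1: "lam t = lam (of_real (4 * pi\<^sup>2) / t) + of_real (pi\<^sup>2 / 6) / t - of_real (1 / 24) * t + l / 2"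
    using tr[of 1] by simp
  have L2: "lam (2 * t) = lam (of_real (4 * pi\<^sup>2) / t / 2) + of_real (pi\<^sup>2 / 6 / 2) / t - of_real (2 / 24) * t + (of_real (ln 2) + l) / 2"
    using tr[of 2] by simp
  have L3: "lam (2 * of_real m * t) = lam (of_real (4 * pi\<^sup>2) / t / (2 * of_real m)) + of_real (pi\<^sup>2 / 6 / (2 * m)) / t - of_real (2 * m / 24) * t + (of_real (ln (2 * m)) + l) / 2"
    using tr[of "2 * m"] m by simp
  have "bd_log m t = bd_dual m (of_real (4 * pi\<^sup>2) / t)
     + (of_real (3 * (pi\<^sup>2 / 6) - pi\<^sup>2 / 6 / 2 - pi\<^sup>2 / 6 / m + pi\<^sup>2 / 6 / (2 * m)) / t - of_real (3 * (1 / 24) - 2 / 24 - m / 24 + 2 * m / 24) * t)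
     + (3 * l / 2 - (of_real (ln 2) + l) / 2 - (of_real (ln m) + l) / 2 + (of_real (ln (2 * m)) + l) / 2)"
    unfolding bd_log_def bd_dual_def L1 L2 L3 tr[OF m]
    by (simp add: algebra_simps add_divide_distrib diff_divide_distrib)
  also have "3 * (pi\<^sup>2 / 6) - pi\<^sup>2 / 6 / 2 - pi\<^sup>2 / 6 / m + pi\<^sup>2 / 6 / (2 * m) = pi\<^sup>2 * (5 * m - 1) / (12 * m)"
    using m by (simp add: field_simps)
  also have "3 * (1 / 24) - 2 / 24 - m / 24 + 2 * m / 24 = (m + 1) / 24" by (simp add: field_simps)
  finally have bd: "bd_log m t = bd_dual m (of_real (4 * pi\<^sup>2) / t)
     + (of_real (pi\<^sup>2 * (5 * m - 1) / (12 * m)) / t - of_real ((m + 1) / 24) * t) + l"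
    unfolding T .
  have "exp l = t / of_real (2 * pi)" using t0 by (simp add: l_def)
  then show ?thesis unfolding bd exp_add by (simp only: mult_ac)
qed

section \<open>Bessel function estimates\<close>

text \<open>At its first zero the function would come down from positive values, which a positive
  derivative there forbids. Comparing a solution of a differential equation with an explicit
  function is thus reduced to a check at hypothetical crossing points.\<close>

lemma first_zero_barrier:
  fixes d :: "real \<Rightarrow> real"
  assumes der: "\<And>x. x \<ge> a \<Longrightarrow> (d has_real_derivative d' x) (at x)"
    and start: "d a > 0" and cross: "\<And>x. x > a \<Longrightarrow> d x = 0 \<Longrightarrow> d' x > 0" and z: "z \<ge> a"
  shows "d z > 0"
proof (rule ccontr)
  assume "\<not> d z > 0"
  then have dz: "d z \<le> 0" by simp
  define Z where "Z = {x \<in> {a..z}. d x \<le> 0}"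
  have cont: "continuous_on {a..z} d"
    using der by (intro continuous_at_imp_continuous_on ballI) (auto intro: DERIV_isCont)
  have "closed Z" unfolding Z_def
    by (intro continuous_on_closed_Collect_le cont continuous_on_const closed_atLeastAtMost)
  moreover have "z \<in> Z" using dz z by (simp add: Z_def)
  moreover have "bdd_below Z" unfolding Z_def by (rule bdd_belowI[of _ a]) auto
  ultimately have p: "Inf Z \<in> Z" by (intro closed_contains_Inf) auto
  define p where "p = Inf Z"
  have pz: "p \<ge> a" "d p \<le> 0" "p \<le> z" using p unfolding p_def Z_def by auto
  have before: "d x > 0" if "a \<le> x" "x < p" for x
  proof (rule ccontr)
    assume "\<not> d x > 0"
    then have "x \<in> Z" using that pz by (auto simp: Z_def)
    then have "p \<le> x" unfolding p_def using \<open>bdd_below Z\<close> by (rule cInf_lower)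
    then show False using that by simp
  qed
  have pa: "p > a" using start pz by (cases "p = a") auto
  have "d p = 0"
  proof (rule ccontr)
    assume "d p \<noteq> 0"
    then have "d p < 0" using pz by simp
    then have "\<exists>x. a \<le> x \<and> x \<le> p \<and> d x = 0"
      using start pa der by (intro IVT2') (auto intro!: continuous_at_imp_continuous_on DERIV_isCont)
    then obtain x where "a \<le> x" "x \<le> p" "d x = 0" by blast
    then show False using before[of x] \<open>d p \<noteq> 0\<close> by (cases "x = p") auto
  qed
  then have "d' p > 0" using cross pa by blast
  from DERIV_pos_inc_left[OF der[OF pz(1)] this] obtain e
    where e: "e > 0" "\<And>h. h > 0 \<Longrightarrow> h < e \<Longrightarrow> d (p - h) < d p" by blast
  define h where "h = min (e / 2) (p - a)"
  have "h > 0" "h < e" "a \<le> p - h" "p - h < p" using e pa by (auto simp: h_def min_def)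
  then show False using e(2)[of h] before[of "p - h"] \<open>d p = 0\<close> by simp
qed

text \<open>\<open>bes x = I\<^sub>2 (2 * sqrt x) / x\<close>, with \<open>I\<^sub>2\<close> the modified Bessel function.\<close>

definition bes_coeff :: "nat \<Rightarrow> real" where
  "bes_coeff n = 1 / (fact n * fact (n + 2))"

definition bes :: "real \<Rightarrow> real" where
  "bes x = (\<Sum>n. bes_coeff n * x ^ n)"

definition bes1 :: "real \<Rightarrow> real" where
  "bes1 x = (\<Sum>n. diffs bes_coeff n * x ^ n)"

definition bes2 :: "real \<Rightarrow> real" where
  "bes2 x = (\<Sum>n. diffs (diffs bes_coeff) n * x ^ n)"

lemma bes_coeff_pos: "bes_coeff n > 0"
  by (simp add: bes_coeff_def)

lemma summable_bes: "summable (\<lambda>n. bes_coeff n * x ^ n)"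
proof (rule summable_comparison_test'[of "\<lambda>n. \<bar>x\<bar> ^ n / fact n"])
  show "summable (\<lambda>n. \<bar>x\<bar> ^ n / fact n)"
    using summable_exp[of "\<bar>x\<bar>"] by (simp add: field_simps)
  show "norm (bes_coeff n * x ^ n) \<le> \<bar>x\<bar> ^ n / fact n" for n
  proof -
    have "norm (bes_coeff n * x ^ n) = \<bar>x\<bar> ^ n / fact n / fact (n + 2)"
      by (simp add: bes_coeff_def abs_mult power_abs)
    also have "\<dots> \<le> \<bar>x\<bar> ^ n / fact n / 1"
      by (rule divide_left_mono[OF fact_ge_1]) simp_all
    finally show ?thesis by simp
  qed
qed

lemma summable_bes1: "summable (\<lambda>n. diffs bes_coeff n * x ^ n)"
  using termdiff_converges_all[of bes_coeff] summable_bes by blast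

lemma summable_bes2: "summable (\<lambda>n. diffs (diffs bes_coeff) n * x ^ n)"
  using termdiff_converges_all[of "diffs bes_coeff"] summable_bes1 by blast

lemma DERIV_bes: "(bes has_real_derivative bes1 x) (at x)"
  unfolding bes_def[abs_def] bes1_def
  by (rule termdiffs_strong_converges_everywhere) (rule summable_bes)

lemma DERIV_bes1: "(bes1 has_real_derivative bes2 x) (at x)"
  unfolding bes1_def[abs_def] bes2_def
  by (rule termdiffs_strong_converges_everywhere) (rule summable_bes1)

lemma diffs_bes_coeff: "diffs bes_coeff n = 1 / (fact n * fact (n + 3))"
proof -
  have "diffs bes_coeff n = real (Suc n) / (real (Suc n) * fact n * fact (n + 3))"
    unfolding diffs_def bes_coeff_def by (simp del: of_nat_Suc fact_Suc add: fact_Suc[of n] eval_nat_numeral)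
  then show ?thesis by (simp del: of_nat_Suc fact_Suc)
qed

lemma bes_coeff_rec: "(real n + 3) * diffs bes_coeff n = bes_coeff n"
proof -
  have "fact (n + 3) = (real n + 3) * fact (n + 2)"
    using fact_Suc[of "n + 2", where 'a = real] by (simp del: fact_Suc add: eval_nat_numeral algebra_simps)
  then show ?thesis unfolding diffs_bes_coeff bes_coeff_def by (simp del: fact_Suc)
qed

text \<open>Bessel's equation in the variable x, that is, the equation of the hypergeometric
  function 0F1(; 3; x); coefficientwise it is \<open>bes_coeff_rec\<close>.\<close>

lemma bes_ode: "x * bes2 x + 3 * bes1 x = bes x"
proof -
  have "(\<lambda>n. diffs (diffs bes_coeff) n * x ^ n) sums bes2 x"
    unfolding bes2_def by (rule summable_sums[OF summable_bes2])
  from sums_mult[OF this, of x]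
  have "(\<lambda>n. real (Suc n) * diffs bes_coeff (Suc n) * x ^ Suc n) sums (x * bes2 x)"
    by (simp add: diffs_def mult_ac)
  then have 1: "(\<lambda>n. real n * diffs bes_coeff n * x ^ n) sums (x * bes2 x)"
    using sums_Suc_iff[of "\<lambda>n. real n * diffs bes_coeff n * x ^ n" "x * bes2 x"] by simp
  have 2: "(\<lambda>n. 3 * (diffs bes_coeff n * x ^ n)) sums (3 * bes1 x)"
    unfolding bes1_def by (rule sums_mult[OF summable_sums[OF summable_bes1]])
  have "real n * diffs bes_coeff n * x ^ n + 3 * (diffs bes_coeff n * x ^ n) = bes_coeff n * x ^ n" for n
  proof -
    have "real n * diffs bes_coeff n * x ^ n + 3 * (diffs bes_coeff n * x ^ n) = (real n + 3) * diffs bes_coeff n * x ^ n"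
      by (simp add: algebra_simps)
    also have "(real n + 3) * diffs bes_coeff n = bes_coeff n" by (rule bes_coeff_rec)
    finally show ?thesis .
  qed
  with sums_add[OF 1 2] have "(\<lambda>n. bes_coeff n * x ^ n) sums (x * bes2 x + 3 * bes1 x)" by simp
  then show ?thesis unfolding bes_def by (simp add: sums_iff)
qed

lemma bes_pos: "x \<ge> 0 \<Longrightarrow> bes x > 0"
  unfolding bes_def
  by (rule suminf_pos2[OF summable_bes, of _ 0]) (auto intro!: mult_nonneg_nonneg less_imp_le[OF bes_coeff_pos] simp: bes_coeff_pos)

lemma bes1_pos: "x \<ge> 0 \<Longrightarrow> bes1 x > 0"
  unfolding bes1_def
  by (rule suminf_pos2[OF summable_bes1, of _ 0]) (auto simp: diffs_bes_coeff)

text \<open>Gives the starting value for the upper barrier in \<open>bes_s_upper\<close>.\<close>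

lemma bes1_le: "x \<ge> 0 \<Longrightarrow> bes1 x \<le> bes x / 3"
proof -
  assume x: "x \<ge> 0"
  have "bes1 x \<le> (\<Sum>n. (bes_coeff n * x ^ n) / 3)"
    unfolding bes1_def
  proof (rule suminf_le[OF _ summable_bes1 summable_divide[OF summable_bes]])
    fix n
    note bes_coeff_rec[of n]
    moreover have "3 * diffs bes_coeff n \<le> (real n + 3) * diffs bes_coeff n"
      by (intro mult_right_mono) (auto simp: diffs_bes_coeff)
    ultimately have "diffs bes_coeff n \<le> bes_coeff n / 3" by simp
    from mult_right_mono[OF this, of "x ^ n"] x
    show "diffs bes_coeff n * x ^ n \<le> bes_coeff n * x ^ n / 3" by simp
  qed
  also have "\<dots> = bes x / 3" unfolding bes_def by (rule suminf_divide[OF summable_bes])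
  finally show ?thesis .
qed

lemma bes_one_ge: "bes 1 \<ge> 11 / 16"
proof -
  have "(\<Sum>n<3. bes_coeff n * 1 ^ n) \<le> bes 1"
    unfolding bes_def by (rule sum_le_suminf[OF summable_bes]) (auto simp: less_imp_le[OF bes_coeff_pos])
  moreover have "(\<Sum>n<3. bes_coeff n * 1 ^ n) = 11 / 16"
    by (simp add: bes_coeff_def eval_nat_numeral)
  ultimately show ?thesis by simp
qed

section \<open>The logarithmic derivative of \<open>bes\<close> and its Riccati equation\<close>

definition bes_u :: "real \<Rightarrow> real" where "bes_u x = bes1 x / bes x"
text \<open>By \<open>bes_ode\<close> the logarithmic derivative \<open>bes_u\<close> satisfies a
  Riccati equation; \<open>bes_u1\<close> is its right-hand side and \<open>bes_u2\<close> the
  derivative of that. Bounds for \<open>bes_u\<close> alone therefore control both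
  derivatives.\<close>

definition bes_u1 :: "real \<Rightarrow> real" where "bes_u1 x = (1 - 3 * bes_u x - x * (bes_u x)\<^sup>2) / x"
definition bes_u2 :: "real \<Rightarrow> real" where
  "bes_u2 x = - (4 * bes_u1 x + (bes_u x)\<^sup>2 + 2 * x * bes_u x * bes_u1 x) / x"

lemma DERIV_bes_u:
  assumes "x > 0" shows "(bes_u has_real_derivative bes_u1 x) (at x)"
proof -
  have b: "bes x > 0" using assms by (intro bes_pos) simp
  have b2: "bes2 x = (bes x - 3 * bes1 x) / x" using bes_ode[of x] assms by (simp add: field_simps)
  have "(bes_u has_real_derivative (bes2 x * bes x - bes1 x * bes1 x) / (bes x * bes x)) (at x)"
    unfolding bes_u_def[abs_def] by (rule DERIV_divide[OF DERIV_bes1 DERIV_bes]) (use b in simp)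
  moreover have "(bes2 x * bes x - bes1 x * bes1 x) / (bes x * bes x) = bes_u1 x"
    unfolding bes_u1_def bes_u_def b2 using b assms by (simp add: field_simps power2_eq_square)
  ultimately show ?thesis by simp
qed

lemma DERIV_bes_u1:
  assumes "x > 0" shows "(bes_u1 has_real_derivative bes_u2 x) (at x)"
proof -
  have "(bes_u1 has_real_derivative ((0 - 3 * bes_u1 x - (1 * (bes_u x)\<^sup>2 + x * (2 * bes_u x * bes_u1 x))) * x - (1 - 3 * bes_u x - x * (bes_u x)\<^sup>2) * 1) / (x * x)) (at x)"
    unfolding bes_u1_def[abs_def] using assms
    by (auto intro!: derivative_eq_intros DERIV_bes_u[OF assms] simp: bes_u1_def[abs_def] algebra_simps power2_eq_square)
  moreover have e: "1 - 3 * bes_u x - x * (bes_u x)\<^sup>2 = x * bes_u1 x" using assms by (simp add: bes_u1_def)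
  have "((0 - 3 * bes_u1 x - (1 * (bes_u x)\<^sup>2 + x * (2 * bes_u x * bes_u1 x))) * x - (1 - 3 * bes_u x - x * (bes_u x)\<^sup>2) * 1) / (x * x) = bes_u2 x"
    unfolding e bes_u2_def using assms by (simp add: field_simps power2_eq_square)
  ultimately show ?thesis by simp
qed

text \<open>Half the logarithmic derivative of bes (z^2) in z. Its asymptotic expansion begins 1 - 5
  / (4 z) + (15 / 32) / z^2; \<open>bes_s_lower\<close> and \<open>bes_s_upper\<close> replace the
  last coefficient by 25 / 64 and 3 / 5.\<close>

definition bes_s :: "real \<Rightarrow> real" where "bes_s z = z * bes_u (z\<^sup>2)"

lemma DERIV_bes_s:
  assumes "z > 0" shows "(bes_s has_real_derivative 2 * (1 - (bes_s z)\<^sup>2) - 5 * bes_s z / z) (at z)"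
proof -
  have "((\<lambda>z. bes_u (z\<^sup>2)) has_real_derivative bes_u1 (z\<^sup>2) * (2 * z)) (at z)"
    by (rule DERIV_chain2[where g = "\<lambda>z. z\<^sup>2", OF DERIV_bes_u]) (use assms in \<open>auto intro!: derivative_eq_intros\<close>)
  from DERIV_mult[OF DERIV_ident this]
  have "(bes_s has_real_derivative (1 * bes_u (z\<^sup>2) + bes_u1 (z\<^sup>2) * (2 * z) * z)) (at z)"
    unfolding bes_s_def[abs_def] .
  then show ?thesis
    by (rule DERIV_cong) (use assms in \<open>simp add: bes_u1_def bes_s_def field_simps power2_eq_square\<close>)
qed

text \<open>The bound is the square of 1 - 5 / (8 z) and vanishes at z = 5 / 8, so that positivity
  of the series suffices as the start of the barrier argument.\<close>

lemma bes_s_lower: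
  assumes "z \<ge> 5 / 8"
  shows "1 - 5 / (4 * z) + (25 / 64) / z\<^sup>2 < bes_s z"
proof -
  let ?d = "\<lambda>z. bes_s z - (1 - 5 / (4 * z) + (25 / 64) / z\<^sup>2)"
  have "?d z > 0"
  proof (rule first_zero_barrier[of "5/8" ?d "\<lambda>z. 2 * (1 - (bes_s z)\<^sup>2) - 5 * bes_s z / z - (5 / (4 * z\<^sup>2) - (25 / 32) / z ^ 3)"])
    fix x :: real assume x: "x \<ge> 5 / 8"
    have "((\<lambda>z. 1 - 5 / (4 * z) + (25 / 64) / z\<^sup>2) has_real_derivative (5 / (4 * x\<^sup>2) - (25 / 32) / x ^ 3)) (at x)"
      using x by (auto intro!: derivative_eq_intros simp: field_simps power2_eq_square power3_eq_cube)
    then show "(?d has_real_derivative 2 * (1 - (bes_s x)\<^sup>2) - 5 * bes_s x / x - (5 / (4 * x\<^sup>2) - (25 / 32) / x ^ 3)) (at x)"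
      using x by (intro DERIV_diff DERIV_bes_s; linarith?)
  next
    show "?d (5 / 8) > 0"
      using bes1_pos[of "(5/8)\<^sup>2"] bes_pos[of "(5/8)\<^sup>2"] by (simp add: bes_s_def bes_u_def power2_eq_square)
  next
    fix x :: real assume x: "x > 5 / 8" and "?d x = 0"
    then have s: "bes_s x = 1 - 5 / (4 * x) + (25 / 64) / x\<^sup>2" by simp
    have "2 * (1 - (bes_s x)\<^sup>2) - 5 * bes_s x / x - (5 / (4 * x\<^sup>2) - (25 / 32) / x ^ 3)
       = (5 / 16 * x\<^sup>2 + 25 / 32 * (x - 25 / 64)) / x ^ 4"
      unfolding s using x by (simp add: field_simps power2_eq_square power3_eq_cube power4_eq_xxxx)
    also have "\<dots> > 0" using x by (intro divide_pos_pos add_pos_pos) auto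
    finally show "2 * (1 - (bes_s x)\<^sup>2) - 5 * bes_s x / x - (5 / (4 * x\<^sup>2) - (25 / 32) / x ^ 3) > 0" .
  qed fact
  then show ?thesis by simp
qed

text \<open>The coefficient 3 / 5 lies far enough above 15 / 32 for the crossing condition to be a
  positive quadratic in x, and for the bound to exceed 1 / 6 at the start z = 1 / 2.\<close>

lemma bes_s_upper:
  assumes "z \<ge> 1 / 2"
  shows "bes_s z < 1 - 5 / (4 * z) + (3 / 5) / z\<^sup>2"
proof -
  let ?d = "\<lambda>z. (1 - 5 / (4 * z) + (3 / 5) / z\<^sup>2) - bes_s z"
  have "?d z > 0"
  proof (rule first_zero_barrier[of "1/2" ?d "\<lambda>z. (5 / (4 * z\<^sup>2) - (6 / 5) / z ^ 3) - (2 * (1 - (bes_s z)\<^sup>2) - 5 * bes_s z / z)"])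
    fix x :: real assume x: "x \<ge> 1 / 2"
    have "((\<lambda>z. 1 - 5 / (4 * z) + (3 / 5) / z\<^sup>2) has_real_derivative (5 / (4 * x\<^sup>2) - (6 / 5) / x ^ 3)) (at x)"
      using x by (auto intro!: derivative_eq_intros simp: field_simps power2_eq_square power3_eq_cube)
    then show "(?d has_real_derivative (5 / (4 * x\<^sup>2) - (6 / 5) / x ^ 3) - (2 * (1 - (bes_s x)\<^sup>2) - 5 * bes_s x / x)) (at x)"
      using x by (intro DERIV_diff DERIV_bes_s; linarith?)
  next
    have "bes_u ((1/2)\<^sup>2) \<le> 1 / 3"
      unfolding bes_u_def using bes1_le[of "(1/2)\<^sup>2"] bes_pos[of "(1/2)\<^sup>2"] by (simp add: field_simps)
    then show "?d (1 / 2) > 0" by (simp add: bes_s_def power2_eq_square)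
  next
    fix x :: real assume x: "x > 1 / 2" and "?d x = 0"
    then have s: "bes_s x = 1 - 5 / (4 * x) + (3 / 5) / x\<^sup>2" by simp
    have "(5 / (4 * x\<^sup>2) - (6 / 5) / x ^ 3) - (2 * (1 - (bes_s x)\<^sup>2) - 5 * bes_s x / x)
       = (21 / 40 * (x - 8 / 7)\<^sup>2 + 6 / 175) / x ^ 4"
      unfolding s using x by (simp add: field_simps power2_eq_square power3_eq_cube power4_eq_xxxx)
    also have "\<dots> > 0" using x by (intro divide_pos_pos add_nonneg_pos) auto
    finally show "(5 / (4 * x\<^sup>2) - (6 / 5) / x ^ 3) - (2 * (1 - (bes_s x)\<^sup>2) - 5 * bes_s x / x) > 0" .
  qed fact
  then show ?thesis by simp
qed

text \<open>Twice the bound of \<open>bes_s_lower\<close>, integrated from 1 to z, with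
  \<open>bes_one_ge\<close> as the initial value.\<close>

lemma bes_lower_bound:
  assumes z: "z \<ge> 1"
  shows "bes (z\<^sup>2) \<ge> 11 / 16 * exp (2 * z - 5 / 2 * ln z - 2 + 25 / 32 * (1 - 1 / z))"
proof -
  let ?g = "\<lambda>z. ln (bes (z\<^sup>2)) - 2 * z + 5 / 2 * ln z + (25 / 32) / z"
  have der: "(?g has_real_derivative 2 * bes_s x - 2 + 5 / 2 / x - (25 / 32) / x\<^sup>2) (at x)" if "x \<ge> 1" for x
  proof -
    have b: "bes (x\<^sup>2) > 0" by (rule bes_pos) simp
    have "((\<lambda>z. bes (z\<^sup>2)) has_real_derivative bes1 (x\<^sup>2) * (2 * x)) (at x)"
      by (rule DERIV_chain2[where g = "\<lambda>z. z\<^sup>2", OF DERIV_bes]) (auto intro!: derivative_eq_intros)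
    then have "((\<lambda>z. ln (bes (z\<^sup>2))) has_real_derivative 1 / bes (x\<^sup>2) * (bes1 (x\<^sup>2) * (2 * x))) (at x)"
      by (rule DERIV_chain2[where f = ln and g = "\<lambda>z. bes (z\<^sup>2)", OF DERIV_ln_divide[OF b]])
    moreover have "1 / bes (x\<^sup>2) * (bes1 (x\<^sup>2) * (2 * x)) = 2 * bes_s x"
      by (simp add: bes_s_def bes_u_def)
    ultimately have l: "((\<lambda>z. ln (bes (z\<^sup>2))) has_real_derivative 2 * bes_s x) (at x)" by simp
    have "((\<lambda>z. - 2 * z + 5 / 2 * ln z + (25 / 32) / z) has_real_derivative - 2 + 5 / 2 / x - (25 / 32) / x\<^sup>2) (at x)"
      using that by (auto intro!: derivative_eq_intros simp: power2_eq_square)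
    from DERIV_add[OF l this] show ?thesis by (simp add: algebra_simps)
  qed
  have "?g 1 \<le> ?g z"
  proof (rule DERIV_nonneg_imp_nondecreasing[OF z])
    fix x :: real assume "1 \<le> x" "x \<le> z"
    moreover have "2 * bes_s x - 2 + 5 / 2 / x - (25 / 32) / x\<^sup>2 \<ge> 0"
      using bes_s_lower[of x] \<open>1 \<le> x\<close> by (simp add: field_simps)
    ultimately show "\<exists>y. (?g has_real_derivative y) (at x) \<and> 0 \<le> y" using der by blast
  qed
  then have "ln (bes 1) + (2 * z - 5 / 2 * ln z - 2 + 25 / 32 * (1 - 1 / z)) \<le> ln (bes (z\<^sup>2))"
    by (simp add: right_diff_distrib)
  then have "exp (ln (bes 1) + (2 * z - 5 / 2 * ln z - 2 + 25 / 32 * (1 - 1 / z))) \<le> bes (z\<^sup>2)"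
    using bes_pos[of "z\<^sup>2"] by (metis exp_le_cancel_iff exp_ln zero_le_power2)
  then have "bes 1 * exp (2 * z - 5 / 2 * ln z - 2 + 25 / 32 * (1 - 1 / z)) \<le> bes (z\<^sup>2)"
    using bes_pos[of 1] by (simp add: exp_add)
  moreover have "11 / 16 * exp (2 * z - 5 / 2 * ln z - 2 + 25 / 32 * (1 - 1 / z)) \<le> bes 1 * exp (2 * z - 5 / 2 * ln z - 2 + 25 / 32 * (1 - 1 / z))"
    by (intro mult_right_mono bes_one_ge) simp
  ultimately show ?thesis by linarith
qed

text \<open>With \<sigma> the exact coefficient of 1 / z^2 in \<open>bes_s z\<close>, the Riccati
  formulas become - \<delta> / z^3 and E / z^5 after all cancellations are carried out
  algebraically; the window 25 / 64 < \<sigma> < 3 / 5 is then enough. For large z the true values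
  tend to \<delta> = 1 / 2 and E = 3 / 4.\<close>

lemma bes_u_derivative_bounds:
  assumes z: "z \<ge> 50"
  shows "- bes_u1 (z\<^sup>2) \<ge> (47 / 100) / z ^ 3" "- bes_u1 (z\<^sup>2) \<le> (1 / 2) / z ^ 3"
    "bes_u2 (z\<^sup>2) \<ge> 0" "bes_u2 (z\<^sup>2) \<le> (14 / 10) / z ^ 5"
proof -
  define s where "s = bes_s z"
  define \<sigma> where "\<sigma> = (s - 1 + 5 / (4 * z)) * z\<^sup>2"
  have s: "s = 1 - 5 / (4 * z) + \<sigma> / z\<^sup>2" using z by (simp add: \<sigma>_def)
  have u: "bes_u (z\<^sup>2) = s / z" using z by (simp add: s_def bes_s_def)
  have "25 / 64 / z\<^sup>2 < \<sigma> / z\<^sup>2" "\<sigma> / z\<^sup>2 < 3 / 5 / z\<^sup>2"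
    using bes_s_lower[of z] bes_s_upper[of z] z s unfolding s_def by auto
  then have "25 / 64 < \<sigma> \<and> \<sigma> < 3 / 5" using z unfolding divide_less_cancel by auto
  then have \<sigma>: "25 / 64 < \<sigma>" "\<sigma> < 3 / 5" by auto
  define \<delta> where "\<delta> = 1 / 2 + (2 * \<sigma> - 35 / 16) / z + (\<sigma> / 2) / z\<^sup>2 + \<sigma>\<^sup>2 / z ^ 3"
  have u1: "bes_u1 (z\<^sup>2) = - \<delta> / z ^ 3"
    unfolding bes_u1_def u \<delta>_def s using z
    by (simp add: field_simps power2_eq_square power3_eq_cube)
  have \<sigma>2: "\<sigma>\<^sup>2 \<le> 1" "\<sigma>\<^sup>2 > 0" using \<sigma> by (auto simp: power_le_one_iff)
  have "(2 * \<sigma> - 35 / 16) / z \<ge> (- 45 / 32) / z" using \<sigma> z by (intro divide_right_mono) auto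
  moreover have "(- 45 / 32) / z \<ge> - (45 / 32) * (1 / 50)" using z by (simp add: field_simps)
  moreover have "(\<sigma> / 2) / z\<^sup>2 \<ge> 0" "\<sigma>\<^sup>2 / z ^ 3 \<ge> 0" using \<sigma> z by auto
  ultimately have \<delta>1: "\<delta> \<ge> 47 / 100" unfolding \<delta>_def by linarith
  have "\<delta> - 1 / 2 = (2 * \<sigma> - 35 / 16 + (\<sigma> / 2) / z + \<sigma>\<^sup>2 / z\<^sup>2) / z"
    unfolding \<delta>_def using z by (simp add: field_simps power2_eq_square power3_eq_cube)
  moreover have "2 * \<sigma> - 35 / 16 + (\<sigma> / 2) / z + \<sigma>\<^sup>2 / z\<^sup>2 \<le> 0"
  proof -
    have "(\<sigma> / 2) / z \<le> (3 / 5 / 2) / 50" using \<sigma> z by (intro frac_le) auto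
    moreover have "\<sigma>\<^sup>2 / z\<^sup>2 \<le> 1 / 50\<^sup>2" using \<sigma>2 z by (intro frac_le power_mono) auto
    moreover have "1 / 50\<^sup>2 \<le> (1 / 50 :: real)" by (simp add: power2_eq_square)
    ultimately show ?thesis using \<sigma> by linarith
  qed
  ultimately have "\<delta> - 1 / 2 \<le> 0" using z by (simp add: divide_nonpos_pos)
  then have \<delta>2: "\<delta> \<le> 1 / 2" by simp
  show "- bes_u1 (z\<^sup>2) \<ge> (47 / 100) / z ^ 3" "- bes_u1 (z\<^sup>2) \<le> (1 / 2) / z ^ 3"
    unfolding u1 using divide_right_mono[OF \<delta>1, of "z ^ 3"] divide_right_mono[OF \<delta>2, of "z ^ 3"] z by simp_all
  define E where "E = 4 * \<delta> + s * (4 * \<sigma> - 25 / 8 + 2 * \<sigma>\<^sup>2 / z\<^sup>2)"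
  \<comment> \<open>Both 2 \<delta> and s tend to 1. Their exact difference supplies a factor 1 / z,
    which lowers the order of \<open>bes_u2\<close> from z^(-4) to z^(-5).\<close>
  have e1: "z * (2 * \<delta> - s) = 4 * \<sigma> - 25 / 8 + 2 * \<sigma>\<^sup>2 / z\<^sup>2"
    unfolding \<delta>_def s using z by (simp add: field_simps power2_eq_square power3_eq_cube)
  have "bes_u2 (z\<^sup>2) = (4 * \<delta> + s * (z * (2 * \<delta> - s))) / z ^ 5"
    unfolding bes_u2_def u1 u using z by (simp add: field_simps eval_nat_numeral)
  then have u2: "bes_u2 (z\<^sup>2) = E / z ^ 5" unfolding e1 E_def .
  have z2: "2 * \<sigma>\<^sup>2 / z\<^sup>2 \<le> 2 * 1 / 50\<^sup>2"
    by (rule frac_le) (use \<sigma>2 power_mono[OF z, of 2] in simp_all)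
  have z3: "2 * \<sigma>\<^sup>2 / z\<^sup>2 \<ge> 0" by simp
  have "5 / (4 * z) \<le> 5 / (4 * 50)" using z by (intro frac_le) auto
  moreover have "\<sigma> / z\<^sup>2 \<ge> 0" using \<sigma> by simp
  ultimately have s1: "s \<ge> 97 / 100" unfolding s by simp
  have "\<sigma> / z\<^sup>2 \<le> 5 / (4 * z)" using \<sigma> z by (simp add: field_simps power2_eq_square)
  then have s2: "s \<le> 1" unfolding s by simp
  define k where "k = 4 * \<sigma> - 25 / 8 + 2 * \<sigma>\<^sup>2 / z\<^sup>2"
  have k: "k \<ge> - 25 / 16" "k \<le> - 72 / 100" using z2 z3 \<sigma> unfolding k_def power2_eq_square[of 50] by linarith+
  have "s * k \<ge> 1 * k" using s2 k by (intro mult_right_mono_neg) auto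
  moreover have "s * k \<le> 97 / 100 * k" using s1 k by (intro mult_right_mono_neg) auto
  ultimately have "E \<ge> 0" "E \<le> 14 / 10" unfolding E_def k_def[symmetric] using \<delta>1 \<delta>2 k by linarith+
  then show "bes_u2 (z\<^sup>2) \<ge> 0" "bes_u2 (z\<^sup>2) \<le> (14 / 10) / z ^ 5"
    unfolding u2 using z divide_right_mono[of E "14 / 10" "z ^ 5"] by simp_all
qed

section \<open>Finite differences and stability of the higher order Turan inequality\<close>

lemma second_difference_mvt:
  fixes f :: "real \<Rightarrow> real"
  assumes f: "\<And>x. x > 0 \<Longrightarrow> (f has_real_derivative f1 x) (at x)"
    and f1: "\<And>x. x > 0 \<Longrightarrow> (f1 has_real_derivative f2 x) (at x)" and Y: "Y > 0"
  obtains \<xi> where "Y < \<xi>" "\<xi> < Y + 2" "f (Y + 2) - 2 * f (Y + 1) + f Y = f2 \<xi>"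
proof -
  have "((\<lambda>x. f (x + 1) - f x) has_real_derivative f1 (x + 1) - f1 x) (at x)" if "x \<ge> Y" for x
  proof (rule DERIV_diff)
    show "((\<lambda>x. f (x + 1)) has_real_derivative f1 (x + 1)) (at x)"
      using f[of "x + 1"] that Y by (simp only: DERIV_shift)
  qed (use f[of x] that Y in simp)
  then obtain c where c: "Y < c" "c < Y + 1"
      "(f (Y + 1 + 1) - f (Y + 1)) - (f (Y + 1) - f Y) = (Y + 1 - Y) * (f1 (c + 1) - f1 c)"
    using MVT2[of Y "Y + 1" "\<lambda>x. f (x + 1) - f x" "\<lambda>x. f1 (x + 1) - f1 x"] by auto
  have "\<exists>\<xi>. c < \<xi> \<and> \<xi> < c + 1 \<and> f1 (c + 1) - f1 c = (c + 1 - c) * f2 \<xi>"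
    using c Y by (intro MVT2 f1) auto
  then obtain \<xi> where "c < \<xi>" "\<xi> < c + 1" "f1 (c + 1) - f1 c = f2 \<xi>" by auto
  with c show ?thesis by (intro that[of \<xi>]) (auto simp: add.assoc)
qed

lemma third_difference_mvt:
  fixes f :: "real \<Rightarrow> real"
  assumes f: "\<And>x. x > 0 \<Longrightarrow> (f has_real_derivative f1 x) (at x)"
    and f1: "\<And>x. x > 0 \<Longrightarrow> (f1 has_real_derivative f2 x) (at x)"
    and f2: "\<And>x. x > 0 \<Longrightarrow> (f2 has_real_derivative f3 x) (at x)" and Y: "Y > 0"
  obtains \<xi> where "Y < \<xi>" "\<xi> < Y + 3" "f (Y + 3) - 3 * f (Y + 2) + 3 * f (Y + 1) - f Y = f3 \<xi>"
proof -
  let ?H = "\<lambda>x. f (x + 2) - 2 * f (x + 1) + f x" and ?H1 = "\<lambda>x. f1 (x + 2) - 2 * f1 (x + 1) + f1 x"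
  have sh: "((\<lambda>x. f (x + s)) has_real_derivative f1 (x + s)) (at x)" if "x \<ge> Y" "s \<ge> 0" for x s
    using f[of "x + s"] that Y by (simp only: DERIV_shift)
  have "(?H has_real_derivative ?H1 x) (at x)" if "x \<ge> Y" for x
    using sh[OF that, of 2] sh[OF that, of 1] sh[OF that, of 0]
    by (intro DERIV_add DERIV_diff DERIV_cmult) auto
  then obtain c where c: "Y < c" "c < Y + 1" "?H (Y + 1) - ?H Y = (Y + 1 - Y) * ?H1 c"
    using MVT2[of Y "Y + 1" ?H ?H1] by auto
  have "c > 0" using c Y by simp
  then obtain \<xi> where "c < \<xi>" "\<xi> < c + 2" "?H1 c = f3 \<xi>"
    using second_difference_mvt[OF f1 f2] by blast
  moreover have "?H (Y + 1) - ?H Y = f (Y + 3) - 3 * f (Y + 2) + 3 * f (Y + 1) - f Y"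
    by (simp add: add.commute add.left_commute)
  ultimately show ?thesis using c by (intro that[of \<xi>]) auto
qed

text \<open>Divided by (y1 y2)^2 the expression is 4 e1 e2 - (e1 + e2 - e1 e2)^2, that is 2 (e1 +
  e2) e1 e2 - (e1 - e2)^2 - (e1 e2)^2. The cubic part, at least 4 m^3, has to beat h^2 and
  M^4.\<close>

lemma higher_turan_of_ratios:
  fixes y0 y1 y2 y3 e1 e2 :: real
  assumes "y1 > 0" "y2 > 0" and r: "y0 * y2 = (1 - e1) * y1\<^sup>2" "y1 * y3 = (1 - e2) * y2\<^sup>2"
    and m: "m \<le> e1" "m \<le> e2" "0 < m" and M: "e1 \<le> M" "e2 \<le> M" and h: "\<bar>e1 - e2\<bar> \<le> h"
    and le: "h\<^sup>2 + M ^ 4 < 4 * m ^ 3"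
  shows "4 * (y1\<^sup>2 - y0 * y2) * (y2\<^sup>2 - y1 * y3) - (y1 * y2 - y0 * y3)\<^sup>2 > 0"
proof -
  have "(y0 * y3) * (y1 * y2) = (y0 * y2) * (y1 * y3)" by (simp add: mult_ac)
  also have "\<dots> = ((1 - e1) * (1 - e2) * (y1 * y2)) * (y1 * y2)"
    unfolding r by (simp add: power2_eq_square mult_ac)
  finally have y03: "y0 * y3 = (1 - e1) * (1 - e2) * (y1 * y2)" using assms(1,2) by simp
  have "4 * (y1\<^sup>2 - y0 * y2) * (y2\<^sup>2 - y1 * y3) - (y1 * y2 - y0 * y3)\<^sup>2
      = (y1 * y2)\<^sup>2 * (2 * (e1 + e2) * (e1 * e2) - (e1 - e2)\<^sup>2 - (e1 * e2)\<^sup>2)"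
    unfolding r y03 by (simp add: power2_eq_square algebra_simps)
  moreover have "2 * (m + m) * (m * m) \<le> 2 * (e1 + e2) * (e1 * e2)"
    using m by (intro mult_mono add_mono) auto
  moreover have "(e1 - e2)\<^sup>2 \<le> h\<^sup>2" using h by (simp add: abs_le_square_iff[symmetric])
  moreover have "(e1 * e2)\<^sup>2 \<le> (M * M)\<^sup>2" using m M by (intro power_mono mult_mono) auto
  moreover have "2 * (m + m) * (m * m) = 4 * m ^ 3" "(M * M)\<^sup>2 = M ^ 4"
    by (simp_all add: eval_nat_numeral)
  ultimately have "2 * (e1 + e2) * (e1 * e2) - (e1 - e2)\<^sup>2 - (e1 * e2)\<^sup>2 > 0" using le by linarith
  moreover have "(y1 * y2)\<^sup>2 > 0" using assms(1,2) by simp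
  ultimately show ?thesis
    using \<open>4 * (y1\<^sup>2 - y0 * y2) * (y2\<^sup>2 - y1 * y3) - (y1 * y2 - y0 * y3)\<^sup>2 = _\<close> by simp
qed

lemma one_minus_exp_bounds:
  fixes w :: real
  assumes "0 \<le> w"
  shows "1 - exp (- w) \<le> w" "w - w\<^sup>2 / 2 \<le> 1 - exp (- w)"
proof -
  show "1 - exp (- w) \<le> w" using exp_ge_add_one_self[of "- w"] by simp
  have "exp (- w) \<le> 1 - w + w\<^sup>2 / 2"
  proof -
    let ?g = "\<lambda>x. 1 - x + x\<^sup>2 / 2 - exp (- x)"
    have "?g 0 \<le> ?g w"
    proof (rule DERIV_nonneg_imp_nondecreasing[OF assms])
      fix x :: real assume "0 \<le> x"
      have "(?g has_real_derivative (x - 1 + exp (- x))) (at x)"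
        by (auto intro!: derivative_eq_intros)
      moreover have "x - 1 + exp (- x) \<ge> 0" using exp_ge_add_one_self[of "- x"] by simp
      ultimately show "\<exists>y. (?g has_real_derivative y) (at x) \<and> 0 \<le> y" by blast
    qed
    then show ?thesis by simp
  qed
  then show "w - w\<^sup>2 / 2 \<le> 1 - exp (- w)" by simp
qed

lemma one_minus_exp_diff:
  fixes v w :: real
  assumes "0 \<le> v" "0 \<le> w"
  shows "\<bar>(1 - exp (- v)) - (1 - exp (- w))\<bar> \<le> \<bar>v - w\<bar>"
  using assms
proof (induction v w rule: linorder_wlog)
  case (le v w)
  have "exp (- v) - exp (- w) = exp (- v) * (1 - exp (- (w - v)))"
    by (simp add: right_diff_distrib flip: exp_add)
  also have "\<dots> \<le> 1 * (w - v)"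
    using le one_minus_exp_bounds(1)[of "w - v"] by (intro mult_mono) auto
  finally show ?case using le by simp
next
  case (sym v w)
  then show ?case by (simp add: abs_minus_commute)
qed

text \<open>Put a = A^2 / z^3 and b = A^3 / z^5. The negated second differences of the main
  logarithm lie between 0.466 a and 0.5 a, its third difference between 0 and 1.4 b. Errors up to
  \<epsilon> <= 3 b / 8 shift these by at most 4 \<epsilon> = 1.5 b and 8 \<epsilon> = 3 b, hence
  the bound 4.4 b. Since b^2 = a^3 / z, the requirement of \<open>higher_turan_of_ratios\<close>
  becomes purely numerical.\<close>

lemma higher_turan_bes_perturbed:
  fixes A Y c \<epsilon> :: real and y :: "nat \<Rightarrow> real"
  defines "z \<equiv> sqrt (A * Y)"
  assumes A: "0 < A" "A \<le> 4" and Y: "Y > 0" and z: "z \<ge> 50"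
    and \<epsilon>: "\<epsilon> \<le> 3 / 8 * A ^ 3 / z ^ 5"
    and pos: "\<And>j. j \<le> 3 \<Longrightarrow> y j > 0"
    and err: "\<And>j. j \<le> 3 \<Longrightarrow> \<bar>ln (y j) - (c + ln (bes (A * (Y + real j))))\<bar> \<le> \<epsilon>"
  shows "4 * ((y 1)\<^sup>2 - y 0 * y 2) * ((y 2)\<^sup>2 - y 1 * y 3) - (y 1 * y 2 - y 0 * y 3)\<^sup>2 > 0"
proof -
  define l where "l = (\<lambda>x. ln (bes (A * x)))"
  have z2: "z\<^sup>2 = A * Y" unfolding z_def using A Y by simp
  have lin: "((*) A has_real_derivative A) (at x)" for x
    by (auto intro!: derivative_eq_intros)
  have l1: "(l has_real_derivative A * bes_u (A * x)) (at x)" if "x > 0" for x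
  proof -
    have b: "bes (A * x) > 0" using that A by (intro bes_pos) simp
    have "((\<lambda>x. bes (A * x)) has_real_derivative bes1 (A * x) * A) (at x)"
      by (rule DERIV_chain2[where f = bes, OF DERIV_bes lin])
    then have "(l has_real_derivative 1 / bes (A * x) * (bes1 (A * x) * A)) (at x)"
      unfolding l_def by (rule DERIV_chain2[where f = ln and g = "\<lambda>x. bes (A * x)", OF DERIV_ln_divide[OF b]])
    then show ?thesis by (rule DERIV_cong) (simp add: bes_u_def)
  qed
  have l2: "((\<lambda>x. A * bes_u (A * x)) has_real_derivative A\<^sup>2 * bes_u1 (A * x)) (at x)" if "x > 0" for x
  proof -
    have "A * x > 0" using that A by simp
    from DERIV_cmult[OF DERIV_chain2[where f = bes_u, OF DERIV_bes_u[OF this] lin], of A]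
    show ?thesis by (rule DERIV_cong) (simp add: power2_eq_square)
  qed
  have l3: "((\<lambda>x. A\<^sup>2 * bes_u1 (A * x)) has_real_derivative A ^ 3 * bes_u2 (A * x)) (at x)" if "x > 0" for x
  proof -
    have "A * x > 0" using that A by simp
    from DERIV_cmult[OF DERIV_chain2[where f = bes_u1, OF DERIV_bes_u1[OF this] lin], of "A\<^sup>2"]
    show ?thesis by (rule DERIV_cong) (simp add: power2_eq_square power3_eq_cube)
  qed
  define a where "a = A\<^sup>2 / z ^ 3"
  define b where "b = A ^ 3 / z ^ 5"
  have zp: "z > 0" using z by simp
  have ap: "a > 0" unfolding a_def using A zp by auto
  have iz: "1 / z \<le> 1 / 50" using z by (simp add: field_simps)
  have "A / z\<^sup>2 \<le> 4 / 50\<^sup>2" using A z by (intro frac_le power_mono) auto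
  then have "a * (A / z\<^sup>2) \<le> a * (4 / 50\<^sup>2)" using ap by (intro mult_left_mono) auto
  moreover have "b = a * (A / z\<^sup>2)" unfolding a_def b_def using zp by (simp add: field_simps eval_nat_numeral)
  ultimately have ba: "b \<le> 16 / 10000 * a" by (simp add: power2_eq_square)
  have "a \<le> 4\<^sup>2 / 50 ^ 3" unfolding a_def using A z by (intro frac_le power_mono) auto
  then have a1: "a \<le> 128 / 1000000" by (simp add: eval_nat_numeral)
  \<comment> \<open>The derivatives are taken at points up to Y + 3, where the square root has grown
    by a factor of at most 1.0025; dividing 0.47 by the cube of this leaves 0.466.\<close>
  have window: "- (A\<^sup>2 * bes_u1 (A * x)) \<ge> 466 / 1000 * a" "- (A\<^sup>2 * bes_u1 (A * x)) \<le> 1 / 2 * a"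
    "A ^ 3 * bes_u2 (A * x) \<ge> 0" "A ^ 3 * bes_u2 (A * x) \<le> 14 / 10 * b" if x: "Y < x" "x < Y + 3" for x
  proof -
    define \<zeta> where "\<zeta> = sqrt (A * x)"
    have \<zeta>2: "\<zeta>\<^sup>2 = A * x" unfolding \<zeta>_def using A Y x by simp
    have z\<zeta>: "z \<le> \<zeta>" unfolding z_def \<zeta>_def using A x by simp
    have "A * x \<le> A * Y + 4 * 3"
    proof -
      have "A * (x - Y) \<le> 4 * 3" using A x by (intro mult_mono) auto
      then show ?thesis by (simp add: right_diff_distrib)
    qed
    then have "\<zeta>\<^sup>2 \<le> z\<^sup>2 + 12" using z2 \<zeta>2 by simp
    also have "z\<^sup>2 + 12 \<le> (1003 / 1000 * z)\<^sup>2"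
    proof -
      have "50\<^sup>2 \<le> z\<^sup>2" using z by (intro power_mono) auto
      then show ?thesis by (simp add: power2_eq_square)
    qed
    finally have "\<zeta> \<le> 1003 / 1000 * z" using zp by (simp add: power2_le_iff_abs_le)
    then have "\<zeta> \<le> 10025 / 10000 * z"
      using \<open>\<zeta>\<^sup>2 \<le> z\<^sup>2 + 12\<close> z
    proof -
      have "z\<^sup>2 + 12 \<le> (10025 / 10000 * z)\<^sup>2"
      proof -
        have "50\<^sup>2 \<le> z\<^sup>2" using z by (intro power_mono) auto
        then show ?thesis by (simp add: power2_eq_square)
      qed
      with \<open>\<zeta>\<^sup>2 \<le> z\<^sup>2 + 12\<close> have "\<zeta>\<^sup>2 \<le> (10025 / 10000 * z)\<^sup>2" by linarith
      then show ?thesis using zp by (simp add: power2_le_iff_abs_le)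
    qed
    then have "\<zeta> ^ 3 \<le> (10025 / 10000 * z) ^ 3" using z\<zeta> zp by (intro power_mono) auto
    also have "(10025 / 10000 * z) ^ 3 = (10025 / 10000) ^ 3 * z ^ 3" by (rule power_mult_distrib)
    also have "\<dots> \<le> 1008 / 1000 * z ^ 3" using zp by (intro mult_right_mono) (auto simp: eval_nat_numeral)
    finally have "1 / (1008 / 1000 * z ^ 3) \<le> 1 / \<zeta> ^ 3"
      using z\<zeta> zp by (intro frac_le) auto
    then have "(47 / 100) / (1008 / 1000) * (1 / z ^ 3) \<le> (47 / 100) / \<zeta> ^ 3" by simp
    moreover have "466 / 1000 * (1 / z ^ 3) \<le> (47 / 100) / (1008 / 1000) * (1 / z ^ 3)"
      using zp by (intro mult_right_mono) auto
    moreover note bes_u_derivative_bounds[of \<zeta>]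
    ultimately have B: "466 / 1000 * (1 / z ^ 3) \<le> - bes_u1 (A * x)" "- bes_u1 (A * x) \<le> (1 / 2) / \<zeta> ^ 3"
      "bes_u2 (A * x) \<ge> 0" "bes_u2 (A * x) \<le> (14 / 10) / \<zeta> ^ 5"
      using z\<zeta> z by (auto simp: \<zeta>2)
    have "(1 / 2) / \<zeta> ^ 3 \<le> (1 / 2) / z ^ 3" "(14 / 10) / \<zeta> ^ 5 \<le> (14 / 10) / z ^ 5"
      using z\<zeta> zp by (intro frac_le power_mono; simp)+
    with B have B2: "- bes_u1 (A * x) \<le> 1 / 2 * (1 / z ^ 3)" "bes_u2 (A * x) \<le> 14 / 10 * (1 / z ^ 5)" by simp_all
    have A2: "A\<^sup>2 \<ge> 0" "A ^ 3 \<ge> 0" using A by auto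
    show "- (A\<^sup>2 * bes_u1 (A * x)) \<ge> 466 / 1000 * a"
      using mult_left_mono[OF B(1) A2(1)] unfolding a_def by simp
    show "- (A\<^sup>2 * bes_u1 (A * x)) \<le> 1 / 2 * a"
      using mult_left_mono[OF B2(1) A2(1)] unfolding a_def by simp
    show "A ^ 3 * bes_u2 (A * x) \<ge> 0" using A2 B by simp
    show "A ^ 3 * bes_u2 (A * x) \<le> 14 / 10 * b"
      using mult_left_mono[OF B2(2) A2(2)] unfolding b_def by simp
  qed
  obtain \<xi>1 where x1: "Y < \<xi>1" "\<xi>1 < Y + 2" "l (Y + 2) - 2 * l (Y + 1) + l Y = A\<^sup>2 * bes_u1 (A * \<xi>1)"
    using second_difference_mvt[OF l1 l2 Y] by blast
  have "Y + 1 > 0" using Y by simp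
  then obtain \<xi>2 where x2: "Y + 1 < \<xi>2" "\<xi>2 < Y + 1 + 2"
      "l (Y + 1 + 2) - 2 * l (Y + 1 + 1) + l (Y + 1) = A\<^sup>2 * bes_u1 (A * \<xi>2)"
    using second_difference_mvt[OF l1 l2, of "Y + 1"] by blast
  obtain \<xi>3 where x3: "Y < \<xi>3" "\<xi>3 < Y + 3"
      "l (Y + 3) - 3 * l (Y + 2) + 3 * l (Y + 1) - l Y = A ^ 3 * bes_u2 (A * \<xi>3)"
    using third_difference_mvt[OF l1 l2 l3 Y] by blast
  have Y13: "Y + 1 + 2 = Y + 3" "Y + 1 + 1 = Y + 2" by auto
  define w1 where "w1 = 2 * l (Y + 1) - l Y - l (Y + 2)"
  define w2 where "w2 = 2 * l (Y + 2) - l (Y + 1) - l (Y + 3)"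
  have "\<xi>1 < Y + 3" "Y < \<xi>2" "\<xi>2 < Y + 3" using x1 x2 by linarith+
  note win = window(1,2)[OF x1(1) this(1)] window(1,2)[OF this(2,3)] window(3,4)[OF x3(1,2)]
  have w12: "w1 = - (A\<^sup>2 * bes_u1 (A * \<xi>1))" "w2 = - (A\<^sup>2 * bes_u1 (A * \<xi>2))" "w1 - w2 = A ^ 3 * bes_u2 (A * \<xi>3)"
    unfolding w1_def w2_def x1(3)[symmetric] x2(3)[symmetric] x3(3)[symmetric] Y13 by simp_all
  have w: "466 / 1000 * a \<le> w1" "w1 \<le> 1 / 2 * a" "466 / 1000 * a \<le> w2" "w2 \<le> 1 / 2 * a" "\<bar>w1 - w2\<bar> \<le> 14 / 10 * b"
    using win unfolding w12[symmetric] by linarith+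
  define W1 where "W1 = 2 * ln (y 1) - ln (y 0) - ln (y 2)"
  define W2 where "W2 = 2 * ln (y 2) - ln (y 1) - ln (y 3)"
  have er: "\<bar>ln (y 0) - (c + l Y)\<bar> \<le> \<epsilon>" "\<bar>ln (y 1) - (c + l (Y + 1))\<bar> \<le> \<epsilon>"
    "\<bar>ln (y 2) - (c + l (Y + 2))\<bar> \<le> \<epsilon>" "\<bar>ln (y 3) - (c + l (Y + 3))\<bar> \<le> \<epsilon>"
    using err[of 0] err[of 1] err[of 2] err[of 3] by (auto simp: l_def)
  have \<epsilon>b: "\<epsilon> \<le> 3 / 8 * b" using \<epsilon> unfolding b_def by simp
  have W: "4636 / 10000 * a \<le> W1" "W1 \<le> 5024 / 10000 * a" "4636 / 10000 * a \<le> W2" "W2 \<le> 5024 / 10000 * a"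
    "\<bar>W1 - W2\<bar> \<le> 44 / 10 * b"
    using w er \<epsilon>b ba unfolding w1_def w2_def W1_def W2_def by linarith+
  have Wp: "W1 \<ge> 0" "W2 \<ge> 0" using W ap by linarith+
  have exp2: "exp (2 * ln v) = v\<^sup>2" if "v > 0" for v :: real
    using that by (simp add: exp_double)
  have r: "y 0 * y 2 = (1 - (1 - exp (- W1))) * (y 1)\<^sup>2" "y 1 * y 3 = (1 - (1 - exp (- W2))) * (y 2)\<^sup>2"
    using pos[of 0] pos[of 1] pos[of 2] pos[of 3]
    unfolding W1_def W2_def by (simp_all add: exp_diff exp_add exp2 field_simps)
  have lowerW: "4635 / 10000 * a \<le> 1 - exp (- v)" if v: "4636 / 10000 * a \<le> v" "v \<le> 5024 / 10000 * a" for v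
  proof -
    have v0: "v \<ge> 0" using v ap by linarith
    have "v * v \<le> (5024 / 10000 * a) * (5024 / 10000 * a)" using v v0 by (intro mult_mono) auto
    also have "\<dots> = a * ((5024 / 10000)\<^sup>2 * a)" by (simp add: power2_eq_square)
    also have "\<dots> \<le> a * ((5024 / 10000)\<^sup>2 * (128 / 1000000))" using ap a1 by (intro mult_left_mono) auto
    also have "\<dots> \<le> 1 / 10000 * a" using ap by (simp add: power2_eq_square)
    finally have "v\<^sup>2 / 2 \<le> 1 / 10000 * a" using ap by (simp add: power2_eq_square)
    then show ?thesis using one_minus_exp_bounds(2)[OF v0] v by linarith
  qed
  have "y 1 > 0" "y 2 > 0" using pos by auto
  then show ?thesis
  proof (rule higher_turan_of_ratios[OF _ _ r])
    show "4635 / 10000 * a \<le> 1 - exp (- W1)" "4635 / 10000 * a \<le> 1 - exp (- W2)"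
      using lowerW W by auto
    show "0 < 4635 / 10000 * a" using ap by simp
    show "1 - exp (- W1) \<le> 5024 / 10000 * a" "1 - exp (- W2) \<le> 5024 / 10000 * a"
      using one_minus_exp_bounds(1)[of W1] one_minus_exp_bounds(1)[of W2] Wp W by linarith+
    show "\<bar>1 - exp (- W1) - (1 - exp (- W2))\<bar> \<le> 44 / 10 * b"
      using one_minus_exp_diff[OF Wp] W by linarith
    have "b\<^sup>2 = a ^ 3 * (1 / z)" unfolding a_def b_def using zp by (simp add: field_simps eval_nat_numeral)
    also have "\<dots> \<le> a ^ 3 * (1 / 50)" using ap iz by (intro mult_left_mono) auto
    finally have b2: "b\<^sup>2 \<le> a ^ 3 / 50" by simp
    have "a ^ 4 = a ^ 3 * a" by (simp add: eval_nat_numeral)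
    also have "\<dots> \<le> a ^ 3 * (128 / 1000000)" using ap a1 by (intro mult_left_mono) auto
    finally have a4: "a ^ 4 \<le> a ^ 3 * (128 / 1000000)" .
    \<comment> \<open>At z = 50 this compares about 0.3873 a^3 with 0.3983 a^3; the constant 3 / 8
      in the bound on \<epsilon> nearly exhausts this room.\<close>
    have "(44 / 10 * b)\<^sup>2 + (5024 / 10000 * a) ^ 4 = (44 / 10)\<^sup>2 * b\<^sup>2 + (5024 / 10000) ^ 4 * a ^ 4"
      by (simp only: power_mult_distrib)
    also have "\<dots> \<le> (44 / 10)\<^sup>2 * (a ^ 3 / 50) + 1 * (a ^ 3 * (128 / 1000000))"
      using b2 a4 ap by (intro add_mono mult_mono) (auto simp: eval_nat_numeral)
    also have "\<dots> < 4 * (4635 / 10000) ^ 3 * a ^ 3"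
      using ap by (simp add: eval_nat_numeral)
    also have "\<dots> = 4 * (4635 / 10000 * a) ^ 3" by (simp only: power_mult_distrib mult.assoc)
    finally show "(44 / 10 * b)\<^sup>2 + (5024 / 10000 * a) ^ 4 < 4 * (4635 / 10000 * a) ^ 3" .
  qed
qed

section \<open>Contour integrals\<close>

lemma integral_periodic_shift:
  fixes g :: "real \<Rightarrow> complex"
  assumes cont: "continuous_on UNIV g" and per: "\<And>x. g (x + p) = g x" and a: "- p \<le> a" "a \<le> 0"
  shows "integral {a..a + p} g = integral {0..p} g"
proof -
  have int: "g integrable_on {u..v}" for u v
    by (rule integrable_continuous_real[OF continuous_on_subset[OF cont]]) simp
  have "integral {a..0} g + integral {0..a + p} g = integral {a..a + p} g"
    using a by (intro Henstock_Kurzweil_Integration.integral_combine int) auto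
  moreover have "integral {0..a + p} g + integral {a + p..p} g = integral {0..p} g"
    using a by (intro Henstock_Kurzweil_Integration.integral_combine int) auto
  moreover have "integral {a + p - p..p - p} (\<lambda>x. g (x + p)) = integral {a + p..p} g"
    by (rule integral_shift_real_ivl)
  then have "integral {a..0} g = integral {a + p..p} g" by (simp add: per)
  ultimately show ?thesis by (simp add: add.commute)
qed

text \<open>The integrand of Cauchy's formula with the dual factor and 1 / (2 pi) split off.\<close>

definition main_fun :: "real \<Rightarrow> real \<Rightarrow> complex \<Rightarrow> complex" where
  "main_fun A X t = t * exp (of_real A / t + of_real X * t)"

lemma main_fun_holomorphic: "0 \<notin> S \<Longrightarrow> main_fun A X holomorphic_on S"
  unfolding main_fun_def by (intro holomorphic_intros) auto

text \<open>When exp (A / t) is expanded, the term of index j >= 2 has residue A^j X^(j - 2) / (j!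
  (j - 2)!) at 0 and the first two terms have none; the shifted sum is A^2 bes (A X).\<close>

lemma contour_integral_main_fun:
  assumes \<rho>: "\<rho> > 0"
  shows "contour_integral (circlepath 0 \<rho>) (main_fun A X) = 2 * of_real pi * \<i> * of_real (A\<^sup>2 * bes (A * X))"
    and "main_fun A X contour_integrable_on (circlepath 0 \<rho>)"
proof -
  define h where "h = (\<lambda>j t. (of_real A) ^ j / fact j * (exp (of_real X * t) * t / t ^ j) :: complex)"
  define c where "c = (\<lambda>j. if j < 2 then 0 else 2 * of_real pi * \<i> * of_real (A ^ j / fact j * (X ^ (j - 2) / fact (j - 2))) :: complex)"
  have hc: "(h j has_contour_integral c j) (circlepath 0 \<rho>)" for j
  proof -
    have *: "((\<lambda>t. exp (of_real X * t) * t / t ^ j) has_contour_integral (if j < 2 then 0 else 2 * of_real pi * \<i> * of_real (X ^ (j - 2) / fact (j - 2)))) (circlepath 0 \<rho>)"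
    proof (cases "j < 2")
      case True
      have e1: "((\<lambda>t. exp (of_real X * t) * t ^ (1 - j)) has_contour_integral 0) (circlepath 0 \<rho>)"
        by (rule Cauchy_theorem_convex_simple[of _ UNIV]) (auto intro!: holomorphic_intros)
      have e2: "exp (of_real X * t) * t ^ (1 - j) = exp (of_real X * t) * t / t ^ j" if "t \<in> path_image (circlepath 0 \<rho>)" for t
      proof -
        have "t \<noteq> 0" using that \<rho> by auto
        then show ?thesis using True by (cases j) auto
      qed
      from has_contour_integral_eq[OF e1 e2] show ?thesis using True by simp
    next
      case False
      then obtain i where i: "j = Suc (Suc i)" by (metis One_nat_def Suc_1 add_2_eq_Suc le_Suc_ex not_le)
      have "((\<lambda>u. exp (of_real X * u) / (u - 0) ^ Suc i) has_contour_integral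
         ((2 * pi * \<i>) / (fact i) * (deriv ^^ i) (\<lambda>u. exp (of_real X * u)) 0)) (circlepath 0 \<rho>)"
        by (rule Cauchy_has_contour_integral_higher_derivative_circlepath)
           (use \<rho> in \<open>auto intro!: holomorphic_intros continuous_intros\<close>)
      moreover have "(deriv ^^ i) (\<lambda>u. exp (of_real X * u)) = (\<lambda>u. (of_real X :: complex) ^ i * exp (of_real X * u))"
      proof (induction i)
        case (Suc i)
        show ?case
        proof
          fix u :: complex
          have "((\<lambda>u. (of_real X :: complex) ^ i * exp (of_real X * u)) has_field_derivative (of_real X) ^ Suc i * exp (of_real X * u)) (at u)"
            by (auto intro!: derivative_eq_intros)
          then show "(deriv ^^ Suc i) (\<lambda>u. exp (of_real X * u)) u = (of_real X) ^ Suc i * exp (of_real X * u)"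
            by (simp add: Suc.IH DERIV_imp_deriv)
        qed
      qed simp
      ultimately have e1: "((\<lambda>u. exp (of_real X * u) / u ^ Suc i) has_contour_integral
         (2 * of_real pi * \<i> * of_real (X ^ i / fact i))) (circlepath 0 \<rho>)" by simp
      have e2: "exp (of_real X * t) / t ^ Suc i = exp (of_real X * t) * t / t ^ j" if "t \<in> path_image (circlepath 0 \<rho>)" for t
      proof -
        have "t \<noteq> 0" using that \<rho> by auto
        then show ?thesis unfolding i by simp
      qed
      from has_contour_integral_eq[OF e1 e2] show ?thesis using False unfolding i by simp
    qed
    have cj: "c j = of_real A ^ j / fact j * (if j < 2 then 0 else 2 * of_real pi * \<i> * of_real (X ^ (j - 2) / fact (j - 2)))"
      by (simp add: c_def mult_ac)
    show ?thesis unfolding h_def cj by (rule has_contour_integral_lmul[OF *])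
  qed
  define M where "M = (\<lambda>j. \<rho> * exp (\<bar>X\<bar> * \<rho>) * ((\<bar>A\<bar> / \<rho>) ^ j / fact j))"
  have sM: "summable M"
    unfolding M_def using summable_exp[of "\<bar>A\<bar> / \<rho>"] by (intro summable_mult) (simp add: field_simps)
  have bound: "norm (h j t) \<le> M j" if "t \<in> sphere 0 \<rho>" for j t
  proof -
    have nt: "norm t = \<rho>" using that by simp
    have "Re (of_real X * t) \<le> norm (of_real X * t)" by (rule complex_Re_le_cmod)
    then have e1: "norm (exp (of_real X * t)) \<le> exp (\<bar>X\<bar> * \<rho>)" by (simp add: norm_mult nt)
    have e2: "norm (h j t) = norm (exp (of_real X * t)) * (\<rho> * ((\<bar>A\<bar> / \<rho>) ^ j / fact j))"
      unfolding h_def by (simp add: norm_mult norm_divide norm_power nt power_divide mult_ac)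
    have "norm (h j t) \<le> exp (\<bar>X\<bar> * \<rho>) * (\<rho> * ((\<bar>A\<bar> / \<rho>) ^ j / fact j))"
      unfolding e2 using \<rho> by (intro mult_right_mono e1) auto
    then show ?thesis by (simp add: M_def mult_ac)
  qed
  have lim: "(\<Sum>j. h j t) = main_fun A X t" if "t \<in> sphere 0 \<rho>" for t
  proof -
    have "t \<noteq> 0" using that \<rho> by auto
    have "(\<lambda>j. (of_real A / t) ^ j /\<^sub>R fact j) sums exp (of_real A / t)" by (rule exp_converges)
    from sums_mult[OF this, of "exp (of_real X * t) * t"]
    have "(\<lambda>j. h j t) sums (exp (of_real X * t) * t * exp (of_real A / t))"
      unfolding h_def by (simp add: scaleR_conv_of_real field_simps power_divide)
    then show ?thesis unfolding main_fun_def by (simp add: sums_iff exp_add mult_ac)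
  qed
  have ul: "uniform_limit (sphere 0 \<rho>) (\<lambda>n t. \<Sum>j<n. h j t) (main_fun A X) sequentially"
    by (rule iffD1[OF uniform_limit_cong'[OF refl lim] Weierstrass_m_test[OF bound sM]])
  have ci: "((\<lambda>t. \<Sum>j<n. h j t) has_contour_integral (\<Sum>j<n. c j)) (circlepath 0 \<rho>)" for n
    by (intro has_contour_integral_sum hc) simp
  have ev: "\<forall>\<^sub>F n in sequentially. (\<lambda>t. \<Sum>j<n. h j t) contour_integrable_on (circlepath 0 \<rho>)"
    by (intro always_eventually allI has_contour_integral_integrable[OF ci])
  note L = contour_integral_uniform_limit_circlepath[OF ev ul _ \<rho>]
  show "main_fun A X contour_integrable_on (circlepath 0 \<rho>)" by (rule L(1)) simp
  have "(\<lambda>n. contour_integral (circlepath 0 \<rho>) (\<lambda>t. \<Sum>j<n. h j t)) \<longlonglongrightarrow> contour_integral (circlepath 0 \<rho>) (main_fun A X)"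
    by (rule L(2)) simp
  then have "c sums contour_integral (circlepath 0 \<rho>) (main_fun A X)"
    by (simp add: contour_integral_unique[OF ci] sums_def)
  moreover have "c sums (2 * of_real pi * \<i> * of_real (A\<^sup>2 * bes (A * X)))"
  proof -
    have "(\<lambda>i. A\<^sup>2 * (bes_coeff i * (A * X) ^ i)) sums (A\<^sup>2 * bes (A * X))"
      unfolding bes_def by (intro sums_mult summable_sums summable_bes)
    then have "(\<lambda>i. complex_of_real (A\<^sup>2 * (bes_coeff i * (A * X) ^ i))) sums of_real (A\<^sup>2 * bes (A * X))"
      by (rule sums_of_real)
    then have "(\<lambda>i. 2 * of_real pi * \<i> * complex_of_real (A\<^sup>2 * (bes_coeff i * (A * X) ^ i))) sums (2 * of_real pi * \<i> * of_real (A\<^sup>2 * bes (A * X)))"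
      by (rule sums_mult)
    moreover have "2 * of_real pi * \<i> * complex_of_real (A\<^sup>2 * (bes_coeff i * (A * X) ^ i)) = c (i + 2)" for i
      unfolding c_def bes_coeff_def by (simp add: power_mult_distrib power_add mult_ac power2_eq_square del: fact_Suc)
    ultimately have "(\<lambda>i. c (i + 2)) sums (2 * of_real pi * \<i> * of_real (A\<^sup>2 * bes (A * X)))" by simp
    moreover have "(\<Sum>i<2. c i) = 0" by (simp add: c_def)
    ultimately show ?thesis using sums_iff_shift[of c 2] by simp
  qed
  ultimately show "contour_integral (circlepath 0 \<rho>) (main_fun A X) = 2 * of_real pi * \<i> * of_real (A\<^sup>2 * bes (A * X))"
    by (rule sums_unique2)
qed

text \<open>The chord \<open>Re t = \<rho> cos \<alpha>\<close> is homotopic to the right-hand arc of the circle, and on the left-hand arc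
  both \<open>Re t\<close> and \<open>Re (1 / t)\<close> are at most their values at the end points of the chord.\<close>

lemma chord_integral:
  assumes \<rho>: "\<rho> > 0" and \<alpha>: "0 < \<alpha>" "\<alpha> < pi / 2" and AX: "A \<ge> 0" "X \<ge> 0"
  shows "norm (integral {- (\<rho> * sin \<alpha>)..\<rho> * sin \<alpha>} (\<lambda>y. main_fun A X (Complex (\<rho> * cos \<alpha>) y))
            - of_real (2 * pi * A\<^sup>2 * bes (A * X)))
           \<le> 2 * pi * \<rho>\<^sup>2 * exp (A * cos \<alpha> / \<rho> + X * (\<rho> * cos \<alpha>))"
proof -
  let ?f = "main_fun A X"
  define a where "a = Complex (\<rho> * cos \<alpha>) (- (\<rho> * sin \<alpha>))"
  define b where "b = Complex (\<rho> * cos \<alpha>) (\<rho> * sin \<alpha>)"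
  have ca: "cos \<alpha> > 0" "sin \<alpha> > 0" using \<alpha> pi_gt_zero by (auto intro!: cos_gt_zero sin_gt_zero)
  let ?H = "{t::complex. Re t > 0}"
  have cH: "convex ?H" by (rule convex_halfspace_Re_gt)
  have hol: "?f holomorphic_on ?H" by (rule main_fun_holomorphic) simp
  obtain F where F: "\<And>x. x \<in> ?H \<Longrightarrow> (F has_field_derivative ?f x) (at x within ?H)"
    using holomorphic_convex_primitive'[OF cH open_halfspace_Re_gt hol] by blast
  define arc where "arc = part_circlepath 0 \<rho> (- \<alpha>) \<alpha>"
  have arcs: "pathstart arc = a" "pathfinish arc = b"
    unfolding arc_def a_def b_def by (simp_all add: complex_eq_iff Re_exp Im_exp)
  have arcH: "path_image arc \<subseteq> ?H"
  proof
    fix t assume "t \<in> path_image arc"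
    then obtain x where x: "- \<alpha> \<le> x" "x \<le> \<alpha>" "t = \<rho> * exp (\<i> * x)"
      unfolding arc_def using \<alpha> by (auto simp: path_image_part_circlepath)
    have "cos x > 0" using x \<alpha> by (intro cos_gt_zero_pi) auto
    then show "t \<in> ?H" using x \<rho> by (simp add: Re_exp)
  qed
  have lineH: "path_image (linepath a b) \<subseteq> ?H"
  proof -
    have "closed_segment a b \<subseteq> ?H"
      using cH \<rho> ca by (intro closed_segment_subset) (auto simp: a_def b_def)
    then show ?thesis by simp
  qed
  have "(?f has_contour_integral (F b - F a)) arc"
    using contour_integral_primitive[OF F _ arcH] arcs unfolding arc_def by simp
  moreover have "(?f has_contour_integral (F b - F a)) (linepath a b)"
    using contour_integral_primitive[OF F _ lineH] by simp
  ultimately have eq: "contour_integral (linepath a b) ?f = contour_integral arc ?f"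
    by (simp add: contour_integral_unique)
  have line: "contour_integral (linepath a b) ?f = \<i> * integral {- (\<rho> * sin \<alpha>)..\<rho> * sin \<alpha>} (\<lambda>y. ?f (Complex (\<rho> * cos \<alpha>) y))"
    by (rule contour_integral_linepath_same_Re) (use \<rho> ca in \<open>auto simp: a_def b_def\<close>)
  define g where "g = (\<lambda>x::real. ?f (\<rho> * cis x) * \<rho> * \<i> * cis x)"
  have cg: "continuous_on UNIV g"
    unfolding g_def main_fun_def using \<rho> by (intro continuous_intros) auto
  have int: "g integrable_on {u..v}" for u v
    by (rule integrable_continuous_real[OF continuous_on_subset[OF cg]]) simp
  have gp: "g (x + 2 * pi) = g x" for x
    unfolding g_def by (simp flip: cis_mult)
  have A1: "contour_integral arc ?f = integral {- \<alpha>..\<alpha>} g"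
    unfolding arc_def g_def using \<alpha> by (subst contour_integral_part_circlepath_eq) auto
  have A2: "contour_integral (part_circlepath 0 \<rho> \<alpha> (2 * pi - \<alpha>)) ?f = integral {\<alpha>..2 * pi - \<alpha>} g"
    unfolding g_def using \<alpha> by (subst contour_integral_part_circlepath_eq) auto
  have A3: "contour_integral (circlepath 0 \<rho>) ?f = integral {0..2 * pi} g"
    unfolding g_def circlepath_def by (subst contour_integral_part_circlepath_eq) auto
  \<comment> \<open>The two arcs make up a full turn that starts at - \<alpha>; periodicity moves it
    to the standard circle.\<close>
  have "integral {- \<alpha>..\<alpha>} g + integral {\<alpha>..2 * pi - \<alpha>} g = integral {- \<alpha>..2 * pi - \<alpha>} g"
    using \<alpha> by (intro Henstock_Kurzweil_Integration.integral_combine int) auto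
  also have "\<dots> = integral {0..2 * pi} g"
    using integral_periodic_shift[OF cg gp, of "- \<alpha>"] \<alpha> by simp
  finally have sum: "\<i> * integral {- (\<rho> * sin \<alpha>)..\<rho> * sin \<alpha>} (\<lambda>y. ?f (Complex (\<rho> * cos \<alpha>) y))
      - 2 * of_real pi * \<i> * of_real (A\<^sup>2 * bes (A * X)) = - contour_integral (part_circlepath 0 \<rho> \<alpha> (2 * pi - \<alpha>)) ?f"
    unfolding line[symmetric] eq A1 A2 contour_integral_main_fun(1)[OF \<rho>, symmetric] A3
    by (simp add: algebra_simps)
  define B where "B = \<rho> * exp (A * cos \<alpha> / \<rho> + X * (\<rho> * cos \<alpha>))"
  have "norm (contour_integral (part_circlepath 0 \<rho> \<alpha> (2 * pi - \<alpha>)) ?f) \<le> B * \<rho> * \<bar>2 * pi - \<alpha> - \<alpha>\<bar>"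
  proof (rule contour_integral_bound_part_circlepath)
    show "?f contour_integrable_on part_circlepath 0 \<rho> \<alpha> (2 * pi - \<alpha>)"
    proof (rule contour_integrable_continuous_part_circlepath)
      have "0 \<notin> path_image (part_circlepath 0 \<rho> \<alpha> (2 * pi - \<alpha>))"
        using \<rho> \<alpha> by (auto simp: path_image_part_circlepath)
      then show "continuous_on (path_image (part_circlepath 0 \<rho> \<alpha> (2 * pi - \<alpha>))) ?f"
        by (intro holomorphic_on_imp_continuous_on main_fun_holomorphic)
    qed
    show "B \<ge> 0" "\<rho> \<ge> 0" using \<rho> by (auto simp: B_def)
    fix t assume "t \<in> path_image (part_circlepath 0 \<rho> \<alpha> (2 * pi - \<alpha>))"
    then obtain x where x: "\<alpha> \<le> x" "x \<le> 2 * pi - \<alpha>" "t = \<rho> * exp (\<i> * x)"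
      using \<alpha> by (auto simp: path_image_part_circlepath)
    have c: "cos x \<le> cos \<alpha>"
    proof (cases "x \<le> pi")
      case True
      then show ?thesis using x \<alpha> by (intro cos_monotone_0_pi_le) auto
    next
      case False
      have "cos (2 * pi - x) \<le> cos \<alpha>" using x \<alpha> False by (intro cos_monotone_0_pi_le) auto
      then show ?thesis by (simp add: cos_diff)
    qed
    have nt: "norm t = \<rho>" using x \<rho> by (simp add: norm_mult)
    have Ret: "Re t = \<rho> * cos x" using x by (simp add: Re_exp)
    have "of_real A / t = of_real A * cnj t / of_real (\<rho>\<^sup>2)"
      using complex_div_cnj[of "of_real A" t] nt by simp
    then have "Re (of_real A / t) = A * (\<rho> * cos x) / \<rho>\<^sup>2"
      unfolding Ret[symmetric] by (simp only: Re_divide_of_real) simp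
    also have "\<dots> = A * cos x / \<rho>" using \<rho> by (simp add: power2_eq_square)
    finally have "Re (of_real A / t) = A * cos x / \<rho>" .
    then have "Re (of_real A / t + of_real X * t) = A * cos x / \<rho> + X * (\<rho> * cos x)"
      using Ret by simp
    also have "\<dots> \<le> A * cos \<alpha> / \<rho> + X * (\<rho> * cos \<alpha>)"
      using c AX \<rho> by (intro add_mono divide_right_mono mult_left_mono) auto
    finally show "norm (?f t) \<le> B"
      unfolding main_fun_def B_def using nt \<rho> by (simp add: norm_mult)
  qed
  also have "\<dots> \<le> B * \<rho> * (2 * pi)"
    using \<alpha> \<rho> by (intro mult_left_mono) (auto simp: B_def)
  finally have "norm (\<i> * integral {- (\<rho> * sin \<alpha>)..\<rho> * sin \<alpha>} (\<lambda>y. ?f (Complex (\<rho> * cos \<alpha>) y))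
      - 2 * of_real pi * \<i> * of_real (A\<^sup>2 * bes (A * X))) \<le> 2 * pi * \<rho>\<^sup>2 * exp (A * cos \<alpha> / \<rho> + X * (\<rho> * cos \<alpha>))"
    unfolding sum norm_minus_cancel by (simp add: B_def power2_eq_square mult_ac)
  moreover have "\<i> * integral {- (\<rho> * sin \<alpha>)..\<rho> * sin \<alpha>} (\<lambda>y. ?f (Complex (\<rho> * cos \<alpha>) y))
      - 2 * of_real pi * \<i> * of_real (A\<^sup>2 * bes (A * X)) =
     \<i> * (integral {- (\<rho> * sin \<alpha>)..\<rho> * sin \<alpha>} (\<lambda>y. ?f (Complex (\<rho> * cos \<alpha>) y)) - of_real (2 * pi * A\<^sup>2 * bes (A * X)))"
    by (simp add: algebra_simps)
  ultimately show ?thesis by (simp only: norm_mult norm_ii mult_1)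
qed

section \<open>The coefficients as integrals over a vertical segment\<close>

text \<open>Cauchy's formula needs complex power series, whereas the generating function is defined
  over the reals.\<close>

definition complex_fps :: "real fps \<Rightarrow> complex fps" where
  "complex_fps F = Abs_fps (\<lambda>n. of_real (fps_nth F n))"

lemma complex_fps_nth [simp]: "fps_nth (complex_fps F) n = of_real (fps_nth F n)"
  by (simp add: complex_fps_def)

lemma complex_fps_1: "complex_fps 1 = 1"
  by (rule fps_ext) (simp add: fps_one_nth)

lemma complex_fps_diff: "complex_fps (F - G) = complex_fps F - complex_fps G"
  by (rule fps_ext) simp

lemma complex_fps_mult: "complex_fps (F * G) = complex_fps F * complex_fps G"
  by (rule fps_ext) (simp add: fps_mult_nth)

lemma complex_fps_power: "complex_fps (F ^ n) = complex_fps F ^ n"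
  by (induction n) (simp_all add: complex_fps_1 complex_fps_mult)

lemma complex_fps_X: "complex_fps fps_X = fps_X"
  by (rule fps_ext) (simp add: fps_X_def)

lemma complex_fps_divide:
  assumes "fps_nth G 0 \<noteq> 0"
  shows "complex_fps (F / G) = complex_fps F / complex_fps G"
proof -
  have "G \<noteq> 0" "subdegree G = 0" using assms by auto
  then have "F / G * G = F" by (simp add: fps_divide_unit assms mult.assoc inverse_mult_eq_1)
  then have "complex_fps (F / G) * complex_fps G = complex_fps F" by (simp flip: complex_fps_mult)
  moreover have "fps_nth (complex_fps G) 0 \<noteq> 0" using assms by simp
  ultimately show ?thesis
    by (metis fps_divide_unit inverse_mult_eq_1' mult.assoc mult.right_neutral)
qed

lemma complex_fps_prod: "complex_fps (\<Prod>i\<in>A. F i) = (\<Prod>i\<in>A. complex_fps (F i))"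
  by (induction A rule: infinite_finite_induct) (simp_all add: complex_fps_1 complex_fps_mult)

definition factor_fun :: "nat \<Rightarrow> nat \<Rightarrow> complex \<Rightarrow> complex" where
  "factor_fun k n z = ((1 - z ^ (2 * n)) * (1 - z ^ ((2 * k + 1) * n))) /
     ((1 - z ^ n) ^ 3 * (1 - z ^ ((4 * k + 2) * n)))"

lemma factor_fun_expansion:
  assumes "n > 0"
  shows "factor_fun k n has_fps_expansion complex_fps (broken_diamond_factor k n)"
proof -
  have z: "fps_nth ((1 - fps_X ^ n) ^ 3 * (1 - fps_X ^ ((4 * k + 2) * n))) 0 = (1 :: real)"
    using assms by (simp add: fps_nth_power_0 power_0_left)
  have z': "fps_nth ((1 - fps_X ^ n) ^ 3 * (1 - fps_X ^ ((4 * k + 2) * n))) 0 = (1 :: complex)"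
    using assms by (simp add: fps_nth_power_0 power_0_left)
  have "complex_fps (broken_diamond_factor k n) = ((1 - fps_X ^ (2 * n)) * (1 - fps_X ^ ((2 * k + 1) * n))) /
     ((1 - fps_X ^ n) ^ 3 * (1 - fps_X ^ ((4 * k + 2) * n)))"
    unfolding broken_diamond_factor_def using z
    by (simp only: complex_fps_divide complex_fps_mult complex_fps_power complex_fps_diff complex_fps_1 complex_fps_X one_neq_zero not_False_eq_True)
  moreover have "factor_fun k n has_fps_expansion ((1 - fps_X ^ (2 * n)) * (1 - fps_X ^ ((2 * k + 1) * n))) /
     ((1 - fps_X ^ n) ^ 3 * (1 - fps_X ^ ((4 * k + 2) * n)))"
    unfolding factor_fun_def[abs_def]
    by (rule has_fps_expansion_divide') (use z' in \<open>auto intro!: fps_expansion_intros\<close>)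
  ultimately show ?thesis by simp
qed

lemma factor_fun_holomorphic:
  assumes "n > 0"
  shows "factor_fun k n holomorphic_on ball 0 1"
proof -
  have "1 - z ^ m \<noteq> 0" if "z \<in> ball 0 1" "m > 0" for z :: complex and m
  proof -
    have "norm z ^ m < 1 ^ m" using that by (intro power_strict_mono) auto
    then have "norm (z ^ m) < 1" by (simp add: norm_power)
    then show ?thesis by auto
  qed
  then show ?thesis
    unfolding factor_fun_def[abs_def] using assms by (intro holomorphic_intros) auto
qed

text \<open>X-adic convergence means that each coefficient is eventually constant.
  \<open>has_prod\<close> also covers products with a zero factor; the constant coefficients of the
  factors exclude that alternative.\<close>

lemma eventually_broken_diamond_eq:
  "eventually (\<lambda>N. fps_nth (\<Prod>i\<le>N. broken_diamond_factor k (Suc i)) n = broken_diamond k n) sequentially"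
proof -
  let ?f = "\<lambda>i. broken_diamond_factor k (Suc i)"
  have "?f i \<noteq> 0" for i
  proof
    assume "?f i = 0"
    moreover obtain h where "?f i - 1 = fps_X ^ Suc i * h"
      using fps_X_power_dvd_broken_diamond_factor_minus_1[of "Suc i" k] by blast
    ultimately have "fps_nth (0 - 1 :: real fps) 0 = fps_nth (fps_X ^ Suc i * h) 0" by metis
    then show False by (simp add: fps_X_power_mult_nth)
  qed
  then have "(\<lambda>N. \<Prod>i\<le>N. ?f i) \<longlonglongrightarrow> broken_diamond_gf k"
    using has_prod_broken_diamond_gf[of k] by (auto simp: has_prod_def raw_has_prod_def)
  then show ?thesis unfolding broken_diamond_def by (simp add: tendsto_fps_iff)
qed

definition prod_log_sum :: "nat \<Rightarrow> nat \<Rightarrow> complex \<Rightarrow> complex" where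
  "prod_log_sum k N t = 3 * (\<Sum>i\<le>N. prod_log t i) - (\<Sum>i\<le>N. prod_log (2 * t) i)
     - (\<Sum>i\<le>N. prod_log (of_real (real (2 * k + 1)) * t) i) + (\<Sum>i\<le>N. prod_log (2 * of_real (real (2 * k + 1)) * t) i)"

lemma exp_prod_log:
  assumes "Re t > 0"
  shows "exp (prod_log t i) = 1 / (1 - exp (- t) ^ Suc i)" "1 - exp (- t) ^ Suc i \<noteq> 0"
proof -
  have e: "exp (- (of_nat (Suc i) * t)) = exp (- t) ^ Suc i"
    by (simp only: exp_of_nat_mult flip: mult_minus_right)
  show nz: "1 - exp (- t) ^ Suc i \<noteq> 0"
    using norm_one_minus_exp_ge(3)[OF order_refl assms, of i] unfolding e .
  show "exp (prod_log t i) = 1 / (1 - exp (- t) ^ Suc i)"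
    by (simp only: prod_log_def e exp_minus[of "Ln _"] exp_Ln[OF nz] inverse_eq_divide)
qed

lemma prod_factor_fun:
  assumes "Re t > 0"
  shows "(\<Prod>i\<le>N. factor_fun k (Suc i) (exp (- t))) = exp (prod_log_sum k N t)"
proof -
  define q where "q = exp (- t)"
  have pw: "exp (- (of_real (real c) * t)) = q ^ c" for c
    unfolding q_def using exp_of_nat_mult[of c "- t"] by simp
  have E: "exp (prod_log (of_real (real c) * t) i) = 1 / (1 - q ^ (c * Suc i))" "1 - q ^ (c * Suc i) \<noteq> 0" if "c > 0" for c i
    using exp_prod_log[of "of_real (real c) * t" i] that assms unfolding pw power_mult by auto
  have "factor_fun k (Suc i) q = exp (3 * prod_log (of_real (real 1) * t) i - prod_log (of_real (real 2) * t) i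
      - prod_log (of_real (real (2 * k + 1)) * t) i + prod_log (of_real (real (2 * (2 * k + 1))) * t) i)" for i
  proof -
    have e3: "exp (3 * u) = exp u ^ 3" for u :: complex using exp_of_nat_mult[of 3 u] by simp
    have "(4 * k + 2) = 2 * (2 * k + 1)" by simp
    then show ?thesis
      unfolding factor_fun_def exp_add exp_diff e3 using E[of 1 i] E[of 2 i] E[of "2 * k + 1" i] E[of "2 * (2 * k + 1)" i]
      by (simp only: zero_less_one zero_less_numeral nat_0_less_mult_iff add_gr_0 mult_1 simp_thms)
         (simp add: field_simps power_divide del: mult_Suc_right power_Suc)
  qed
  then have "(\<Prod>i\<le>N. factor_fun k (Suc i) q) = exp (\<Sum>i\<le>N. 3 * prod_log (of_real (real 1) * t) i - prod_log (of_real (real 2) * t) i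
      - prod_log (of_real (real (2 * k + 1)) * t) i + prod_log (of_real (real (2 * (2 * k + 1))) * t) i)"
    by (simp add: exp_sum)
  also have "(\<Sum>i\<le>N. 3 * prod_log (of_real (real 1) * t) i - prod_log (of_real (real 2) * t) i
      - prod_log (of_real (real (2 * k + 1)) * t) i + prod_log (of_real (real (2 * (2 * k + 1))) * t) i) = prod_log_sum k N t"
    unfolding prod_log_sum_def by (simp add: sum.distrib sum_subtractf sum_distrib_left)
  finally show ?thesis unfolding q_def .
qed

lemma norm_prod_log_le:
  assumes "Re t \<ge> r" "r > 0"
  shows "norm (prod_log t i) \<le> exp (- r) ^ Suc i * (1 / (1 - exp (- r)))"
proof -
  define w where "w = exp (- (of_nat (Suc i) * t))"
  have nw: "norm w \<le> exp (- r) ^ Suc i" unfolding w_def by (rule norm_one_minus_exp_ge(2)[OF assms])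
  have "exp (- r) ^ Suc i \<le> exp (- r) ^ 1" using assms by (intro power_decreasing) auto
  from order_trans[OF nw this] have nw1: "norm w \<le> exp (- r)" by (simp only: power_one_right)
  have r1: "exp (- r) < 1" using assms by simp
  have w1: "norm w < 1" using nw1 r1 by linarith
  have "norm (- Ln (1 - w)) \<le> norm w * (1 / (1 - norm w))"
  proof (rule norm_sums_le)
    show "(\<lambda>m. w ^ Suc m / of_nat (Suc m)) sums (- Ln (1 - w))"
      by (rule sums_Ln_one_minus[OF w1])
    show "(\<lambda>m. norm w * norm w ^ m) sums (norm w * (1 / (1 - norm w)))"
      by (intro sums_mult geometric_sums) (use w1 in simp)
    show "norm (w ^ Suc m / of_nat (Suc m)) \<le> norm w * norm w ^ m" for m
    proof -
      have "norm (w ^ Suc m / of_nat (Suc m)) = norm w ^ Suc m / real (Suc m)"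
        by (simp only: norm_divide norm_power norm_of_nat)
      also have "\<dots> \<le> norm w ^ Suc m / 1" by (intro divide_left_mono) auto
      finally show ?thesis by simp
    qed
  qed
  also have "\<dots> \<le> exp (- r) ^ Suc i * (1 / (1 - exp (- r)))"
    using nw nw1 r1 less_imp_le[OF w1] by (intro mult_mono frac_le) auto
  finally show ?thesis unfolding prod_log_def w_def .
qed

text \<open>Uniform in N, hence a majorant for letting N tend to infinity under the
  integral.\<close>

lemma norm_prod_log_sum_le:
  assumes "Re t \<ge> r" "r > 0"
  shows "norm (prod_log_sum k N t) \<le> 6 * (exp (- r) / (1 - exp (- r))\<^sup>2)"
proof -
  let ?B = "exp (- r) / (1 - exp (- r))\<^sup>2"
  have S: "norm (\<Sum>i\<le>N. prod_log (of_real c * t) i) \<le> ?B" if "c \<ge> 1" for c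
  proof -
    have "r \<le> c * Re t"
    proof -
      have "1 * r \<le> c * Re t" using that assms by (intro mult_mono) auto
      then show ?thesis by simp
    qed
    then have "norm (\<Sum>i\<le>N. prod_log (of_real c * t) i) \<le> (\<Sum>i\<le>N. exp (- r) ^ Suc i * (1 / (1 - exp (- r))))"
      by (intro sum_norm_le norm_prod_log_le) (use assms in auto)
    also have "\<dots> \<le> (\<Sum>i. exp (- r) ^ Suc i * (1 / (1 - exp (- r))))"
      using assms by (intro sum_le_suminf summable_mult2 summable_exp_Suc) auto
    also have "\<dots> = ?B"
    proof -
      have "(\<lambda>i. exp (- r) * exp (- r) ^ i * (1 / (1 - exp (- r)))) sums (exp (- r) * (1 / (1 - exp (- r))) * (1 / (1 - exp (- r))))"
        using assms by (intro sums_mult2 sums_mult geometric_sums) auto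
      then show ?thesis by (simp add: sums_iff power2_eq_square)
    qed
    finally show ?thesis .
  qed
  let ?m = "real (2 * k + 1)"
  have "norm (prod_log_sum k N t) \<le> 3 * ?B + ?B + ?B + ?B"
    unfolding prod_log_sum_def
    by (intro norm_triangle_le norm_triangle_le_diff add_mono order_trans[OF norm_mult_ineq])
       (use S[of 1] S[of 2] S[of ?m] S[of "2 * ?m"] in auto)
  then show ?thesis by simp
qed

lemma prod_log_sum_tendsto:
  assumes "Re t > 0"
  shows "(\<lambda>N. prod_log_sum k N t) \<longlonglongrightarrow> bd_log (real (2 * k + 1)) t"
proof -
  have S: "(\<lambda>N. \<Sum>i\<le>N. prod_log (of_real c * t) i) \<longlonglongrightarrow> lam (of_real c * t)" if "c > 0" for c
    using prod_log_sums[of "of_real c * t"] that assms by (simp add: sums_def_le)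
  show ?thesis
    unfolding prod_log_sum_def bd_log_def
    using S[of 1] S[of 2] S[of "real (2 * k + 1)"] S[of "2 * real (2 * k + 1)"]
    by (intro tendsto_intros) (simp_all del: of_nat_mult of_nat_add of_nat_Suc)
qed

text \<open>Cauchy's formula is applied to the partial products, which are holomorphic in the unit
  disc and whose n-th coefficient is eventually the wanted one. Dominated convergence then brings in
  \<open>bd_log\<close>, so the formal and the analytic limit meet under the integral.\<close>

lemma broken_diamond_integral:
  assumes r: "r > 0"
  shows "of_real (2 * pi * broken_diamond k n) =
     integral {- pi..pi} (\<lambda>y. exp (bd_log (real (2 * k + 1)) (Complex r y) + of_nat n * Complex r y))"
    and "(\<lambda>y. exp (bd_log (real (2 * k + 1)) (Complex r y) + of_nat n * Complex r y)) integrable_on {- pi..pi}"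
proof -
  define x where "x = exp (- r)"
  have x: "0 < x" "x < 1" using r by (auto simp: x_def)
  define P where "P = (\<lambda>N z. \<Prod>i\<le>N. factor_fun k (Suc i) z)"
  define g where "g = (\<lambda>N y. exp (prod_log_sum k N (Complex r y) + of_nat n * Complex r y))"
  have cisx: "of_real x * cis (- y) = exp (- Complex r y)" for y
    by (simp add: x_def exp_eq_polar)
  have int: "(g N has_integral of_real (2 * pi) * of_real (fps_nth (\<Prod>i\<le>N. broken_diamond_factor k (Suc i)) n)) {- pi..pi}" for N
  proof -
    define c where "c = complex_of_real (fps_nth (\<Prod>i\<le>N. broken_diamond_factor k (Suc i)) n)"
    have exp: "P N has_fps_expansion complex_fps (\<Prod>i\<le>N. broken_diamond_factor k (Suc i))"
      unfolding P_def complex_fps_prod by (intro has_fps_expansion_prod factor_fun_expansion) simp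
    have hol: "P N holomorphic_on ball 0 1"
      unfolding P_def by (intro holomorphic_intros factor_fun_holomorphic) simp
    have sub: "cball (0 :: complex) x \<subseteq> ball 0 1" "ball (0 :: complex) x \<subseteq> ball 0 1" using x by auto
    have "((\<lambda>u. P N u / (u - 0) ^ Suc n) has_contour_integral ((2 * pi * \<i>) / fact n * (deriv ^^ n) (P N) 0)) (circlepath 0 x)"
      by (rule Cauchy_has_contour_integral_higher_derivative_circlepath)
        (use x sub in \<open>auto intro: holomorphic_on_imp_continuous_on holomorphic_on_subset[OF hol]\<close>)
    moreover have "(deriv ^^ n) (P N) 0 = fact n * c"
      using fps_nth_fps_expansion[OF exp, of n] by (simp add: c_def)
    ultimately have "((\<lambda>u. P N u / u ^ Suc n) has_contour_integral (2 * pi * \<i> * c)) (part_circlepath 0 x 0 (2 * pi))"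
      by (simp add: circlepath_def mult_ac del: power_Suc)
    then have h: "((\<lambda>y. P N (x * cis y) / (x * cis y) ^ Suc n * x * \<i> * cis y) has_integral (2 * pi * \<i> * c)) {0..2 * pi}"
      by (subst (asm) has_contour_integral_part_circlepath_iff) auto
    define G where "G = (\<lambda>y. P N (x * cis y) / (x * cis y) ^ n)"
    have "(\<lambda>y. P N (x * cis y) / (x * cis y) ^ Suc n * x * \<i> * cis y) = (\<lambda>y. \<i> * G y)"
      unfolding G_def using x by (auto simp: field_simps)
    with h have "((\<lambda>y. \<i> * G y) has_integral (2 * pi * \<i> * c)) {0..2 * pi}" by simp
    from has_integral_mult_right[OF this, of "- \<i>"] have G0: "integral {0..2 * pi} G = 2 * pi * c"
      by (simp add: integral_unique mult_ac)
    have "continuous_on UNIV (\<lambda>y. P N (x * cis y))"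
      by (rule continuous_on_compose2[OF holomorphic_on_imp_continuous_on[OF hol]])
         (use x in \<open>auto intro!: continuous_intros simp: norm_mult\<close>)
    then have cG: "continuous_on UNIV G"
      unfolding G_def using x by (intro continuous_intros) auto
    have "G (y + 2 * pi) = G y" for y unfolding G_def by (simp flip: cis_mult)
    from integral_periodic_shift[OF cG this, of "- pi"] have "integral {- pi..pi} G = 2 * pi * c"
      using G0 by simp
    then have "(G has_integral 2 * pi * c) {- pi..pi}"
      using integrable_integral[OF integrable_continuous_real[OF continuous_on_subset[OF cG subset_UNIV]], of "- pi" pi] by simp
    \<comment> \<open>Since q = exp (- t), increasing Im t runs through the circle
      clockwise.\<close>
    from iffD2[OF has_integral_reflect_real[where f = G and a = "- pi" and b = pi] this]
    have "((\<lambda>y. G (- y)) has_integral 2 * pi * c) {- pi..pi}" by (simp only: minus_minus)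
    moreover have "G (- y) = g N y" for y
    proof -
      have "(of_real x * cis (- y)) ^ n = exp (- (of_nat n * Complex r y))"
        unfolding cisx by (simp only: exp_of_nat_mult flip: mult_minus_right)
      then show ?thesis
        unfolding G_def g_def P_def exp_add using prod_factor_fun[of "Complex r y" k N] r
        by (simp add: cisx exp_minus field_simps)
    qed
    ultimately show ?thesis unfolding c_def by simp
  qed
  define B where "B = exp (6 * (exp (- r) / (1 - exp (- r))\<^sup>2) + n * r)"
  have bound: "norm (g N y) \<le> B" for N y
  proof -
    have "Re (prod_log_sum k N (Complex r y)) \<le> 6 * (exp (- r) / (1 - exp (- r))\<^sup>2)"
      using norm_prod_log_sum_le[of r "Complex r y" k N] r complex_Re_le_cmod[of "prod_log_sum k N (Complex r y)"] by simp
    then show ?thesis unfolding g_def B_def by simp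
  qed
  have lim: "(\<lambda>N. g N y) \<longlonglongrightarrow> exp (bd_log (real (2 * k + 1)) (Complex r y) + of_nat n * Complex r y)" for y
    unfolding g_def by (intro tendsto_intros prod_log_sum_tendsto) (use r in simp)
  have gi: "g N integrable_on {- pi..pi}" for N using int by blast
  have Bi: "(\<lambda>_. B) integrable_on {- pi..pi}" by (rule integrable_const_ivl)
  note D = dominated_convergence[OF gi Bi bound lim]
  show "(\<lambda>y. exp (bd_log (real (2 * k + 1)) (Complex r y) + of_nat n * Complex r y)) integrable_on {- pi..pi}"
    by (rule D(1))
  have "eventually (\<lambda>N. integral {- pi..pi} (g N) = of_real (2 * pi * broken_diamond k n)) sequentially"
    using eventually_broken_diamond_eq[of k n]
    by eventually_elim (simp add: integral_unique[OF int])
  then have "(\<lambda>N. integral {- pi..pi} (g N)) \<longlonglongrightarrow> of_real (2 * pi * broken_diamond k n)"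
    by (rule tendsto_eventually)
  with D(2) show "of_real (2 * pi * broken_diamond k n) =
     integral {- pi..pi} (\<lambda>y. exp (bd_log (real (2 * k + 1)) (Complex r y) + of_nat n * Complex r y))"
    using LIMSEQ_unique by blast
qed

section \<open>Asymptotics of the coefficients\<close>

text \<open>\<open>bd_log m t = 2 * lam t + odd_bracket m t\<close>, and \<open>exp (odd_bracket m t)\<close> is the product of \<open>1 + q ^ i\<close> over the
  \<open>i\<close> not divisible by the odd number \<open>m\<close>. As its expansion in \<open>q\<close> has nonnegative coefficients, the bracket costs nothing
  away from the real axis.\<close>

definition odd_bracket :: "nat \<Rightarrow> complex \<Rightarrow> complex" where
  "odd_bracket m t = lam t - lam (2 * t) - lam (of_real (real m) * t) + lam (2 * of_real (real m) * t)"

section \<open>Bounds away from the real axis and for the dual factor\<close>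

lemma exp_prod_log_diff:
  assumes "Re t > 0"
  shows "exp (prod_log t i - prod_log (2 * t) i) = 1 + exp (- t) ^ Suc i"
proof -
  define w where "w = exp (- t) ^ Suc i"
  have e: "exp (- (2 * t)) = exp (- t) ^ 2" using exp_of_nat_mult[of 2 "- t"] by simp
  have w2: "exp (- (2 * t)) ^ Suc i = w ^ 2" unfolding e w_def by (simp only: mult.commute flip: power_mult)
  have "1 - w \<noteq> 0" "1 - w ^ 2 \<noteq> 0"
    using exp_prod_log(2)[of t i] exp_prod_log(2)[of "2 * t" i] assms unfolding w2 w_def[symmetric] by auto
  moreover have "exp (prod_log t i - prod_log (2 * t) i) = (1 - w ^ 2) / (1 - w)"
    unfolding exp_diff using exp_prod_log(1)[of t i] exp_prod_log(1)[of "2 * t" i] assms unfolding w2 w_def[symmetric] by simp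
  moreover have "1 - w ^ 2 = (1 + w) * (1 - w)" by (simp add: power2_eq_square algebra_simps)
  ultimately show ?thesis by (simp add: w_def)
qed

lemma norm_exp_odd_bracket_le:
  assumes t: "Re t > 0" and m: "m > 0"
  shows "norm (exp (odd_bracket m t)) \<le> norm (exp (odd_bracket m (of_real (Re t))))"
proof -
  \<comment> \<open>Cutting the first sum at m N and the second at N makes the factors with m dvd n
    cancel exactly at every finite stage.\<close>
  define S where "S = (\<lambda>N t. (\<Sum>i<m * N. prod_log t i - prod_log (2 * t) i) -
     (\<Sum>i<N. prod_log (of_real (real m) * t) i - prod_log (2 * (of_real (real m) * t)) i))"
  define Q where "Q = (\<lambda>N q. \<Prod>n\<in>{n\<in>{1..m * N}. \<not> m dvd n}. 1 + q ^ n :: complex)"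
  have Q: "exp (S N t) = Q N (exp (- t))" if t: "Re t > 0" for N t
  proof -
    define q where "q = exp (- t)"
    have pw: "exp (- (of_real (real m) * t)) = q ^ m"
      unfolding q_def using exp_of_nat_mult[of m "- t"] by simp
    have tm: "Re (of_real (real m) * t) > 0" using t m by simp
    have "exp (\<Sum>i<m * N. prod_log t i - prod_log (2 * t) i) = (\<Prod>i<m * N. 1 + q ^ Suc i)"
      unfolding exp_sum[OF finite_lessThan] exp_prod_log_diff[OF t] q_def ..
    also have "\<dots> = (\<Prod>n\<in>{1..m * N}. 1 + q ^ n)"
      by (rule prod.reindex_bij_witness[of _ "\<lambda>n. n - 1" Suc]) auto
    also have "{1..m * N} = {n\<in>{1..m * N}. \<not> m dvd n} \<union> {n\<in>{1..m * N}. m dvd n}" by auto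
    also have "(\<Prod>n\<in>\<dots>. 1 + q ^ n) = Q N q * (\<Prod>n\<in>{n\<in>{1..m * N}. m dvd n}. 1 + q ^ n)"
      unfolding Q_def by (rule prod.union_disjoint) auto
    also have "(\<Prod>n\<in>{n\<in>{1..m * N}. m dvd n}. 1 + q ^ n) = (\<Prod>i<N. 1 + q ^ (m * Suc i))"
      by (rule prod.reindex_bij_witness[of _ "\<lambda>i. m * Suc i" "\<lambda>n. n div m - 1"]) 
         (use m in \<open>auto elim!: dvdE simp: Suc_le_eq simp del: mult_Suc_right\<close>)
    also have "\<dots> = exp (\<Sum>i<N. prod_log (of_real (real m) * t) i - prod_log (2 * (of_real (real m) * t)) i)"
      unfolding exp_sum[OF finite_lessThan] exp_prod_log_diff[OF tm] pw power_mult ..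
    finally show ?thesis unfolding S_def exp_diff q_def by simp
  qed
  have lim: "(\<lambda>N. S N t) \<longlonglongrightarrow> odd_bracket m t" if t: "Re t > 0" for t
  proof -
    have tm: "Re (of_real (real m) * t) > 0" using t m by simp
    have "(\<lambda>i. prod_log t i - prod_log (2 * t) i) sums (lam t - lam (2 * t))"
      using t by (intro sums_diff prod_log_sums) simp_all
    then have "(\<lambda>N. \<Sum>i<N. prod_log t i - prod_log (2 * t) i) \<longlonglongrightarrow> lam t - lam (2 * t)" by (simp add: sums_def)
    then have "(\<lambda>N. \<Sum>i<m * N. prod_log t i - prod_log (2 * t) i) \<longlonglongrightarrow> lam t - lam (2 * t)"
      by (rule filterlim_compose) (use m in \<open>intro mult_nat_left_at_top\<close>)
    moreover have "(\<lambda>i. prod_log (of_real (real m) * t) i - prod_log (2 * (of_real (real m) * t)) i) sums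
        (lam (of_real (real m) * t) - lam (2 * (of_real (real m) * t)))"
      using tm by (intro sums_diff prod_log_sums) simp_all
    then have "(\<lambda>N. \<Sum>i<N. prod_log (of_real (real m) * t) i - prod_log (2 * (of_real (real m) * t)) i) \<longlonglongrightarrow>
        (lam (of_real (real m) * t) - lam (2 * (of_real (real m) * t)))" by (simp add: sums_def)
    ultimately have "(\<lambda>N. S N t) \<longlonglongrightarrow> (lam t - lam (2 * t)) - (lam (of_real (real m) * t) - lam (2 * (of_real (real m) * t)))"
      unfolding S_def by (rule tendsto_diff)
    then show ?thesis by (simp add: odd_bracket_def algebra_simps)
  qed
  have r: "Re (of_real (Re t)) > 0" using t by simp
  have "norm (exp (S N t)) \<le> norm (exp (S N (of_real (Re t))))" for N
  proof -
    define x where "x = exp (- Re t)"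
    have x: "x > 0" by (simp add: x_def)
    have "norm (exp (S N t)) \<le> (\<Prod>n\<in>{n\<in>{1..m * N}. \<not> m dvd n}. 1 + x ^ n)"
      unfolding Q[OF t] Q_def prod_norm[symmetric]
    proof (intro prod_mono conjI norm_ge_zero)
      fix n
      have "norm (1 + exp (- t) ^ n) \<le> 1 + norm (exp (- t)) ^ n"
        using norm_triangle_ineq[of 1 "exp (- t) ^ n"] by (simp add: norm_power)
      then show "norm (1 + exp (- t) ^ n) \<le> 1 + x ^ n" by (simp add: x_def)
    qed
    also have "\<dots> = norm (of_real (\<Prod>n\<in>{n\<in>{1..m * N}. \<not> m dvd n}. 1 + x ^ n) :: complex)"
      unfolding norm_of_real using x by (subst abs_of_nonneg) (auto intro!: prod_nonneg add_nonneg_nonneg)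
    also have "of_real (\<Prod>n\<in>{n\<in>{1..m * N}. \<not> m dvd n}. 1 + x ^ n) = exp (S N (of_real (Re t)))"
      unfolding Q[OF r] Q_def x_def by (simp add: exp_of_real flip: of_real_minus)
    finally show ?thesis .
  qed
  moreover have "(\<lambda>N. norm (exp (S N t))) \<longlonglongrightarrow> norm (exp (odd_bracket m t))"
    by (intro tendsto_norm tendsto_exp lim t)
  moreover have "(\<lambda>N. norm (exp (S N (of_real (Re t))))) \<longlonglongrightarrow> norm (exp (odd_bracket m (of_real (Re t))))"
    by (intro tendsto_norm tendsto_exp lim r)
  ultimately show ?thesis by (intro LIMSEQ_le) auto
qed

text \<open>The two copies of \<open>lam\<close> beside the bracket double the gain of
  \<open>norm_lam_le\<close>.\<close>

lemma Re_bd_log_le: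
  assumes t: "Re t > 0" and m: "m > 0"
  shows "Re (bd_log (real m) t) \<le> Re (bd_log (real m) (of_real (Re t))) - 2 * (1 / (exp (Re t) - 1) - 1 / norm (exp t - 1))"
proof -
  have e: "bd_log (real m) u = 2 * lam u + odd_bracket m u" for u
    by (simp add: bd_log_def odd_bracket_def)
  have "Re (odd_bracket m t) \<le> Re (odd_bracket m (of_real (Re t)))"
    using norm_exp_odd_bracket_le[OF assms] by simp
  moreover have "Re (lam t) \<le> Re (lam (of_real (Re t))) - (1 / (exp (Re t) - 1) - 1 / norm (exp t - 1))"
    using norm_lam_le[OF t] complex_Re_le_cmod[of "lam t"] by linarith
  ultimately show ?thesis unfolding e by simp
qed

lemma cos_le_quartic: "cos y \<le> 1 - y\<^sup>2 / 2 + y ^ 4 / 24" for y :: real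
proof -
  have *: "cos y \<le> 1 - y\<^sup>2 / 2 + y ^ 4 / 24" if y: "y > 0" for y :: real
  proof -
    obtain t where "cos y = (\<Sum>m<4. cos_coeff m * y ^ m) + cos (t + 1 / 2 * real 4 * pi) / fact 4 * y ^ 4"
      using Maclaurin_cos_expansion2[OF y, of 4] by auto
    moreover have "(\<Sum>m<4. cos_coeff m * y ^ m) = 1 - y\<^sup>2 / 2"
    proof -
      have "{..<4::nat} = {0, 1, 2, 3}" by auto
      then show ?thesis by (simp add: cos_coeff_def fact_numeral)
    qed
    moreover have "cos (t + 1 / 2 * real 4 * pi) / fact 4 * y ^ 4 \<le> 1 / fact 4 * y ^ 4"
      by (intro mult_right_mono divide_right_mono) auto
    ultimately show ?thesis by (simp add: fact_numeral)
  qed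
  show ?thesis using *[of y] *[of "- y"] by (cases y "0 :: real" rule: linorder_cases) auto
qed

text \<open>The first two terms of the Laurent expansion at 0; equivalently (1 - r / 2) (exp r - 1)
  <= r, where both sides agree at 0.\<close>

lemma inverse_exp_minus_one_ge:
  fixes r :: real
  assumes r: "0 < r" "r < 2"
  shows "1 / (exp r - 1) \<ge> 1 / r - 1 / 2"
proof -
  let ?g = "\<lambda>t. t - (1 - t / 2) * (exp t - 1)"
  have "?g 0 \<le> ?g r"
  proof (rule DERIV_nonneg_imp_nondecreasing[of 0 r ?g])
    fix x :: real assume "0 \<le> x"
    have "(?g has_real_derivative (1 - exp x * (1 - x)) / 2) (at x)"
      by (auto intro!: derivative_eq_intros simp: field_simps)
    moreover have "exp x * (1 - x) \<le> exp x * exp (- x)"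
      using exp_ge_add_one_self[of "- x"] by (intro mult_left_mono) auto
    then have "exp x * (1 - x) \<le> 1" by (simp add: exp_minus)
    ultimately show "\<exists>y. (?g has_real_derivative y) (at x) \<and> 0 \<le> y" by force
  qed (use r in simp)
  then have "(1 - r / 2) * (exp r - 1) \<le> r" by simp
  moreover have "exp r - 1 > 0" using r by simp
  ultimately have "(1 - r / 2) / r \<le> 1 / (exp r - 1)" using r by (simp add: field_simps)
  then show ?thesis using r by (simp add: diff_divide_distrib)
qed

text \<open>The square of the norm is (exp r - 1)^2 + 2 exp r (1 - cos y), least on this range where
  y^2 = 63 r^2, that is |t| = 8 r. Replacing the cosine by its quartic bound loses a factor 1 - 21
  r^2 / 4, which exp r >= 1 + r makes up for when r <= 3 / 20.\<close>

lemma norm_exp_minus_one_ge: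
  fixes r y :: real
  assumes r: "0 < r" "r \<le> 3 / 20" and y: "sqrt 63 * r \<le> \<bar>y\<bar>" "\<bar>y\<bar> \<le> pi"
  shows "norm (exp (Complex r y) - 1) \<ge> 8 * r"
proof -
  define Y where "Y = sqrt 63 * r"
  have Y: "Y > 0" "Y\<^sup>2 = 63 * r\<^sup>2" unfolding Y_def using r by (auto simp: power_mult_distrib)
  have "cos \<bar>y\<bar> \<le> cos Y" using y Y unfolding Y_def[symmetric] by (intro cos_monotone_0_pi_le) auto
  then have c: "cos y \<le> 1 - Y\<^sup>2 / 2 + Y ^ 4 / 24" using cos_le_quartic[of Y] by simp
  have Y4: "Y ^ 4 = 63\<^sup>2 * r ^ 4"
  proof -
    have "Y ^ 4 = (Y\<^sup>2)\<^sup>2" by (simp add: eval_nat_numeral)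
    then show ?thesis unfolding Y by (simp add: power_mult_distrib flip: power_mult)
  qed
  have er: "exp r \<ge> 1 + r" by (rule exp_ge_add_one_self)
  have "r * r \<le> r * (3 / 20)" using r by (intro mult_left_mono) auto
  then have "21 / 4 * r\<^sup>2 + 21 / 4 * r ^ 3 \<le> r"
  proof -
    have r2: "r\<^sup>2 \<le> 3 / 20 * r" using \<open>r * r \<le> r * (3 / 20)\<close> by (simp add: power2_eq_square)
    have "r ^ 3 = r\<^sup>2 * r" by (simp add: eval_nat_numeral)
    also have "\<dots> \<le> r\<^sup>2 * (3 / 20)" using r by (intro mult_left_mono) auto
    finally show ?thesis using r2 r by linarith
  qed
  then have "63 * r\<^sup>2 * (21 / 4 * r\<^sup>2 + 21 / 4 * r ^ 3) \<le> 63 * r\<^sup>2 * r" by (intro mult_left_mono) auto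
  then have k: "63 * r\<^sup>2 \<le> (1 + r) * (63 * r\<^sup>2 - 63\<^sup>2 * r ^ 4 / 12)"
    by (simp add: algebra_simps power2_eq_square eval_nat_numeral)
  have pos: "63 * r\<^sup>2 - 63\<^sup>2 * r ^ 4 / 12 \<ge> 0"
  proof -
    have "(1 + r) * (63 * r\<^sup>2 - 63\<^sup>2 * r ^ 4 / 12) \<ge> 0" using k by (rule order_trans[rotated]) simp
    then show ?thesis using r by (simp add: zero_le_mult_iff)
  qed
  have "(8 * r)\<^sup>2 = r\<^sup>2 + 63 * r\<^sup>2" by (simp add: power_mult_distrib)
  also have "\<dots> \<le> (exp r - 1)\<^sup>2 + exp r * (63 * r\<^sup>2 - 63\<^sup>2 * r ^ 4 / 12)"
  proof (rule add_mono)
    show "r\<^sup>2 \<le> (exp r - 1)\<^sup>2" using er r by (intro power_mono) linarith+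
    show "63 * r\<^sup>2 \<le> exp r * (63 * r\<^sup>2 - 63\<^sup>2 * r ^ 4 / 12)"
      using k mult_right_mono[OF er pos] by linarith
  qed
  also have "exp r * (63 * r\<^sup>2 - 63\<^sup>2 * r ^ 4 / 12) \<le> exp r * (2 * (1 - cos y))"
    using c unfolding Y Y4 by (intro mult_left_mono) auto
  also have "(exp r - 1)\<^sup>2 + exp r * (2 * (1 - cos y)) = (norm (exp (Complex r y) - 1))\<^sup>2"
  proof -
    have "(norm (exp (Complex r y) - 1))\<^sup>2 = (exp r * cos y - 1)\<^sup>2 + (exp r * sin y)\<^sup>2"
      by (simp add: cmod_power2 Re_exp Im_exp)
    also have "\<dots> = (exp r)\<^sup>2 * ((sin y)\<^sup>2 + (cos y)\<^sup>2) - 2 * exp r * cos y + 1"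
    proof -
      have "(e * c - 1)\<^sup>2 + (e * s)\<^sup>2 = e\<^sup>2 * (s\<^sup>2 + c\<^sup>2) - 2 * e * c + 1" for e c s :: real
        by (simp add: power2_eq_square algebra_simps)
      then show ?thesis .
    qed
    also have "\<dots> = (exp r)\<^sup>2 - 2 * exp r * cos y + 1" by (simp only: sin_cos_squared_add mult_1_right)
    finally show ?thesis by (simp add: power2_eq_square algebra_simps)
  qed
  finally have "(8 * r)\<^sup>2 \<le> (norm (exp (Complex r y) - 1))\<^sup>2" by simp
  then show ?thesis by (rule power2_le_imp_le) simp
qed

text \<open>All four arguments have real part at least v, the critical one being s / (2 m). As exp
  (- v) <= 1 / 2, each \<open>lam\<close> is at most 4 exp (- v), and the absolute coefficients add
  up to 6.\<close>

lemma norm_bd_dual_le: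
  assumes m: "m \<ge> 1" and s: "Re s \<ge> 2 * m * v" and v: "v \<ge> 3 / 4"
  shows "norm (bd_dual m s) \<le> 24 * exp (- v)"
proof -
  have "2 \<le> exp (3 / 4 :: real)" using exp_lower_Taylor_quadratic[of "3 / 4"] by (simp add: power2_eq_square)
  also have "exp (3 / 4 :: real) \<le> exp v" using v by simp
  finally have w2: "exp (- v) \<le> 1 / 2" by (simp add: exp_minus field_simps)
  have L: "norm (lam u) \<le> 4 * exp (- v)" if "Re u \<ge> v" for u
  proof -
    have u: "Re u > 0" using that v by linarith
    have e: "exp (- Re u) \<le> exp (- v)" using that by simp
    have e2: "1 / 2 \<le> 1 - exp (- Re u)" using e w2 by linarith
    have "norm (lam u) \<le> exp (- Re u) / (1 - exp (- Re u))\<^sup>2" by (rule norm_lam_le_exp[OF u])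
    also have "\<dots> \<le> exp (- v) / (1 / 2)\<^sup>2" by (intro frac_le power_mono e e2) auto
    finally show ?thesis by (simp add: power2_eq_square)
  qed
  have c: "Re (s / of_real c) \<ge> v" if "0 < c" "c \<le> 2 * m" for c
  proof -
    have "c * v \<le> 2 * m * v" using that v by (intro mult_right_mono) auto
    then show ?thesis unfolding Re_divide_of_real using that s by (simp add: field_simps)
  qed
  have "norm (lam s) \<le> 4 * exp (- v)" "norm (lam (s / 2)) \<le> 4 * exp (- v)" "norm (lam (s / of_real m)) \<le> 4 * exp (- v)"
    "norm (lam (s / (2 * of_real m))) \<le> 4 * exp (- v)"
    using L[OF c[of 1]] L[OF c[of 2]] L[OF c[of m]] L[OF c[of "2 * m"]] m by auto
  moreover have "norm (bd_dual m s) \<le> 3 * norm (lam s) + norm (lam (s / 2)) + norm (lam (s / of_real m)) + norm (lam (s / (2 * of_real m)))"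
    unfolding bd_dual_def
    by (intro norm_triangle_le norm_triangle_le_diff add_mono order_trans[OF norm_mult_ineq]) auto
  ultimately show ?thesis by linarith
qed

lemma norm_exp_minus_one_le:
  fixes w :: complex
  assumes "norm w \<le> b"
  shows "norm (exp w - 1) \<le> b * exp b"
proof -
  have "norm (exp w - 1) \<le> norm w * exp (norm w)"
  proof -
    have "(\<lambda>n. w ^ Suc n /\<^sub>R fact (Suc n)) sums (exp w - 1)"
      using exp_converges[of w] sums_Suc_iff[of "\<lambda>n. w ^ n /\<^sub>R fact n" "exp w - 1"] by simp
    moreover have "(\<lambda>n. norm w * (norm w ^ n /\<^sub>R fact n)) sums (norm w * exp (norm w))"
      by (intro sums_mult exp_converges)
    moreover have "norm (w ^ Suc n /\<^sub>R fact (Suc n)) \<le> norm w * (norm w ^ n /\<^sub>R fact n)" for n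
    proof -
      have "norm (w ^ Suc n /\<^sub>R fact (Suc n)) = norm w ^ Suc n * inverse (fact (Suc n))"
        by (simp add: norm_power norm_mult)
      also have "\<dots> \<le> norm w ^ Suc n * inverse (fact n)"
        by (intro mult_left_mono le_imp_inverse_le fact_mono) auto
      finally show ?thesis by (simp add: mult_ac)
    qed
    ultimately show ?thesis by (rule norm_sums_le[rotated 0])
  qed
  also have "\<dots> \<le> b * exp b" using assms order_trans[OF norm_ge_zero assms] by (intro mult_mono) auto
  finally show ?thesis .
qed

section \<open>The Bessel approximation with explicit error\<close>

text \<open>The coefficient of 1 / t in \<open>exp_bd_log\<close>: 7 pi^2 / 18 for m = 3 and 2 pi^2
  / 5 for m = 5.\<close>

definition bd_A :: "real \<Rightarrow> real" where "bd_A m = pi\<^sup>2 * (5 * m - 1) / (12 * m)"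

text \<open>The last bound says that the slowest dual term decays at least as fast as the main term
  grows. It amounts to 5 m - 1 <= 24 and is an equality for m = 5.\<close>

lemma bd_A_bounds:
  assumes "m \<in> {3, 5}"
  shows "bd_A m \<ge> 3838 / 1000" "bd_A m \<le> 3948 / 1000" "bd_A m \<le> 2 * pi\<^sup>2 / m"
proof -
  have "314159 / 100000 \<le> pi" "pi \<le> 31416 / 10000" using pi_approx by simp_all
  then have "(314159 / 100000)\<^sup>2 \<le> pi\<^sup>2" "pi\<^sup>2 \<le> (31416 / 10000)\<^sup>2" by (auto intro!: power_mono)
  then show "bd_A m \<ge> 3838 / 1000" "bd_A m \<le> 3948 / 1000"
    using assms by (auto simp: bd_A_def power2_eq_square)
  show "bd_A m \<le> 2 * pi\<^sup>2 / m" using assms by (auto simp: bd_A_def)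
qed

text \<open>The first error term comes from the part of the line with |y| >= sqrt 63 r. The second
  collects the dual factor on the central part, of order exp z, and the arc that closes the chord,
  of order exp (z + z / 64).\<close>

lemma broken_diamond_approx:
  fixes k n :: nat
  assumes k: "k \<in> {1, 2}"
  defines "m \<equiv> real (2 * k + 1)"
  defines "A \<equiv> bd_A m" and "X \<equiv> real n - (m + 1) / 24"
  defines "z \<equiv> sqrt (A * X)"
  assumes X: "X > 0" and z: "z \<ge> 55"
  shows "\<bar>2 * pi * broken_diamond k n - A\<^sup>2 * bes (A * X)\<bar>
    \<le> (A / z) * (101 / 100 * exp (2 * z + 1 - 7 / 4 * (z / A))) + (A / z)\<^sup>2 * (5 * 10 ^ 9 * exp z + 64 * exp (z + z / 64))"
proof -
  have m: "m \<in> {3, 5}" using k by (auto simp: m_def)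
  then have m1: "m \<ge> 1" by auto
  note Ab = bd_A_bounds[OF m, folded A_def]
  have A0: "A > 0" using Ab by linarith
  have z0: "z > 0" using z by simp
  have z2: "z\<^sup>2 = A * X" unfolding z_def using A0 X by simp
  \<comment> \<open>The saddle point of A / t + X t on the positive axis, where A / r = X r =
    z.\<close>
  define r where "r = A / z"
  have r0: "r > 0" using A0 z0 by (simp add: r_def)
  have r1: "r \<le> 3 / 20"
  proof -
    have "r \<le> 4 / 55" unfolding r_def using Ab z by (intro frac_le) auto
    then show ?thesis by simp
  qed
  have Ar: "A / r = z" unfolding r_def using A0 by simp
  have Xr: "X * r = z"
  proof -
    have "X * r = z\<^sup>2 / z" unfolding z2 r_def by simp
    then show ?thesis using z0 by (simp add: power2_eq_square)
  qed
  define B where "B = (m + 1) / 24"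
  define W where "W = (\<lambda>y. exp (bd_log m (Complex r y) + of_nat n * Complex r y))"
  define D where "D = (\<lambda>y. exp (bd_dual m (of_real (4 * pi\<^sup>2) / Complex r y)))"
  have W: "W y = main_fun A X (Complex r y) / of_real (2 * pi) * D y" for y
  proof -
    have "exp (bd_log m (Complex r y)) = Complex r y / of_real (2 * pi) * exp (of_real A / Complex r y - of_real B * Complex r y) * D y"
      using exp_bd_log[of "Complex r y" m] r0 m1 unfolding A_def bd_A_def B_def D_def by simp
    then have "W y = Complex r y / of_real (2 * pi) * (exp (of_real A / Complex r y - of_real B * Complex r y) * exp (of_nat n * Complex r y)) * D y"
      unfolding W_def exp_add by (simp only: mult_ac)
    also have "exp (of_real A / Complex r y - of_real B * Complex r y) * exp (of_nat n * Complex r y) = exp (of_real A / Complex r y + of_real X * Complex r y)"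
      unfolding X_def B_def[symmetric] by (simp add: algebra_simps flip: exp_add)
    finally show ?thesis unfolding main_fun_def by simp
  qed
  define \<kappa> where "\<kappa> = 2 * pi\<^sup>2 / m"
  have \<kappa>A: "A \<le> \<kappa>" using Ab(3) by (simp add: \<kappa>_def)
  \<comment> \<open>The real part of 1 / t on the line, see \<open>ReR\<close>.\<close>
  define R where "R = (\<lambda>y. r / (r\<^sup>2 + y\<^sup>2))"
  have ReR: "Re (of_real c / Complex r y) = c * R y" for c y
    unfolding R_def by (simp add: Re_divide power2_eq_square)
  have dual: "norm (bd_dual m (of_real (4 * pi\<^sup>2) / Complex r y)) \<le> 24 * exp (- (\<kappa> * R y))" if "\<kappa> * R y \<ge> 3 / 4" for y
    using that m1 by (intro norm_bd_dual_le) (simp_all only: ReR, simp_all add: \<kappa>_def)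
  \<comment> \<open>The ends of the central part have modulus 8 r. On it Re (1 / t) >= 1 / (64 r),
    and beyond it |exp t - 1| >= 8 r.\<close>
  define Y where "Y = sqrt 63 * r"
  have Y0: "Y > 0" using r0 by (simp add: Y_def)
  have s8: "sqrt 63 \<le> 8" by (rule real_le_lsqrt) auto
  have Y8: "Y \<le> 8 * r" unfolding Y_def using s8 r0 by (intro mult_right_mono) auto
  have Ypi: "Y \<le> pi" using Y8 r1 pi_ge_two by linarith
  have main_norm: "norm (main_fun A X (Complex r y)) = sqrt (r\<^sup>2 + y\<^sup>2) * exp (A * R y + z)" for y
  proof -
    have "Re (of_real A / Complex r y + of_real X * Complex r y) = A * R y + z"
      using ReR[of A y] Xr by simp
    then show ?thesis unfolding main_fun_def norm_mult norm_exp_eq_Re by (simp add: cmod_def)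
  qed
  have Wint: "W integrable_on {- pi..pi}"
    unfolding W_def m_def by (rule broken_diamond_integral(2)[OF r0])
  have W': "W integrable_on {a..b}" if "{a..b} \<subseteq> {- pi..pi}" for a b
    by (rule integrable_on_subinterval[OF Wint that])
  have total: "of_real (2 * pi * broken_diamond k n) = integral {- pi..pi} W"
    unfolding W_def m_def by (rule broken_diamond_integral(1)[OF r0])
  have "integral {- pi..- Y} W + integral {- Y..pi} W = integral {- pi..pi} W"
    by (rule Henstock_Kurzweil_Integration.integral_combine) (use Y0 Ypi Wint in auto)
  moreover have "integral {- Y..Y} W + integral {Y..pi} W = integral {- Y..pi} W"
    by (rule Henstock_Kurzweil_Integration.integral_combine) (use Y0 Ypi in \<open>auto intro!: W'\<close>)
  ultimately have split: "of_real (2 * pi * broken_diamond k n) = integral {- pi..- Y} W + integral {- Y..Y} W + integral {Y..pi} W"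
    using total by (simp add: add.assoc)
  \<comment> \<open>The size of the integrand at y = 0, with 101 / 100 for its dual factor, times
    the gain, whose exponent is minus 2 ((1 / r - 1 / 2) - 1 / (8 r)) = 7 z / (4 A) - 1.\<close>
  define G where "G = r / (2 * pi) * exp (2 * z) * (101 / 100) * exp (1 - 7 / 4 * (z / A))"
  have minor: "norm (W y) \<le> G" if y: "Y \<le> \<bar>y\<bar>" "\<bar>y\<bar> \<le> pi" for y
  proof -
    have "norm (exp (Complex r y) - 1) \<ge> 8 * r"
      using norm_exp_minus_one_ge[OF r0 r1] y unfolding Y_def by simp
    then have "1 / norm (exp (Complex r y) - 1) \<le> 1 / (8 * r)" using r0 by (intro frac_le) auto
    also have "1 / (8 * r) = z / A / 8" using A0 by (simp add: r_def)
    finally have g1: "1 / norm (exp (Complex r y) - 1) \<le> z / A / 8" .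
    have "1 / (exp r - 1) \<ge> 1 / r - 1 / 2" using r0 r1 by (intro inverse_exp_minus_one_ge) auto
    moreover have "1 / r = z / A" by (simp add: r_def)
    ultimately have g2: "1 / (exp r - 1) \<ge> z / A - 1 / 2" by simp
    have gain: "2 * (1 / (exp r - 1) - 1 / norm (exp (Complex r y) - 1)) \<ge> 7 / 4 * (z / A) - 1"
    proof -
      have "2 * (a - b) \<ge> 7 / 4 * q - 1" if "b \<le> q / 8" "q - 1 / 2 \<le> a" for a b q :: real
        using that by simp
      from this[OF g1 g2] show ?thesis .
    qed
    have "Re (bd_log m (Complex r y)) \<le> Re (bd_log m (of_real r)) - 2 * (1 / (exp r - 1) - 1 / norm (exp (Complex r y) - 1))"
      unfolding m_def using Re_bd_log_le[of "Complex r y" "2 * k + 1"] r0 by simp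
    with gain have "Re (bd_log m (Complex r y) + of_nat n * Complex r y) \<le> Re (bd_log m (of_real r) + of_nat n * of_real r) + (1 - 7 / 4 * (z / A))"
      by simp
    then have "norm (W y) \<le> norm (W 0) * exp (1 - 7 / 4 * (z / A))"
      unfolding W_def norm_exp_eq_Re by (simp add: complex_of_real_def flip: exp_add)
    also have "norm (W 0) \<le> r / (2 * pi) * exp (2 * z) * (101 / 100)"
    proof -
      have R0: "R 0 = 1 / r" using r0 by (simp add: R_def power2_eq_square)
      have "\<kappa> * R 0 \<ge> z" unfolding R0 Ar[symmetric] using \<kappa>A r0 by (simp add: divide_right_mono)
      then have v: "\<kappa> * R 0 \<ge> 55" using z by linarith
      have nd: "norm (bd_dual m (of_real (4 * pi\<^sup>2) / Complex r 0)) \<le> 24 * exp (- (\<kappa> * R 0))"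
        by (rule dual) (use v in linarith)
      have "Re (bd_dual m (of_real (4 * pi\<^sup>2) / Complex r 0)) \<le> 24 * exp (- (\<kappa> * R 0))"
        using complex_Re_le_cmod[of "bd_dual m (of_real (4 * pi\<^sup>2) / Complex r 0)"] nd by linarith
      also have "\<dots> \<le> 24 * exp (- 55)" using v by simp
      also have "exp (- 55 :: real) \<le> 1 / 2 ^ 55"
      proof -
        have "(2 :: real) ^ 55 \<le> exp 1 ^ 55" using exp_ge_add_one_self[of "1 :: real"] by (intro power_mono) auto
        also have "exp 1 ^ 55 = exp (55 :: real)" by (simp flip: exp_of_nat_mult)
        finally have "1 / exp (55 :: real) \<le> 1 / 2 ^ 55" by (intro frac_le) auto
        then show ?thesis by (simp add: exp_minus inverse_eq_divide)
      qed
      finally have "Re (bd_dual m (of_real (4 * pi\<^sup>2) / Complex r 0)) \<le> 1 / 200" by simp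
      then have "norm (D 0) \<le> exp (1 / 200)" unfolding D_def norm_exp_eq_Re by simp
      also have "exp (1 / 200 :: real) \<le> 101 / 100"
        using exp_bound[of "1 / 200 :: real"] by (simp add: power2_eq_square)
      finally have D0: "norm (D 0) \<le> 101 / 100" .
      have "norm (main_fun A X (Complex r 0)) = r * exp (2 * z)"
        unfolding main_norm R0 using r0 Ar by simp
      then have "norm (W 0) = r / (2 * pi) * exp (2 * z) * norm (D 0)"
        unfolding W norm_mult norm_divide by simp
      also have "\<dots> \<le> r / (2 * pi) * exp (2 * z) * (101 / 100)"
        using D0 r0 by (intro mult_left_mono) auto
      finally show ?thesis .
    qed
    finally show ?thesis unfolding G_def by simp
  qed
  have G0: "G \<ge> 0" unfolding G_def using r0 by simp
  have minor_int: "norm (integral {a..b} W) \<le> G * (pi - Y)"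
    if "{a..b} \<subseteq> {- pi..pi}" "\<And>y. y \<in> {a..b} \<Longrightarrow> Y \<le> \<bar>y\<bar>" "b - a = pi - Y" for a b
  proof -
    have "norm (integral (cbox a b) W) \<le> G * measure lborel (cbox a b)"
    proof (rule integrable_bound[OF G0])
      show "W integrable_on cbox a b" using W'[OF that(1)] by simp
      show "norm (W x) \<le> G" if "x \<in> cbox a b" for x
        using that \<open>{a..b} \<subseteq> {- pi..pi}\<close> \<open>\<And>y. y \<in> {a..b} \<Longrightarrow> Y \<le> \<bar>y\<bar>\<close>[of x] by (intro minor) (auto simp: abs_le_iff)
    qed
    then show ?thesis using that(3) Ypi by simp
  qed
  have M1: "norm (integral {- pi..- Y} W) \<le> G * (pi - Y)"
    by (rule minor_int) (use Y0 Ypi in auto)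
  have M2: "norm (integral {Y..pi} W) \<le> G * (pi - Y)"
    by (rule minor_int) (use Y0 Ypi in auto)
  have "G * (pi - Y) \<le> G * pi" using G0 Y0 by (intro mult_left_mono) auto
  with M1 M2 have minor_total: "norm (integral {- pi..- Y} W + integral {Y..pi} W) \<le> 2 * (G * pi)"
    using norm_triangle_ineq[of "integral {- pi..- Y} W" "integral {Y..pi} W"] by linarith
  define F where "F = (\<lambda>y. main_fun A X (Complex r y) / of_real (2 * pi))"
  have contF: "continuous_on {- Y..Y} F"
    unfolding F_def main_fun_def Complex_eq using r0 by (intro continuous_intros) (auto simp: complex_eq_iff)
  have Fint: "F integrable_on {- Y..Y}" by (rule integrable_continuous_real[OF contF])
  define K where "K = 8 * r * (24 * exp 12) * exp z"
  have K0: "K \<ge> 0" unfolding K_def using r0 by simp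
  have major: "norm (W y - F y) \<le> K" if y: "y \<in> {- Y..Y}" for y
  proof -
    have "y\<^sup>2 \<le> Y\<^sup>2" using y Y0 by (simp add: abs_le_square_iff[symmetric] abs_le_iff)
    then have le64: "r\<^sup>2 + y\<^sup>2 \<le> (8 * r)\<^sup>2" unfolding Y_def by (simp add: power_mult_distrib)
    have pos: "r\<^sup>2 + y\<^sup>2 > 0" using r0 by (simp add: add_pos_nonneg)
    have "1 / (64 * r) \<le> R y"
    proof -
      have "r / (8 * r)\<^sup>2 \<le> R y" unfolding R_def using le64 pos r0 by (intro divide_left_mono) auto
      then show ?thesis using r0 by (simp add: power2_eq_square)
    qed
    then have "\<kappa> * (1 / (64 * r)) \<le> \<kappa> * R y" using \<kappa>A A0 by (intro mult_left_mono) auto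
    moreover have "A * (1 / (64 * r)) \<le> \<kappa> * (1 / (64 * r))" using \<kappa>A r0 by (intro mult_right_mono) auto
    moreover have "A * (1 / (64 * r)) = z / 64" using Ar by (simp add: field_simps)
    \<comment> \<open>Here z / 64 >= 55 / 64 exceeds 3 / 4, the bound that \<open>dual\<close>
      requires.\<close>
    ultimately have v: "\<kappa> * R y \<ge> 3 / 4" using z by linarith
    have "norm (D y - 1) \<le> 24 * exp (- (\<kappa> * R y)) * exp (24 * exp (- (\<kappa> * R y)))"
      unfolding D_def by (rule norm_exp_minus_one_le[OF dual[OF v]])
    also have "\<dots> \<le> 24 * exp (- (\<kappa> * R y)) * exp 12"
    proof -
      have "2 \<le> exp (3 / 4 :: real)" using exp_lower_Taylor_quadratic[of "3 / 4"] by (simp add: power2_eq_square)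
      also have "exp (3 / 4 :: real) \<le> exp (\<kappa> * R y)" using v by simp
      finally have "exp (- (\<kappa> * R y)) \<le> 1 / 2" by (simp add: exp_minus field_simps)
      then show ?thesis by (intro mult_left_mono) auto
    qed
    finally have Dy: "norm (D y - 1) \<le> 24 * exp 12 * exp (- (\<kappa> * R y))" by (simp add: mult_ac)
    have Ry: "R y \<ge> 0" unfolding R_def using r0 by simp
    have "sqrt (r\<^sup>2 + y\<^sup>2) \<le> 8 * r" using le64 r0 by (intro real_le_lsqrt) auto
    have "W y - F y = F y * (D y - 1)"
      unfolding W F_def by (simp add: right_diff_distrib)
    then have "norm (W y - F y) = norm (F y) * norm (D y - 1)" by (simp only: norm_mult)
    also have "norm (F y) = sqrt (r\<^sup>2 + y\<^sup>2) * exp (A * R y + z) / (2 * pi)"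
      unfolding F_def norm_divide main_norm by simp
    also have "\<dots> * norm (D y - 1) \<le> 8 * r * exp (A * R y + z) / 1 * (24 * exp 12 * exp (- (\<kappa> * R y)))"
      using Dy \<open>sqrt (r\<^sup>2 + y\<^sup>2) \<le> 8 * r\<close> r0 pi_ge_two by (intro mult_mono frac_le) auto
    also have "\<dots> = 8 * r * (24 * exp 12) * (exp z * (exp (A * R y) * exp (- (\<kappa> * R y))))"
      by (simp add: exp_add mult_ac)
    \<comment> \<open>The growth exp (A R) of the main function is absorbed by the decay exp (-
      \<kappa> R) of the dual factor, by \<open>\<kappa>A\<close>.\<close>
    also have "\<dots> \<le> 8 * r * (24 * exp 12) * (exp z * 1)"
    proof -
      have "A * R y \<le> \<kappa> * R y" using \<kappa>A Ry by (intro mult_right_mono) auto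
      then have "exp (A * R y) * exp (- (\<kappa> * R y)) \<le> 1" by (simp flip: exp_add)
      then show ?thesis using r0 by (intro mult_left_mono) auto
    qed
    finally show ?thesis unfolding K_def by simp
  qed
  have WY: "W integrable_on {- Y..Y}" using Y0 Ypi by (intro W') auto
  have "norm (integral (cbox (- Y) Y) (\<lambda>y. W y - F y)) \<le> K * measure lborel (cbox (- Y) Y)"
    by (rule integrable_bound[OF K0]) (use major WY Fint in \<open>auto intro: integrable_diff\<close>)
  then have "norm (integral {- Y..Y} W - integral {- Y..Y} F) \<le> K * (2 * Y)"
    using Y0 WY Fint by (simp add: Henstock_Kurzweil_Integration.integral_diff)
  also have "\<dots> \<le> K * (16 * r)" using K0 Y8 by (intro mult_left_mono) auto
  also have "\<dots> = r\<^sup>2 * (3072 * exp 12 * exp z)" unfolding K_def by (simp add: power2_eq_square)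
  also have "\<dots> \<le> r\<^sup>2 * (5 * 10 ^ 9 * exp z)"
  proof -
    have "exp (12 :: real) = exp 1 ^ 12" by (simp flip: exp_of_nat_mult)
    also have "\<dots> \<le> (272 / 100) ^ 12" using e_less_272 by (intro power_mono) auto
    also have "(272 / 100 :: real) ^ 12 \<le> 10 ^ 6" by (simp add: power_divide)
    finally have "3072 * exp (12 :: real) \<le> 5 * 10 ^ 9" by simp
    then show ?thesis by (intro mult_left_mono mult_right_mono) auto
  qed
  finally have major_total: "norm (integral {- Y..Y} W - integral {- Y..Y} F) \<le> r\<^sup>2 * (5 * 10 ^ 9 * exp z)" .
  \<comment> \<open>The angle of the chord Re t = r in the circle of radius 8 r; half its length, 8
    r sin \<alpha>, is \<open>Y\<close>.\<close>
  define \<alpha> where "\<alpha> = arccos (1 / 8)"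
  have ca: "cos \<alpha> = 1 / 8" unfolding \<alpha>_def by simp
  have sa: "sin \<alpha> = sqrt 63 / 8" unfolding \<alpha>_def
    by (simp add: sin_arccos_nonzero sin_arccos power2_eq_square real_sqrt_divide)
  have \<alpha>: "0 < \<alpha>" "\<alpha> < pi / 2"
    unfolding \<alpha>_def using arccos_lt_bounded[of "1 / 8"] arccos_less_arccos[of 0 "1 / 8"] by auto
  have "norm (integral {- (8 * r * sin \<alpha>)..8 * r * sin \<alpha>} (\<lambda>y. main_fun A X (Complex (8 * r * cos \<alpha>) y)) - of_real (2 * pi * A\<^sup>2 * bes (A * X)))
       \<le> 2 * pi * (8 * r)\<^sup>2 * exp (A * cos \<alpha> / (8 * r) + X * (8 * r * cos \<alpha>))"
    by (rule chord_integral) (use r0 \<alpha> A0 X in auto)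
  moreover have "8 * r * sin \<alpha> = Y" "8 * r * cos \<alpha> = r" unfolding sa ca Y_def by auto
  moreover have "A * cos \<alpha> / (8 * r) + X * r = z + z / 64" using Ar Xr unfolding ca by (simp add: field_simps)
  ultimately have "norm (integral {- Y..Y} (\<lambda>y. main_fun A X (Complex r y)) - of_real (2 * pi * A\<^sup>2 * bes (A * X))) \<le> 2 * pi * (8 * r)\<^sup>2 * exp (z + z / 64)"
    by simp
  moreover have "integral {- Y..Y} (\<lambda>y. main_fun A X (Complex r y)) = of_real (2 * pi) * integral {- Y..Y} F"
    unfolding F_def by simp
  ultimately have "norm (of_real (2 * pi) * (integral {- Y..Y} F - of_real (A\<^sup>2 * bes (A * X)))) \<le> 2 * pi * ((8 * r)\<^sup>2 * exp (z + z / 64))"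
    by (simp add: algebra_simps)
  then have chord: "norm (integral {- Y..Y} F - of_real (A\<^sup>2 * bes (A * X))) \<le> r\<^sup>2 * (64 * exp (z + z / 64))"
    unfolding norm_mult by (simp add: power_mult_distrib)
  have "2 * (G * pi) = r * (101 / 100 * exp (2 * z + 1 - 7 / 4 * (z / A)))"
    unfolding G_def by (simp add: exp_add exp_diff field_simps)
  with minor_total have mt: "norm (integral {- pi..- Y} W + integral {Y..pi} W) \<le> r * (101 / 100 * exp (2 * z + 1 - 7 / 4 * (z / A)))" by simp
  have "complex_of_real (2 * pi * broken_diamond k n - A\<^sup>2 * bes (A * X)) =
     (integral {- pi..- Y} W + integral {Y..pi} W) + ((integral {- Y..Y} W - integral {- Y..Y} F) + (integral {- Y..Y} F - of_real (A\<^sup>2 * bes (A * X))))"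
    using split by simp
  then have "norm (complex_of_real (2 * pi * broken_diamond k n - A\<^sup>2 * bes (A * X))) \<le>
     r * (101 / 100 * exp (2 * z + 1 - 7 / 4 * (z / A))) + (r\<^sup>2 * (5 * 10 ^ 9 * exp z) + r\<^sup>2 * (64 * exp (z + z / 64)))"
    by (simp only:) (intro norm_triangle_mono mt major_total chord)
  then show ?thesis unfolding norm_of_real r_def by (simp add: distrib_left)
qed

section \<open>Numerical comparison of the error with the main term\<close>

lemma exp_one_ge: "271 / 100 \<le> exp (1 :: real)"
proof -
  have "inverse (2 ^ 32) \<le> (1 / 1000 :: real)" by simp
  then show ?thesis using e_approx_32 unfolding abs_le_iff by linarith
qed

text \<open>The number 277 / 5 is the lower bound for z that n >= 800 provides; the tangent of ln at
  this point bounds ln z beyond it.\<close>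

lemma ln_le_404: "ln (277 / 5) \<le> (404 / 100 :: real)"
proof -
  have "(271 / 100 :: real) ^ 4 \<le> exp 1 ^ 4" by (intro power_mono exp_one_ge) auto
  also have "exp 1 ^ 4 = exp (4 :: real)" by (simp flip: exp_of_nat_mult)
  finally have e4: "(539 / 10 :: real) \<le> exp 4" by (simp add: eval_nat_numeral)
  have "(277 / 5 :: real) \<le> (539 / 10) * (104 / 100)" by simp
  also have "\<dots> \<le> exp 4 * exp (4 / 100)"
    using e4 exp_ge_add_one_self[of "4 / 100 :: real"] by (intro mult_mono) auto
  also have "\<dots> = exp (404 / 100 :: real)" by (simp flip: exp_add)
  finally have "ln (277 / 5) \<le> ln (exp (404 / 100 :: real))" by (subst ln_le_cancel_iff) auto
  then show ?thesis by simp
qed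

lemma exp_minus_31: "exp (- 31 :: real) \<le> 1 / (2 * 10 ^ 13)"
proof -
  have "(271 / 100 :: real) ^ 31 \<le> exp 1 ^ 31" by (intro power_mono exp_one_ge) auto
  also have "exp 1 ^ 31 = exp (31 :: real)" by (simp flip: exp_of_nat_mult)
  finally have "2 * 10 ^ 13 \<le> exp (31 :: real)" by (simp add: power_divide)
  then have "1 / exp (31 :: real) \<le> 1 / (2 * 10 ^ 13)" by (intro frac_le) auto
  then show ?thesis by (simp add: exp_minus inverse_eq_divide)
qed

lemma abs_ln_le:
  fixes u \<theta> :: real
  assumes "\<bar>u - 1\<bar> \<le> \<theta>" "\<theta> \<le> 1 / 10000"
  shows "\<bar>ln u\<bar> \<le> 10002 / 10000 * \<theta>"
proof -
  have u: "u \<ge> 9999 / 10000" using assms by linarith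
  have "ln u \<le> u - 1" using u by (intro ln_le_minus_one) simp
  moreover have "\<theta> \<ge> 0" using assms by linarith
  moreover have "- ln u \<le> 10002 / 10000 * \<theta>"
  proof -
    have "- ln u = ln (1 / u)" using u by (simp add: ln_div)
    also have "\<dots> \<le> 1 / u - 1" using u by (intro ln_le_minus_one) simp
    also have "1 / u - 1 = (1 - u) * (1 / u)" using u by (simp add: field_simps)
    also have "\<dots> \<le> \<theta> * (10002 / 10000)"
    proof -
      have "1 / u \<le> 1 / (9999 / 10000)" using u by (intro frac_le) auto
      then have "1 / u \<le> 10002 / 10000" by simp
      have "(1 - u) * (1 / u) \<le> \<theta> * (1 / u)" using assms u by (intro mult_right_mono) auto
      also have "\<dots> \<le> \<theta> * (10002 / 10000)" using \<open>1 / u \<le> 10002 / 10000\<close> \<open>\<theta> \<ge> 0\<close> by (intro mult_left_mono) auto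
      finally show ?thesis .
    qed
    finally show ?thesis by simp
  qed
  ultimately show ?thesis using assms unfolding abs_le_iff by linarith
qed

text \<open>All exponentials are expressed through E, which up to a constant and powers of A is a
  lower bound for M / z^5. What remains are linear inequalities between z and L = ln z, settled by
  the tangent bound for L.\<close>

lemma error_terms_le:
  fixes A z M :: real
  assumes A: "3838 / 1000 \<le> A" "A \<le> 3948 / 1000" and z: "z \<ge> 277 / 5"
    and M: "M \<ge> A\<^sup>2 * (11 / 16 * exp (2 * z - 5 / 2 * ln z - 2 + 25 / 32 * (1 - 1 / z)))"
  shows "(A / z) * (101 / 100 * exp (2 * z + 1 - 7 / 4 * (z / A))) + (A / z)\<^sup>2 * (5 * 10 ^ 9 * exp z + 64 * exp (z + z / 64))
     \<le> 3749 / 10000 * (A ^ 3 / z ^ 5) * M"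
proof -
  have A0: "A > 0" and z0: "z > 0" using A z by linarith+
  define L where "L = ln z"
  have eL: "exp L = z" using z0 by (simp add: L_def)
  have eLm: "exp (- L) = 1 / z" "exp (- (2 * L)) = 1 / z\<^sup>2" "exp (- (5 * L)) = 1 / z ^ 5"
    using eL exp_of_nat_mult[of 2 L] exp_of_nat_mult[of 5 L] by (simp_all add: exp_minus inverse_eq_divide)
  have L: "L \<le> 304 / 100 + z * (5 / 277)"
  proof -
    have "ln (z / (277 / 5)) \<le> z / (277 / 5) - 1" using z0 by (intro ln_le_minus_one) simp
    moreover have "ln (z / (277 / 5)) = L - ln (277 / 5)" unfolding L_def using z0 by (intro ln_divide_pos) auto
    ultimately show ?thesis using ln_le_404 by (simp add: field_simps)
  qed
  \<comment> \<open>The coefficient 15 / 2 is 5 / 2 + 5, and 1235 / 1000 is 2 - 765 / 1000, where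
    765 / 1000 bounds 25 / 32 (1 - 1 / z) from below.\<close>
  define E where "E = exp (2 * z - 15 / 2 * L - 1235 / 1000)"
  have E0: "E > 0" by (simp add: E_def)
  have Q: "11 / 16 * A ^ 5 * E \<le> A ^ 3 / z ^ 5 * M"
  proof -
    have "1 / z \<le> 1 / (277 / 5)" using z by (intro frac_le) auto
    then have "25 / 32 * (1 - 1 / z) \<ge> 25 / 32 * (1 - 5 / 277)" by (intro mult_left_mono) auto
    then have w: "25 / 32 * (1 - 1 / z) \<ge> 765 / 1000" by (rule order_trans[rotated]) simp
    have "a - 1235 / 1000 \<le> a - 2 + w" if "w \<ge> 765 / 1000" for a w :: real
      using that by simp
    from this[OF w] have "2 * z - 5 / 2 * L - 1235 / 1000 \<le> 2 * z - 5 / 2 * L - 2 + 25 / 32 * (1 - 1 / z)" .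
    then have "A\<^sup>2 * (11 / 16 * exp (2 * z - 5 / 2 * L - 1235 / 1000)) \<le> M"
      using M unfolding L_def[symmetric] by (elim order_trans[rotated]) (auto intro!: mult_left_mono)
    then have "A ^ 3 / z ^ 5 * (A\<^sup>2 * (11 / 16 * exp (2 * z - 5 / 2 * L - 1235 / 1000))) \<le> A ^ 3 / z ^ 5 * M"
      using A0 z0 by (intro mult_left_mono) auto
    moreover have "E = exp (2 * z - 5 / 2 * L - 1235 / 1000) * (1 / z ^ 5)"
      unfolding E_def eLm(3)[symmetric] exp_add[symmetric] by simp
    ultimately show ?thesis by (simp add: eval_nat_numeral)
  qed
  have T1: "(A / z) * (101 / 100 * exp (2 * z + 1 - 7 / 4 * (z / A))) \<le> 3748 / 10000 * (11 / 16 * A ^ 5 * E)"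
  proof -
    have "z / A \<ge> z * (1000 / 3948)" using A A0 z0 by (simp add: field_simps)
    \<comment> \<open>At z = 277 / 5 the estimate for the left side is about 3.94: this inequality
      decides from which n on the analytic argument works.\<close>
    then have "2235 / 1000 + 13 / 2 * L - 7 / 4 * (z / A) \<le> 4" using L z by linarith
    then have "exp (2235 / 1000 + 13 / 2 * L - 7 / 4 * (z / A)) \<le> exp 4" by simp
    also have "exp (4 :: real) = exp 1 ^ 4" by (simp flip: exp_of_nat_mult)
    also have "\<dots> \<le> (272 / 100) ^ 4" using e_less_272 by (intro power_mono) auto
    finally have x: "101 / 100 * exp (2235 / 1000 + 13 / 2 * L - 7 / 4 * (z / A)) \<le> 3748 / 10000 * (11 / 16) * (3838 / 1000) ^ 4"
      by (simp add: eval_nat_numeral)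
    also have "\<dots> \<le> 3748 / 10000 * (11 / 16) * A ^ 4" using A by (intro mult_left_mono power_mono) auto
    finally have x: "101 / 100 * exp (2235 / 1000 + 13 / 2 * L - 7 / 4 * (z / A)) \<le> 3748 / 10000 * (11 / 16) * A ^ 4" .
    have e: "(1 / z) * exp (2 * z + 1 - 7 / 4 * (z / A)) = E * exp (2235 / 1000 + 13 / 2 * L - 7 / 4 * (z / A))"
      unfolding E_def eLm(1)[symmetric] exp_add[symmetric] by simp
    have "(A / z) * (101 / 100 * u) = A * (101 / 100 * ((1 / z) * u))" for u by simp
    then have "(A / z) * (101 / 100 * exp (2 * z + 1 - 7 / 4 * (z / A))) = A * (101 / 100 * (E * exp (2235 / 1000 + 13 / 2 * L - 7 / 4 * (z / A))))"
      unfolding e[symmetric] .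
    also have "\<dots> = A * E * (101 / 100 * exp (2235 / 1000 + 13 / 2 * L - 7 / 4 * (z / A)))" by (simp only: mult_ac)
    also have "\<dots> \<le> A * E * (3748 / 10000 * (11 / 16) * A ^ 4)"
      using x A0 E0 by (intro mult_left_mono) auto
    finally show ?thesis by (simp add: eval_nat_numeral mult_ac)
  qed
  have T2: "(A / z)\<^sup>2 * (5 * 10 ^ 9 * exp z + 64 * exp (z + z / 64)) \<le> 1 / 10000 * (11 / 16 * A ^ 5 * E)"
  proof -
    have "1235 / 1000 + 11 / 2 * L - z \<le> - 31" "1235 / 1000 + 11 / 2 * L - z + z / 64 \<le> - 31" using L z by linarith+
    then have e: "exp (1235 / 1000 + 11 / 2 * L - z) \<le> exp (- 31)" "exp (1235 / 1000 + 11 / 2 * L - z + z / 64) \<le> exp (- 31)" by simp_all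
    have "5 * 10 ^ 9 * a + 64 * b \<le> (5 * 10 ^ 9 + 64) * q" if "a \<le> p" "b \<le> p" "p \<le> q" for a b p q :: real
      using that by simp
    from this[OF e exp_minus_31]
    have "5 * 10 ^ 9 * exp (1235 / 1000 + 11 / 2 * L - z) + 64 * exp (1235 / 1000 + 11 / 2 * L - z + z / 64) \<le> (5 * 10 ^ 9 + 64) * (1 / (2 * 10 ^ 13))" .
    also have "\<dots> \<le> 1 / 10000 * (11 / 16) * 3 ^ 3" by simp
    also have "\<dots> \<le> 1 / 10000 * (11 / 16) * A ^ 3" using A by (intro mult_left_mono power_mono) auto
    finally have x: "5 * 10 ^ 9 * exp (1235 / 1000 + 11 / 2 * L - z) + 64 * exp (1235 / 1000 + 11 / 2 * L - z + z / 64) \<le> 1 / 10000 * (11 / 16) * A ^ 3" .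
    have e: "(1 / z\<^sup>2) * exp z = E * exp (1235 / 1000 + 11 / 2 * L - z)"
      "(1 / z\<^sup>2) * exp (z + z / 64) = E * exp (1235 / 1000 + 11 / 2 * L - z + z / 64)"
      unfolding E_def eLm(2)[symmetric] exp_add[symmetric] by (simp_all add: algebra_simps)
    have "(A / z)\<^sup>2 * (5 * 10 ^ 9 * u + 64 * v) = A\<^sup>2 * (5 * 10 ^ 9 * ((1 / z\<^sup>2) * u) + 64 * ((1 / z\<^sup>2) * v))" for u v
      by (simp add: power_divide distrib_left)
    then have "(A / z)\<^sup>2 * (5 * 10 ^ 9 * exp z + 64 * exp (z + z / 64)) =
      A\<^sup>2 * (5 * 10 ^ 9 * (E * exp (1235 / 1000 + 11 / 2 * L - z)) + 64 * (E * exp (1235 / 1000 + 11 / 2 * L - z + z / 64)))"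
      unfolding e[symmetric] .
    also have "\<dots> = A\<^sup>2 * E * (5 * 10 ^ 9 * exp (1235 / 1000 + 11 / 2 * L - z) + 64 * exp (1235 / 1000 + 11 / 2 * L - z + z / 64))"
      by (simp only: distrib_left mult_ac)
    also have "\<dots> \<le> A\<^sup>2 * E * (1 / 10000 * (11 / 16) * A ^ 3)"
      using x A0 E0 by (intro mult_left_mono) auto
    finally show ?thesis by (simp add: eval_nat_numeral mult_ac)
  qed
  note add_mono[OF T1 T2]
  also have "3748 / 10000 * (11 / 16 * A ^ 5 * E) + 1 / 10000 * (11 / 16 * A ^ 5 * E) = 3749 / 10000 * (11 / 16 * A ^ 5 * E)"
    by simp
  also have "\<dots> \<le> 3749 / 10000 * (A ^ 3 / z ^ 5 * M)" by (rule mult_left_mono[OF Q]) simp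
  finally show ?thesis by (simp only: mult.assoc)
qed

text \<open>The constant 3749 / 10000 of the relative error, times the factor 10002 / 10000 lost in
  passing to logarithms, is just below 3 / 8.\<close>

lemma broken_diamond_log_approx:
  fixes k n :: nat
  assumes k: "k \<in> {1, 2}" and n: "n \<ge> 800"
  defines "m \<equiv> real (2 * k + 1)"
  defines "A \<equiv> bd_A m" and "X \<equiv> real n - (m + 1) / 24"
  defines "z \<equiv> sqrt (A * X)"
  shows "z \<ge> 277 / 5" "broken_diamond k n > 0"
    "\<bar>ln (broken_diamond k n) - (ln (A\<^sup>2 / (2 * pi)) + ln (bes (A * X)))\<bar> \<le> 3 / 8 * A ^ 3 / z ^ 5"
proof -
  have m: "m \<in> {3, 5}" using k by (auto simp: m_def)
  note Ab = bd_A_bounds[OF m, folded A_def]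
  have A0: "A > 0" using Ab by linarith
  \<comment> \<open>The smaller value 800 - 6 / 24 belongs to m = 5.\<close>
  have X: "X \<ge> 79975 / 100" using m n unfolding X_def by auto
  have "3838 / 1000 * (79975 / 100) \<le> A * X" using Ab X by (intro mult_mono) auto
  then have "(277 / 5)\<^sup>2 \<le> A * X" by (simp add: power2_eq_square)
  then show z: "z \<ge> 277 / 5" unfolding z_def by (rule real_le_rsqrt)
  have X0: "X > 0" using X by simp
  have z2: "z\<^sup>2 = A * X" unfolding z_def using A0 X0 by simp
  define M where "M = A\<^sup>2 * bes (A * X)"
  define \<theta> where "\<theta> = 3749 / 10000 * (A ^ 3 / z ^ 5)"
  have b: "bes (A * X) > 0" using A0 X0 by (intro bes_pos) simp
  have M0: "M > 0" unfolding M_def using A0 b by simp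
  have "\<bar>2 * pi * broken_diamond k n - M\<bar> \<le> \<theta> * M"
  proof -
    have "\<bar>2 * pi * broken_diamond k n - M\<bar> \<le> (A / z) * (101 / 100 * exp (2 * z + 1 - 7 / 4 * (z / A))) + (A / z)\<^sup>2 * (5 * 10 ^ 9 * exp z + 64 * exp (z + z / 64))"
      unfolding M_def z_def A_def X_def m_def using z X0
      by (intro broken_diamond_approx k) (auto simp: z_def A_def X_def m_def)
    also have "\<dots> \<le> \<theta> * M" unfolding \<theta>_def
    proof (rule error_terms_le[OF Ab(1,2) z])
      have "bes (z\<^sup>2) \<ge> 11 / 16 * exp (2 * z - 5 / 2 * ln z - 2 + 25 / 32 * (1 - 1 / z))"
        by (rule bes_lower_bound) (use z in simp)
      then show "A\<^sup>2 * (11 / 16 * exp (2 * z - 5 / 2 * ln z - 2 + 25 / 32 * (1 - 1 / z))) \<le> M"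
        unfolding M_def z2[symmetric] by (intro mult_left_mono) auto
    qed
    finally show ?thesis .
  qed
  then have "\<bar>2 * pi * broken_diamond k n - M\<bar> / M \<le> \<theta>" using M0 by (simp add: pos_divide_le_eq)
  also have "\<bar>2 * pi * broken_diamond k n - M\<bar> / M = \<bar>2 * pi * broken_diamond k n / M - 1\<bar>"
  proof -
    have "2 * pi * broken_diamond k n / M - 1 = (2 * pi * broken_diamond k n - M) / M"
      using M0 by (simp add: diff_divide_distrib)
    then show ?thesis using M0 by (simp only: abs_divide abs_of_pos)
  qed
  finally have u: "\<bar>2 * pi * broken_diamond k n / M - 1\<bar> \<le> \<theta>" .
  have "A ^ 3 / z ^ 5 \<le> 4 ^ 3 / 55 ^ 5" using Ab A0 z by (intro frac_le power_mono) auto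
  then have \<theta>1: "\<theta> \<le> 1 / 10000" unfolding \<theta>_def by (simp add: eval_nat_numeral)
  have "2 * pi * broken_diamond k n / M > 0" using u \<theta>1 by linarith
  then show pos: "broken_diamond k n > 0" using M0 by (simp add: zero_less_divide_iff zero_less_mult_iff)
  have "ln (2 * pi * broken_diamond k n / M) = ln (broken_diamond k n) - (ln (A\<^sup>2 / (2 * pi)) + ln (bes (A * X)))"
    using pos M0 A0 b unfolding M_def by (simp add: ln_div ln_mult)
  then have "\<bar>ln (broken_diamond k n) - (ln (A\<^sup>2 / (2 * pi)) + ln (bes (A * X)))\<bar> \<le> 10002 / 10000 * \<theta>"
    using abs_ln_le[OF u \<theta>1] by simp
  also have "\<dots> \<le> 3 / 8 * (A ^ 3 / z ^ 5)"
  proof -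
    have "A ^ 3 / z ^ 5 \<ge> 0" using A0 z by simp
    then show ?thesis unfolding \<theta>_def by simp
  qed
  finally show "\<bar>ln (broken_diamond k n) - (ln (A\<^sup>2 / (2 * pi)) + ln (bes (A * X)))\<bar> \<le> 3 / 8 * A ^ 3 / z ^ 5" by simp
qed

lemma higher_turan_large:
  fixes k n :: nat
  assumes k: "k \<in> {1, 2}" and n: "n \<ge> 801"
  shows "4 * ((broken_diamond k n)\<^sup>2 - broken_diamond k (n - 1) * broken_diamond k (n + 1))
           * ((broken_diamond k (n + 1))\<^sup>2 - broken_diamond k n * broken_diamond k (n + 2))
         - (broken_diamond k n * broken_diamond k (n + 1)
            - broken_diamond k (n - 1) * broken_diamond k (n + 2))\<^sup>2 > 0"
proof -
  define m where "m = real (2 * k + 1)"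
  define A where "A = bd_A m"
  define Y where "Y = real (n - 1) - (m + 1) / 24"
  define z where "z = sqrt (A * Y)"
  define y where "y = (\<lambda>j. broken_diamond k (n - 1 + j))"
  have m: "m \<in> {3, 5}" using k by (auto simp: m_def)
  note Ab = bd_A_bounds[OF m, folded A_def]
  have A0: "A > 0" using Ab by linarith
  have Y0: "Y > 0" unfolding Y_def using m n by auto
  have z: "z \<ge> 277 / 5" using broken_diamond_log_approx(1)[OF k, of "n - 1"] n unfolding z_def A_def Y_def m_def by simp
  have YX: "real (n - 1 + j) - (m + 1) / 24 = Y + real j" for j unfolding Y_def by simp
  have "4 * ((y 1)\<^sup>2 - y 0 * y 2) * ((y 2)\<^sup>2 - y 1 * y 3) - (y 1 * y 2 - y 0 * y 3)\<^sup>2 > 0"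
  proof (rule higher_turan_bes_perturbed[OF A0 _ Y0, folded z_def, OF _ _ order_refl])
    show "A \<le> 4" using Ab by linarith
    show "z \<ge> 50" using z by linarith
    fix j :: nat assume "j \<le> 3"
    have nj: "n - 1 + j \<ge> 800" using n by simp
    show "y j > 0" unfolding y_def by (rule broken_diamond_log_approx(2)[OF k nj])
    have "\<bar>ln (y j) - (ln (A\<^sup>2 / (2 * pi)) + ln (bes (A * (Y + real j))))\<bar> \<le> 3 / 8 * A ^ 3 / sqrt (A * (Y + real j)) ^ 5"
      using broken_diamond_log_approx(3)[OF k nj] unfolding y_def m_def[symmetric] YX A_def[symmetric] .
    also have "\<dots> \<le> 3 / 8 * A ^ 3 / z ^ 5"
      using A0 Y0 z unfolding z_def by (intro divide_left_mono power_mono mult_pos_pos) (auto intro!: mult_left_mono)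
    finally show "\<bar>ln (y j) - (ln (A\<^sup>2 / (2 * pi)) + ln (bes (A * (Y + real j))))\<bar> \<le> 3 / 8 * A ^ 3 / z ^ 5" .
  qed
  moreover have "y 0 = broken_diamond k (n - 1)" "y 1 = broken_diamond k n" "y 2 = broken_diamond k (n + 1)" "y 3 = broken_diamond k (n + 2)"
    using n by (simp_all add: y_def eval_nat_numeral)
  ultimately show ?thesis by simp
qed

section \<open>The finite check\<close>

text \<open>Euler's product has only the coefficients - 1, 0 and 1, so multiplying or dividing by it
  takes nothing but additions and subtractions.\<close>

datatype digit = DZ | DP | DM

fun digit_val :: "digit \<Rightarrow> int" where
  "digit_val DZ = 0"
| "digit_val DP = 1"
| "digit_val DM = - 1"

fun digit_neg :: "digit \<Rightarrow> digit" where
  "digit_neg DZ = DZ"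
| "digit_neg DP = DM"
| "digit_neg DM = DP"

text \<open>Positive and negative contributions are accumulated separately, so that a single subtraction is
  carried out at the end.\<close>

fun dot :: "digit list \<Rightarrow> int list \<Rightarrow> int \<Rightarrow> int \<Rightarrow> int" where
  "dot cs [] p m = p - m"
| "dot [] (x # xs) p m = p - m"
| "dot (DZ # cs) (x # xs) p m = dot cs xs p m"
| "dot (DP # cs) (x # xs) p m = dot cs xs (p + x) m"
| "dot (DM # cs) (x # xs) p m = dot cs xs p (m + x)"

text \<open>The quotient found so far is kept in reverse, so that \<open>dot\<close> pairs the digit
  of exponent i + 1 with the coefficient i + 1 places back.\<close>

fun series_div :: "digit list \<Rightarrow> int list \<Rightarrow> int list \<Rightarrow> int list" where
  "series_div cs [] h = h"
| "series_div cs (a # as) h = series_div cs as (dot cs h a 0 # h)"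

fun series_mul :: "digit list \<Rightarrow> int list \<Rightarrow> int list \<Rightarrow> int list \<Rightarrow> int list" where
  "series_mul cs [] h out = out"
| "series_mul cs (a # as) h out = series_mul cs as (a # h) (dot cs h a 0 # out)"

fun rev_onto :: "int list \<Rightarrow> int list \<Rightarrow> int list" where
  "rev_onto [] ys = ys"
| "rev_onto (x # xs) ys = rev_onto xs (x # ys)"

text \<open>The parameters a and b are the gaps between consecutive generalized pentagonal numbers
  1, 2, 5, 7, 12, 15, ...; from pair to pair they grow by 2 and 1. The list starts at exponent 1,
  and signs are reversed: \<open>DP\<close> stands for the coefficient - 1.\<close>

fun pent_digits :: "nat \<Rightarrow> nat \<Rightarrow> nat \<Rightarrow> digit \<Rightarrow> digit list" where
  "pent_digits 0 a b s = []"
| "pent_digits (Suc n) a b s =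
     replicate a DZ @ s # (replicate b DZ @ s # pent_digits n (Suc (Suc a)) (Suc b) (digit_neg s))"

fun stretch_digits :: "nat \<Rightarrow> digit list \<Rightarrow> digit list" where
  "stretch_digits d [] = []"
| "stretch_digits d (c # cs) = replicate d DZ @ c # stretch_digits d cs"

fun halve_list :: "int list \<Rightarrow> int list" where
  "halve_list [] = []"
| "halve_list (x # xs) = x div 2 # halve_list xs"

text \<open>Nested halvings rather than one division by 2^24: on a binary numeral each of them is a
  single rewrite step.\<close>

definition div24 :: "int \<Rightarrow> int" where
  "div24 x = x div 2 div 2 div 2 div 2 div 2 div 2 div 2 div 2 div 2 div 2 div 2 div 2
               div 2 div 2 div 2 div 2 div 2 div 2 div 2 div 2 div 2 div 2 div 2 div 2"

text \<open>Here p and r are lower bounds and h is an upper bound, so after the shift h is rounded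
  up and the others down. The sign of l makes it legitimate to square the upper bound.\<close>

definition turan_test2 :: "int \<Rightarrow> int \<Rightarrow> int \<Rightarrow> int \<Rightarrow> bool" where
  "turan_test2 p r h l \<longleftrightarrow> 0 \<le> l \<and> 0 \<le> p \<and> 0 \<le> r \<and> (div24 h + 1) * (div24 h + 1) < 4 * (div24 p * div24 r)"

text \<open>Interval arithmetic for true values in [a, a + 1) and so on, with products like (a + 1)
  (c + 1) expanded. The mixed products are arguments so that each is computed once.\<close>

definition turan_test1 :: "int \<Rightarrow> int \<Rightarrow> int \<Rightarrow> int \<Rightarrow> int \<Rightarrow> int \<Rightarrow> int \<Rightarrow> int \<Rightarrow> bool" where
  "turan_test1 a b c d bc ad ac bd \<longleftrightarrow> 0 \<le> a \<and> 0 \<le> b \<and> 0 \<le> c \<and> 0 \<le> d \<and>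
     turan_test2 (b * b - (ac + (a + (c + 1)))) (c * c - (bd + (b + (d + 1))))
       (bc + (b + (c + 1)) - ad) (bc - (ad + (a + (d + 1))))"

definition turan_test :: "int \<Rightarrow> int \<Rightarrow> int \<Rightarrow> int \<Rightarrow> bool" where
  "turan_test a b c d = turan_test1 a b c d (b * c) (a * d) (a * c) (b * d)"

fun guard_test :: "bool \<Rightarrow> bool \<Rightarrow> bool" where
  "guard_test True b = b"
| "guard_test False b = False"

text \<open>Each entry of the first list counts the windows of four coefficients to be tested before
  all remaining coefficients are halved.\<close>

fun run_tests :: "nat list \<Rightarrow> int list \<Rightarrow> bool" where
  "run_tests [] xs = True"
| "run_tests (0 # cs) xs = run_tests cs (halve_list xs)"
| "run_tests (Suc n # cs) (a # b # c # d # xs) = guard_test (turan_test a b c d) (run_tests (n # cs) (b # c # d # xs))"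
| "run_tests (Suc n # cs) [] = False"
| "run_tests (Suc n # cs) [a] = False"
| "run_tests (Suc n # cs) [a, b] = False"
| "run_tests (Suc n # cs) [a, b, c] = False"

definition exact_test :: "int \<Rightarrow> int \<Rightarrow> int \<Rightarrow> int \<Rightarrow> bool" where
  "exact_test a b c d \<longleftrightarrow> (b * c - a * d) * (b * c - a * d) < 4 * ((b * b - a * c) * (c * c - b * d))"

fun run_exact :: "nat \<Rightarrow> nat list \<Rightarrow> int list \<Rightarrow> bool" where
  "run_exact 0 cs xs = run_tests cs xs"
| "run_exact (Suc n) cs (a # b # c # d # xs) = guard_test (exact_test a b c d) (run_exact n cs (b # c # d # xs))"
| "run_exact (Suc n) cs [] = False"
| "run_exact (Suc n) cs [a] = False"
| "run_exact (Suc n) cs [a, b] = False"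
| "run_exact (Suc n) cs [a, b, c] = False"

text \<open>The gap lists below make the evaluation by rewriting fast: a rewrite step on the list of coefficients
  costs time proportional to the size of that list, and \<open>dot_expand_eqs\<close> skip a whole gap in one step.\<close>

fun expand :: "(nat \<times> digit) list \<Rightarrow> digit list" where
  "expand [] = []"
| "expand ((n, s) # gs) = replicate n DZ @ s # expand gs"

fun acc :: "digit \<Rightarrow> int \<Rightarrow> int \<Rightarrow> int" where
  "acc DP p x = p + x"
| "acc DZ p x = p"
| "acc DM p x = p"

lemma dot_replicate: "dot (replicate (length ys) DZ @ cs) (ys @ xs) p m = dot cs xs p m"
  by (induction ys) simp_all

lemma dot_Nil: "dot cs [] p m = p - m"
  by (cases cs) simp_all

lemma dot_replicate_short: "dot (replicate (length ys + n) DZ @ cs) ys p m = p - m"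
  by (induction ys) (simp_all add: dot_Nil)

lemma dot_Cons: "dot (s # cs) (x # xs) p m = dot cs xs (acc s p x) (acc (digit_neg s) m x)"
  by (cases s) simp_all

lemma dot_expand_append:
  "dot (expand ((length ys, s) # gs)) (ys @ x # xs) p m = dot (expand gs) xs (acc s p x) (acc (digit_neg s) m x)"
  by (simp add: dot_replicate dot_Cons)

lemma dot_expand_skip:
  "dot (expand ((length ys + n, s) # gs)) (ys @ xs) p m = dot (expand ((n, s) # gs)) xs p m"
  using dot_replicate[of ys "replicate n DZ @ s # expand gs"] by (simp add: replicate_add)

lemma dot_expand_short: "dot (expand ((length ys + n, s) # gs)) ys p m = p - m"
  by (simp add: dot_replicate_short)

text \<open>Instances for gaps up to 15, for lists ending within a gap, and for skipping 16 entries
  of a longer gap.\<close>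

lemmas dot_expand_simps =
  dot_expand_append[of "[]"] dot_expand_append[of "[a]"]
  dot_expand_append[of "[a, b]"] dot_expand_append[of "[a, b, c]"]
  dot_expand_append[of "[a, b, c, d]"] dot_expand_append[of "[a, b, c, d, e]"]
  dot_expand_append[of "[a, b, c, d, e, f]"] dot_expand_append[of "[a, b, c, d, e, f, g]"]
  dot_expand_append[of "[a, b, c, d, e, f, g, h]"] dot_expand_append[of "[a, b, c, d, e, f, g, h, i]"]
  dot_expand_append[of "[a, b, c, d, e, f, g, h, i, j]"] dot_expand_append[of "[a, b, c, d, e, f, g, h, i, j, k]"]
  dot_expand_append[of "[a, b, c, d, e, f, g, h, i, j, k, l]"] dot_expand_append[of "[a, b, c, d, e, f, g, h, i, j, k, l, u]"]
  dot_expand_append[of "[a, b, c, d, e, f, g, h, i, j, k, l, u, v]"] dot_expand_append[of "[a, b, c, d, e, f, g, h, i, j, k, l, u, v, w]"]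
  dot_expand_skip[of "[a, b, c, d, e, f, g, h, i, j, k, l, u, v, w, y]"]
  dot_expand_short[of "[]"]
  dot_expand_short[of "[a]"] dot_expand_short[of "[a, b]"]
  dot_expand_short[of "[a, b, c]"] dot_expand_short[of "[a, b, c, d]"]
  dot_expand_short[of "[a, b, c, d, e]"] dot_expand_short[of "[a, b, c, d, e, f]"]
  dot_expand_short[of "[a, b, c, d, e, f, g]"] dot_expand_short[of "[a, b, c, d, e, f, g, h]"]
  dot_expand_short[of "[a, b, c, d, e, f, g, h, i]"] dot_expand_short[of "[a, b, c, d, e, f, g, h, i, j]"]
  dot_expand_short[of "[a, b, c, d, e, f, g, h, i, j, k]"] dot_expand_short[of "[a, b, c, d, e, f, g, h, i, j, k, l]"]
  dot_expand_short[of "[a, b, c, d, e, f, g, h, i, j, k, l, u]"] dot_expand_short[of "[a, b, c, d, e, f, g, h, i, j, k, l, u, v]"]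
  dot_expand_short[of "[a, b, c, d, e, f, g, h, i, j, k, l, u, v, w]"]
  for a b c d e f g h i j k l u v w y

lemmas dot_expand_eqs = dot_expand_simps[unfolded list.size add_0_right add_Suc_right add_Suc add_0 append.simps]
text \<open>Pentagonal gaps after substituting q^(d + 1) for q, which turns a gap g into (d + 1) g +
  d.\<close>

fun pent_gaps :: "nat \<Rightarrow> nat \<Rightarrow> nat \<Rightarrow> nat \<Rightarrow> digit \<Rightarrow> (nat \<times> digit) list" where
  "pent_gaps d 0 a b s = []"
| "pent_gaps d (Suc n) a b s = (a, s) # (b, s) # pent_gaps d n (Suc (Suc (d + (d + a)))) (Suc (d + b)) (digit_neg s)"

fun neg_gaps :: "(nat \<times> digit) list \<Rightarrow> (nat \<times> digit) list" where
  "neg_gaps [] = []"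
| "neg_gaps ((n, s) # gs) = (n, digit_neg s) # neg_gaps gs"

lemma map_digit_neg_expand: "map digit_neg (expand gs) = expand (neg_gaps gs)"
  by (induction gs rule: expand.induct) simp_all

lemma stretch_digits_append: "stretch_digits d (xs @ ys) = stretch_digits d xs @ stretch_digits d ys"
  by (induction xs) simp_all

lemma stretch_digits_replicate: "stretch_digits d (replicate a DZ) = replicate (Suc d * a) DZ"
  by (induction a) (simp_all add: replicate_add replicate_app_Cons_same)

lemma stretch_pent_digits:
  "stretch_digits d (pent_digits n a b s) = expand (pent_gaps d n (Suc d * a + d) (Suc d * b + d) s)"
proof (induction n arbitrary: a b s)
  case (Suc n)
  have "Suc (Suc (d + (d + (Suc d * a + d)))) = Suc d * Suc (Suc a) + d" "Suc (d + (Suc d * b + d)) = Suc d * Suc b + d"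
    by simp_all
  then show ?case unfolding pent_gaps.simps expand.simps
    by (simp only: pent_digits.simps stretch_digits_append stretch_digits.simps stretch_digits_replicate Suc.IH
        replicate_add append_assoc append_Cons)
qed simp

lemma stretch_pent_digits_start: "stretch_digits d (pent_digits n 0 0 s) = expand (pent_gaps d n d d s)"
  using stretch_pent_digits[of d n 0 0 s] by simp

text \<open>Natural numbers are unfolded to \<open>Suc\<close> for pattern matching, while the
  integer coefficients stay binary numerals.\<close>

lemmas eval_simps = dot_expand_eqs acc.simps pent_gaps.simps neg_gaps.simps map_digit_neg_expand stretch_pent_digits_start
  series_div.simps series_mul.simps rev_onto.simps digit_neg.simps halve_list.simps div24_def
  turan_test2_def turan_test1_def turan_test_def guard_test.simps run_tests.simps(1-3)
  exact_test_def run_exact.simps(1,2) replicate.simps append.simps drop_Suc_Cons drop_0 add_Suc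
  numeral_eq_Suc pred_numeral_simps Num.BitM.simps One_nat_def numeral_One diff_self simp_thms
  arith_simps arith_special rel_simps numeral_Bit0_div_2 numeral_Bit1_div_2

section \<open>Correctness of the power series arithmetic\<close>

lemma dot_eq:
  "length xs \<le> length cs \<Longrightarrow> dot cs xs p m = p - m + (\<Sum>i<length xs. digit_val (cs ! i) * xs ! i)"
  by (induction cs xs p m rule: dot.induct) (simp_all add: sum.lessThan_Suc_shift del: sum.lessThan_Suc)

definition prefix_of :: "int list \<Rightarrow> real fps \<Rightarrow> bool" where
  "prefix_of xs F \<longleftrightarrow> (\<forall>i<length xs. fps_nth F i = of_int (xs ! i))"

text \<open>The digits are the negated coefficients, so that division by the series adds the value
  of \<open>dot\<close>.\<close>

definition digits_of :: "digit list \<Rightarrow> real fps \<Rightarrow> bool" where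
  "digits_of cs D \<longleftrightarrow> fps_nth D 0 = 1 \<and> (\<forall>i<length cs. fps_nth D (Suc i) = - of_int (digit_val (cs ! i)))"

lemma digits_mult_nth:
  assumes "digits_of cs D" "n \<le> length cs"
  shows "fps_nth (B * D) n = fps_nth B n - (\<Sum>i<n. of_int (digit_val (cs ! i)) * fps_nth B (n - 1 - i))"
proof -
  have "fps_nth (B * D) n = fps_nth (D * B) n" by (simp add: mult.commute)
  also have "\<dots> = (\<Sum>i=0..n. fps_nth D i * fps_nth B (n - i))" by (rule fps_mult_nth)
  also have "\<dots> = (\<Sum>i<Suc n. fps_nth D i * fps_nth B (n - i))" by (simp add: atLeast0AtMost lessThan_Suc_atMost)
  also have "\<dots> = fps_nth B n + (\<Sum>i<n. fps_nth D (Suc i) * fps_nth B (n - Suc i))"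
    using assms by (simp add: sum.lessThan_Suc_shift digits_of_def del: sum.lessThan_Suc)
  also have "(\<Sum>i<n. fps_nth D (Suc i) * fps_nth B (n - Suc i)) = (\<Sum>i<n. - (of_int (digit_val (cs ! i)) * fps_nth B (n - 1 - i)))"
    using assms by (intro sum.cong) (auto simp: digits_of_def)
  finally show ?thesis by (simp add: sum_negf)
qed

lemma dot_prefix:
  assumes h: "prefix_of (rev h) B" and len: "length h \<le> length cs"
  shows "of_int (dot cs h a 0) = of_int a + (\<Sum>i<length h. of_int (digit_val (cs ! i)) * fps_nth B (length h - 1 - i))"
proof -
  have "fps_nth B (length h - 1 - i) = of_int (h ! i)" if "i < length h" for i
    using h that unfolding prefix_of_def by (auto simp: rev_nth)
  then show ?thesis by (simp add: dot_eq[OF len])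
qed

lemma prefix_of_snoc:
  "prefix_of (xs @ [x]) F \<longleftrightarrow> prefix_of xs F \<and> fps_nth F (length xs) = of_int x"
  unfolding prefix_of_def by (auto simp: nth_append less_Suc_eq)

lemma series_div_correct:
  assumes "digits_of cs D" "B * D = A" "prefix_of (rev h) B"
    "\<And>j. j < length as \<Longrightarrow> fps_nth A (length h + j) = of_int (as ! j)" "length h + length as \<le> Suc (length cs)"
  shows "prefix_of (rev (series_div cs as h)) B \<and> length (series_div cs as h) = length h + length as"
  using assms
proof (induction as arbitrary: h)
  case (Cons a as)
  have len: "length h \<le> length cs" using Cons.prems by simp
  have "fps_nth A (length h) = of_int a" using Cons.prems(4)[of 0] by simp
  then have "fps_nth B (length h) = of_int (dot cs h a 0)"
    using digits_mult_nth[OF Cons.prems(1) len, of B] dot_prefix[OF Cons.prems(3) len, of a] Cons.prems(2) by simp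
  then have "prefix_of (rev (dot cs h a 0 # h)) B" using Cons.prems(3) by (simp add: prefix_of_snoc)
  then have "prefix_of (rev (series_div cs as (dot cs h a 0 # h))) B \<and>
      length (series_div cs as (dot cs h a 0 # h)) = length (dot cs h a 0 # h) + length as"
    using Cons.prems(4)[of "Suc _"] Cons.prems(5) by (intro Cons.IH Cons.prems(1,2)) auto
  then show ?case by simp
qed simp

lemma series_mul_correct:
  assumes "digits_of (map digit_neg cs) D" "prefix_of (rev h @ as) A" "prefix_of (rev out) (A * D)"
    "length out = length h" "length h + length as \<le> Suc (length cs)"
  shows "prefix_of (rev (series_mul cs as h out)) (A * D) \<and> length (series_mul cs as h out) = length h + length as"
  using assms
proof (induction as arbitrary: h out)
  case (Cons a as)
  have neg: "digit_val (digit_neg c) = - digit_val c" for c by (cases c) auto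
  have len: "length h \<le> length cs" "length h \<le> length (map digit_neg cs)" using Cons.prems by simp_all
  have h: "prefix_of (rev h) A"
    using Cons.prems(2) unfolding prefix_of_def by (auto simp: nth_append split: if_splits)
  have "fps_nth A (length h) = of_int a"
    using Cons.prems(2) unfolding prefix_of_def by (auto simp: nth_append dest!: spec[of _ "length h"])
  moreover have "(\<Sum>i<length h. of_int (digit_val (map digit_neg cs ! i)) * fps_nth A (length h - 1 - i)) =
      - (\<Sum>i<length h. of_int (digit_val (cs ! i)) * fps_nth A (length h - 1 - i))"
    using len(1) by (simp add: neg sum_negf)
  ultimately have "fps_nth (A * D) (length out) = of_int (dot cs h a 0)"
    using digits_mult_nth[OF Cons.prems(1) len(2), of A] dot_prefix[OF h len(1), of a] Cons.prems(4) by simp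
  then have "prefix_of (rev (dot cs h a 0 # out)) (A * D)" using Cons.prems(3) by (simp add: prefix_of_snoc)
  then have "prefix_of (rev (series_mul cs as (a # h) (dot cs h a 0 # out))) (A * D) \<and>
      length (series_mul cs as (a # h) (dot cs h a 0 # out)) = length (a # h) + length as"
    using Cons.prems by (intro Cons.IH) auto
  then show ?case by simp
qed simp

lemma rev_onto_eq: "rev_onto xs ys = rev xs @ ys"
  by (induction xs ys rule: rev_onto.induct) auto

section \<open>The pentagonal number theorem for finite products\<close>

fun tri :: "nat \<Rightarrow> nat" where
  "tri 0 = 0"
| "tri (Suc n) = tri n + Suc n"

text \<open>Shanks' finite form of the pentagonal number theorem.\<close>

lemma shanks_identity:
  fixes q :: "'a :: comm_ring_1"
  defines "R \<equiv> \<lambda>n s. \<Prod>i\<in>{s<..n}. 1 - q ^ i"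
  shows "(\<Sum>s\<le>n. (- 1) ^ s * R n s * q ^ (s * n + tri s)) =
     1 + (\<Sum>j=1..n. (- 1) ^ j * (q ^ (j * j + tri (j - 1)) + q ^ (j * j + tri j)))"
proof (induction n)
  case 0
  then show ?case by (simp add: R_def)
next
  case (Suc n)
  \<comment> \<open>The changes caused by passing from n to n + 1 telescope over s <= k to
    \<open>- T k\<close>. At k = n this and the new summand s = n + 1 are the two new monomials on
    the right.\<close>
  define T where "T = (\<lambda>s. (- 1) ^ s * R n s * q ^ (Suc s * Suc n + tri s))"
  have RS: "R (Suc n) s = R n s * (1 - q ^ Suc n)" if "s \<le> n" for s
  proof -
    have "{s<..Suc n} = insert (Suc n) {s<..n}" using that by auto
    then show ?thesis unfolding R_def by (simp add: mult.commute)
  qed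
  have Rr: "R n r = (1 - q ^ Suc r) * R n (Suc r)" if "Suc r \<le> n" for r
  proof -
    have "{r<..n} = insert (Suc r) {Suc r<..n}" using that by auto
    then show ?thesis unfolding R_def by simp
  qed
  have tele: "(\<Sum>s\<le>k. (- 1) ^ s * R n s * ((1 - q ^ Suc n) * q ^ (s * Suc n + tri s) - q ^ (s * n + tri s))) = - T k"
    if "k \<le> n" for k
    using that
  proof (induction k)
    case 0
    then show ?case by (simp add: T_def)
  next
    case (Suc r)
    define e where "e = Suc r * n + tri (Suc r)"
    have e1: "q ^ (Suc r * Suc n + tri (Suc r)) = q ^ e * q ^ Suc r"
      unfolding e_def power_add[symmetric] by (rule arg_cong[where f = "power q"]) simp
    have e2: "q ^ (Suc r * Suc n + tri r) = q ^ e"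
      unfolding e_def by (rule arg_cong[where f = "power q"]) simp
    have e3: "q ^ (Suc (Suc r) * Suc n + tri (Suc r)) = q ^ e * q ^ Suc r * q ^ Suc n"
      unfolding e_def power_add[symmetric] by (rule arg_cong[where f = "power q"]) simp
    show ?case
      using Suc Rr[of r] unfolding sum.atMost_Suc T_def e1 e2 e3 e_def[symmetric]
      by (simp add: algebra_simps)
  qed
  have "(\<Sum>s\<le>Suc n. (- 1) ^ s * R (Suc n) s * q ^ (s * Suc n + tri s)) =
     (\<Sum>s\<le>n. (- 1) ^ s * R (Suc n) s * q ^ (s * Suc n + tri s)) + (- 1) ^ Suc n * q ^ (Suc n * Suc n + tri (Suc n))"
    by (simp add: R_def)
  also have "(\<Sum>s\<le>n. (- 1) ^ s * R (Suc n) s * q ^ (s * Suc n + tri s)) =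
     (\<Sum>s\<le>n. (- 1) ^ s * R n s * q ^ (s * n + tri s)) +
     (\<Sum>s\<le>n. (- 1) ^ s * R n s * ((1 - q ^ Suc n) * q ^ (s * Suc n + tri s) - q ^ (s * n + tri s)))"
    unfolding sum.distrib[symmetric] by (intro sum.cong) (auto simp: RS algebra_simps)
  also have "(\<Sum>s\<le>n. (- 1) ^ s * R n s * ((1 - q ^ Suc n) * q ^ (s * Suc n + tri s) - q ^ (s * n + tri s))) = - T n"
    by (rule tele) simp
  also have "- T n = (- 1) ^ Suc n * q ^ (Suc n * Suc n + tri n)" by (simp add: T_def R_def)
  finally show ?case unfolding Suc.IH by (simp add: algebra_simps)
qed

text \<open>Horner form, with the digit at position i belonging to exponent i + 1.\<close>

fun digit_poly :: "'a :: comm_ring_1 \<Rightarrow> digit list \<Rightarrow> 'a" where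
  "digit_poly q [] = 0"
| "digit_poly q (c # cs) = q * (of_int (digit_val c) + digit_poly q cs)"

lemma digit_poly_zeros: "digit_poly q (replicate a DZ @ cs) = q ^ a * digit_poly q cs"
  by (induction a) (simp_all add: mult_ac)

lemma digit_poly_stretch: "digit_poly q (stretch_digits d cs) = digit_poly (q ^ Suc d) cs"
  by (induction cs) (simp_all add: digit_poly_zeros mult_ac)

lemma length_stretch_digits: "length (stretch_digits d cs) = Suc d * length cs"
  by (induction cs) simp_all

lemma length_pent_digits: "length (pent_digits n (2 * i) i s) + (i * i + tri i) = (i + n) * (i + n) + tri (i + n)"
proof (induction n arbitrary: i s)
  case (Suc n)
  have "Suc (Suc (2 * i)) = 2 * Suc i" by simp
  then show ?case using Suc.IH[of "Suc i" "digit_neg s"] by simp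
qed simp

text \<open>Generalized to lists that continue after i pairs of pentagonal numbers; the power in
  front carries the exponent of the last of them.\<close>

lemma digit_poly_pent_digits:
  fixes q :: "'a :: comm_ring_1"
  assumes "of_int (digit_val s) = ((- 1) ^ i :: 'a)"
  shows "q ^ (i * i + tri i) * digit_poly q (pent_digits n (2 * i) i s) =
     - (\<Sum>j=Suc i..i + n. (- 1) ^ j * (q ^ (j * j + tri (j - 1)) + q ^ (j * j + tri j)))"
  using assms
proof (induction n arbitrary: i s)
  case (Suc n)
  have neg: "digit_val (digit_neg c) = - digit_val c" for c by (cases c) auto
  have S2: "(\<Sum>j=Suc i..i + Suc n. f j) = f (Suc i) + (\<Sum>j=Suc (Suc i)..Suc i + n. f j)" for f :: "nat \<Rightarrow> 'a"
    by (subst sum.atLeast_Suc_atMost) simp_all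
  define S where "S = digit_poly q (pent_digits n (2 * Suc i) (Suc i) (digit_neg s))"
  have e1: "q ^ (i * i + tri i) * q ^ (2 * i) * q = q ^ (Suc i * Suc i + tri i)"
    unfolding power_add[symmetric] power_Suc2[symmetric] by (rule arg_cong[where f = "power q"]) simp
  have e2: "q ^ (Suc i * Suc i + tri i) * q ^ i * q = q ^ (Suc i * Suc i + tri (Suc i))"
    unfolding power_add[symmetric] power_Suc2[symmetric] by (rule arg_cong[where f = "power q"]) simp
  have "digit_poly q (pent_digits (Suc n) (2 * i) i s) = q ^ (2 * i) * (q * ((- 1) ^ i + q ^ i * (q * ((- 1) ^ i + S))))"
    using Suc.prems by (simp add: digit_poly_zeros S_def)
  then have "q ^ (i * i + tri i) * digit_poly q (pent_digits (Suc n) (2 * i) i s) =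
     (q ^ (i * i + tri i) * q ^ (2 * i) * q) * (- 1) ^ i + ((q ^ (i * i + tri i) * q ^ (2 * i) * q) * q ^ i * q) * ((- 1) ^ i + S)"
    by (simp add: algebra_simps)
  also have "\<dots> = (- 1) ^ i * (q ^ (Suc i * Suc i + tri i) + q ^ (Suc i * Suc i + tri (Suc i))) + q ^ (Suc i * Suc i + tri (Suc i)) * S"
    unfolding e1 e2 by (simp add: algebra_simps)
  also have "q ^ (Suc i * Suc i + tri (Suc i)) * S =
     - (\<Sum>j=Suc (Suc i)..Suc i + n. (- 1) ^ j * (q ^ (j * j + tri (j - 1)) + q ^ (j * j + tri j)))"
    unfolding S_def by (rule Suc.IH) (use Suc.prems in \<open>simp add: neg\<close>)
  finally show ?case unfolding S2
    by (simp only: diff_Suc_1 power_Suc mult_1_left mult_minus_left minus_add_distrib minus_minus)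
qed simp

lemma digit_poly_nth: "i < length cs \<Longrightarrow> fps_nth (digit_poly fps_X cs :: real fps) (Suc i) = of_int (digit_val (cs ! i))"
proof (induction cs arbitrary: i)
  case (Cons c cs)
  have z: "fps_nth (digit_poly fps_X cs :: real fps) 0 = 0" by (cases cs) simp_all
  show ?case
  proof (cases i)
    case 0
    then show ?thesis using z by (simp add: fps_of_int[symmetric] del: fps_of_int)
  next
    case (Suc j)
    then show ?thesis using Cons by (simp add: fps_of_int[symmetric] del: fps_of_int)
  qed
qed simp

definition euler_prod :: "nat \<Rightarrow> nat \<Rightarrow> real fps" where
  "euler_prod d N = (\<Prod>i\<in>{0<..N}. 1 - fps_X ^ (d * i))"

text \<open>Shanks' identity is exact for N factors. Its left summands with s >= 1 have exponents
  above N, and its right summands with j > J have exponents above J^2 + \<open>tri J\<close>, so up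
  to this degree the finite product already shows the pentagonal digits.\<close>

lemma euler_prod_digits:
  assumes N: "N \<ge> J * J + tri J"
  shows "digits_of (stretch_digits d (pent_digits J 0 0 DP)) (euler_prod (Suc d) N)"
proof -
  define q where "q = (fps_X :: real fps) ^ Suc d"
  define len where "len = J * J + tri J"
  define cs where "cs = stretch_digits d (pent_digits J 0 0 DP)"
  have lp: "length (pent_digits J 0 0 DP) = len" using length_pent_digits[of J 0 DP] by (simp add: len_def)
  have lcs: "length cs = Suc d * len" unfolding cs_def by (simp add: length_stretch_digits lp)
  define a where "a = (\<lambda>j. (- 1) ^ j * (q ^ (j * j + tri (j - 1)) + q ^ (j * j + tri j)))"
  have JN: "J \<le> N" using N by (cases J) auto
  have dp: "digit_poly q (pent_digits J 0 0 DP) = - (\<Sum>j=1..J. a j)"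
    using digit_poly_pent_digits[of DP 0 q J] unfolding a_def by simp
  have small: "fps_nth (q ^ e * g) i = 0" if "i \<le> Suc d * len" "len < e" for e g i
  proof -
    have "Suc d * len < Suc d * e" using that by (intro mult_strict_left_mono) auto
    then have "i < Suc d * e" using that by linarith
    then show ?thesis unfolding q_def power_mult[symmetric] by (simp only: fps_X_power_mult_nth) simp
  qed
  define R where "R = (\<lambda>n s. \<Prod>i\<in>{s<..n}. 1 - q ^ i)"
  have EP: "euler_prod (Suc d) N = R N 0" unfolding euler_prod_def R_def q_def power_mult ..
  have "(\<Sum>s\<le>N. (- 1) ^ s * R N s * q ^ (s * N + tri s)) = R N 0 + (\<Sum>s\<in>{1..N}. (- 1) ^ s * R N s * q ^ (s * N + tri s))"
    by (simp add: atMost_atLeast0 sum.atLeast_Suc_atMost)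
  moreover have "(\<Sum>j=1..N. a j) = (\<Sum>j=1..J. a j) + (\<Sum>j\<in>{J<..N}. a j)"
  proof -
    have "{1..N} = {1..J} \<union> {J<..N}" using JN by auto
    then show ?thesis by (simp only:) (rule sum.union_disjoint, auto)
  qed
  moreover have "(\<Sum>s\<le>N. (- 1) ^ s * R N s * q ^ (s * N + tri s)) = 1 + (\<Sum>j=1..N. a j)"
    unfolding R_def a_def by (rule shanks_identity)
  moreover have "digit_poly fps_X cs = - (\<Sum>j=1..J. a j)"
    unfolding cs_def digit_poly_stretch q_def[symmetric] by (rule dp)
  ultimately have eq: "euler_prod (Suc d) N = 1 - digit_poly fps_X cs + (\<Sum>j\<in>{J<..N}. a j)
       - (\<Sum>s\<in>{1..N}. (- 1) ^ s * R N s * q ^ (s * N + tri s))"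
    unfolding EP by (simp add: algebra_simps)
  have c1: "fps_nth (\<Sum>j\<in>{J<..N}. a j) i = 0" if "i \<le> Suc d * len" for i
    unfolding fps_sum_nth
  proof (intro sum.neutral ballI)
    fix j assume "j \<in> {J<..N}"
    then obtain l where l: "j = Suc l" "J \<le> l" by (cases j) auto
    have "tri J \<le> tri l" using l(2) by (induction rule: dec_induct) auto
    moreover have "J * J \<le> l * l" using l(2) by (intro mult_mono) auto
    ultimately have "len < j * j + tri (j - 1)" "len < j * j + tri j" unfolding len_def l by auto
    then have "fps_nth (q ^ (j * j + tri (j - 1)) * (- 1) ^ j) i = 0" "fps_nth (q ^ (j * j + tri j) * (- 1) ^ j) i = 0"
      using small[OF that] by auto
    then show "fps_nth (a j) i = 0" unfolding a_def distrib_left by (simp add: mult.commute)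
  qed
  have c2: "fps_nth (\<Sum>s\<in>{1..N}. (- 1) ^ s * R N s * q ^ (s * N + tri s)) i = 0" if "i \<le> Suc d * len" for i
    unfolding fps_sum_nth
  proof (intro sum.neutral ballI)
    fix s assume "s \<in> {1..N}"
    then obtain l where l: "s = Suc l" by (cases s) auto
    have "len < s * N + tri s" using N unfolding l len_def by simp
    then have "fps_nth (q ^ (s * N + tri s) * ((- 1) ^ s * R N s)) i = 0" using small[OF that] by blast
    then show "fps_nth ((- 1) ^ s * R N s * q ^ (s * N + tri s)) i = 0" by (simp only: mult.commute)
  qed
  have "fps_nth (digit_poly fps_X cs :: real fps) 0 = 0" by (cases cs) simp_all
  then show ?thesis
    unfolding digits_of_def cs_def[symmetric] eq
    using c1 c2 digit_poly_nth[of _ cs] by (auto simp: lcs)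
qed

lemma euler_prod_0_nth: "d > 0 \<Longrightarrow> fps_nth (euler_prod d N) 0 = 1"
proof (induction N)
  case (Suc N)
  have "{0<..Suc N} = insert (Suc N) {0<..N}" by auto
  then show ?case using Suc by (simp add: euler_prod_def fps_nth_power_0)
qed (simp add: euler_prod_def)

section \<open>Soundness of the tests on leading binary digits\<close>

definition turan_expr :: "real \<Rightarrow> real \<Rightarrow> real \<Rightarrow> real \<Rightarrow> real" where
  "turan_expr a b c d = 4 * (b\<^sup>2 - a * c) * (c\<^sup>2 - b * d) - (b * c - a * d)\<^sup>2"

text \<open>Homogeneity transfers a positive result from scaled values to the true ones.\<close>

lemma turan_expr_scale: "turan_expr (s * a) (s * b) (s * c) (s * d) = s ^ 4 * turan_expr a b c d"
  by (simp add: turan_expr_def power_mult_distrib eval_nat_numeral algebra_simps)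

lemma halve_list_eq: "halve_list xs = map (\<lambda>x. x div 2) xs"
  by (induction xs) simp_all

lemma div24_eq: "div24 x = x div 2 ^ 24"
  unfolding div24_def by (simp add: zdiv_zmult2_eq[symmetric])

lemma div24_bounds: "2 ^ 24 * real_of_int (div24 x) \<le> real_of_int x" "real_of_int x < 2 ^ 24 * (real_of_int (div24 x) + 1)"
proof -
  have "2 ^ 24 * div24 x \<le> x" "x < 2 ^ 24 * (div24 x + 1)"
    unfolding div24_eq using mult_div_mod_eq[of "2 ^ 24" x] pos_mod_bound[of "2 ^ 24" x] pos_mod_sign[of "2 ^ 24" x]
    unfolding distrib_left by simp_all
  then have "real_of_int (2 ^ 24 * div24 x) \<le> real_of_int x" "real_of_int x < real_of_int (2 ^ 24 * (div24 x + 1))"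
    by (simp_all only: of_int_le_iff of_int_less_iff)
  then show "2 ^ 24 * real_of_int (div24 x) \<le> real_of_int x" "real_of_int x < 2 ^ 24 * (real_of_int (div24 x) + 1)"
    by simp_all
qed

lemma turan_test_correct:
  fixes A B C D :: real
  assumes "turan_test a b c d"
    and A: "of_int a \<le> A" "A < of_int a + 1" and B: "of_int b \<le> B" "B < of_int b + 1"
    and C: "of_int c \<le> C" "C < of_int c + 1" and D: "of_int d \<le> D" "D < of_int d + 1"
  shows "turan_expr A B C D > 0"
proof -
  define p where "p = b * b - (a * c + (a + (c + 1)))"
  define r where "r = c * c - (b * d + (b + (d + 1)))"
  define h where "h = b * c + (b + (c + 1)) - a * d"
  define l where "l = b * c - (a * d + (a + (d + 1)))"
  have t: "0 \<le> a" "0 \<le> b" "0 \<le> c" "0 \<le> d" "0 \<le> l" "0 \<le> p" "0 \<le> r"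
    "(div24 h + 1) * (div24 h + 1) < 4 * (div24 p * div24 r)"
    using assms(1) unfolding turan_test_def turan_test1_def turan_test2_def p_def r_def h_def l_def by auto
  have m: "real_of_int u * real_of_int v \<le> U * V" "U * V \<le> (real_of_int u + 1) * (real_of_int v + 1)"
    if "0 \<le> u" "0 \<le> v" "of_int u \<le> U" "U < of_int u + 1" "of_int v \<le> V" "V < of_int v + 1" for u v U V
    using that by (auto intro!: mult_mono)
  have P: "real_of_int p \<le> B\<^sup>2 - A * C"
    using m(1)[OF t(2,2) B B] m(2)[OF t(1,3) A C] unfolding p_def by (simp add: power2_eq_square algebra_simps)
  have R: "real_of_int r \<le> C\<^sup>2 - B * D"
    using m(1)[OF t(3,3) C C] m(2)[OF t(2,4) B D] unfolding r_def by (simp add: power2_eq_square algebra_simps)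
  have H: "B * C - A * D \<le> real_of_int h"
    using m(2)[OF t(2,3) B C] m(1)[OF t(1,4) A D] unfolding h_def by (simp add: algebra_simps)
  have L: "0 \<le> B * C - A * D"
  proof -
    have "real_of_int l \<le> B * C - A * D"
      using m(1)[OF t(2,3) B C] m(2)[OF t(1,4) A D] unfolding l_def by (simp add: algebra_simps)
    moreover have "real_of_int l \<ge> 0" using t by simp
    ultimately show ?thesis by linarith
  qed
  define p' where "p' = real_of_int (div24 p)"
  define r' where "r' = real_of_int (div24 r)"
  define h' where "h' = real_of_int (div24 h) + 1"
  have nn: "div24 p \<ge> 0" "div24 r \<ge> 0" unfolding div24_eq using t by (auto intro: pos_imp_zdiv_nonneg_iff[THEN iffD2])
  have "2 ^ 24 * p' \<le> B\<^sup>2 - A * C" "2 ^ 24 * r' \<le> C\<^sup>2 - B * D"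
    using div24_bounds(1)[of p] div24_bounds(1)[of r] P R unfolding p'_def r'_def by linarith+
  then have "4 * ((2 ^ 24 * p') * (2 ^ 24 * r')) \<le> 4 * ((B\<^sup>2 - A * C) * (C\<^sup>2 - B * D))"
    using nn by (intro mult_left_mono mult_mono) (auto simp: p'_def r'_def intro: order_trans[rotated])
  moreover have "B * C - A * D \<le> 2 ^ 24 * h'" using div24_bounds(2)[of h] H unfolding h'_def by linarith
  then have "(B * C - A * D)\<^sup>2 \<le> (2 ^ 24 * h')\<^sup>2" using L by (intro power_mono)
  moreover have "h' * h' < 4 * (p' * r')"
  proof -
    have "real_of_int ((div24 h + 1) * (div24 h + 1)) < real_of_int (4 * (div24 p * div24 r))"
      using t(8) by (simp only: of_int_less_iff)
    then show ?thesis unfolding p'_def r'_def h'_def by simp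
  qed
  then have "(2 ^ 24 * h')\<^sup>2 < 4 * ((2 ^ 24 * p') * (2 ^ 24 * r'))" by (simp add: power2_eq_square)
  ultimately have "(B * C - A * D)\<^sup>2 < 4 * ((B\<^sup>2 - A * C) * (C\<^sup>2 - B * D))" by linarith
  then show ?thesis unfolding turan_expr_def by (simp only: mult.assoc diff_gt_0_iff_gt)
qed

lemma guard_test_iff: "guard_test a b \<longleftrightarrow> a \<and> b"
  by (cases a) simp_all

text \<open>Invariant: each entry is the floor of the true value divided by \<sigma>. Halving with
  \<open>div\<close> preserves this for 2 \<sigma>, so truncation errors never accumulate beyond one
  unit.\<close>

lemma run_tests_correct:
  assumes "run_tests cs ys" "\<sigma> > 0" "\<And>i. i < length ys \<Longrightarrow> of_int (ys ! i) \<le> x i / \<sigma> \<and> x i / \<sigma> < of_int (ys ! i) + 1"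
    "i < sum_list cs"
  shows "turan_expr (x i) (x (i + 1)) (x (i + 2)) (x (i + 3)) > 0"
  using assms
proof (induction cs ys arbitrary: x \<sigma> i rule: run_tests.induct)
  case (2 cs xs)
  have "of_int (halve_list xs ! j) \<le> x j / (2 * \<sigma>) \<and> x j / (2 * \<sigma>) < of_int (halve_list xs ! j) + 1"
    if "j < length (halve_list xs)" for j
  proof -
    have j: "j < length xs" using that by (simp add: halve_list_eq)
    have "2 * (xs ! j div 2) \<le> xs ! j" "xs ! j + 1 \<le> 2 * (xs ! j div 2) + 2" by linarith+
    then have "real_of_int (2 * (xs ! j div 2)) \<le> real_of_int (xs ! j)" "real_of_int (xs ! j + 1) \<le> real_of_int (2 * (xs ! j div 2) + 2)"
      by (simp_all only: of_int_le_iff)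
    then have "2 * real_of_int (xs ! j div 2) \<le> x j / \<sigma>" "x j / \<sigma> < 2 * real_of_int (xs ! j div 2) + 2"
      using "2.prems"(3)[OF j] by simp_all
    moreover have "u \<le> v / 2 \<and> v / 2 < u + 1" if "2 * u \<le> v" "v < 2 * u + 2" for u v :: real
      using that by auto
    ultimately have "real_of_int (xs ! j div 2) \<le> x j / \<sigma> / 2 \<and> x j / \<sigma> / 2 < real_of_int (xs ! j div 2) + 1" by blast
    then show ?thesis using j by (simp add: halve_list_eq mult.commute)
  qed
  then show ?case using "2.prems" by (intro "2.IH"[of "2 * \<sigma>" x]) auto
next
  case (3 n cs a b c d xs)
  have t: "turan_test a b c d" "run_tests (n # cs) (b # c # d # xs)"
    using "3.prems"(1) by (auto simp: guard_test_iff)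
  note B = "3.prems"(3)
  show ?case
  proof (cases i)
    case 0
    have "turan_expr (x 0 / \<sigma>) (x 1 / \<sigma>) (x 2 / \<sigma>) (x 3 / \<sigma>) > 0"
      by (rule turan_test_correct[OF t(1)]) (use B[of 0] B[of 1] B[of 2] B[of 3] in auto)
    then have "\<sigma> ^ 4 * turan_expr (x 0 / \<sigma>) (x 1 / \<sigma>) (x 2 / \<sigma>) (x 3 / \<sigma>) > 0" using "3.prems"(2) by simp
    then show ?thesis unfolding turan_expr_scale[symmetric] using "3.prems"(2) 0 by (simp add: numeral_2_eq_2)
  next
    case (Suc j)
    have "turan_expr (x (Suc j)) (x (Suc (j + 1))) (x (Suc (j + 2))) (x (Suc (j + 3))) > 0"
      by (rule "3.IH"[of \<sigma> "\<lambda>i. x (Suc i)" j]) (use t "3.prems" B[of "Suc _"] Suc in \<open>auto simp: guard_test_iff\<close>)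
    then show ?thesis unfolding Suc by simp
  qed
qed auto

lemma run_exact_correct:
  assumes "run_exact n cs ys" "\<And>i. i < length ys \<Longrightarrow> x i = of_int (ys ! i)" "i < n + sum_list cs"
  shows "turan_expr (x i) (x (i + 1)) (x (i + 2)) (x (i + 3)) > 0"
  using assms
proof (induction n cs ys arbitrary: x i rule: run_exact.induct)
  case (1 cs xs)
  then show ?case by (intro run_tests_correct[of cs xs 1]) auto
next
  case (2 n cs a b c d xs)
  have t: "exact_test a b c d" "run_exact n cs (b # c # d # xs)"
    using "2.prems"(1) by (auto simp: guard_test_iff)
  note B = "2.prems"(2)
  show ?case
  proof (cases i)
    case 0
    have "real_of_int ((b * c - a * d) * (b * c - a * d)) < real_of_int (4 * ((b * b - a * c) * (c * c - b * d)))"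
      using t(1) unfolding exact_test_def by (simp only: of_int_less_iff)
    then have lt: "(real_of_int b * of_int c - of_int a * of_int d)\<^sup>2 <
        4 * (((real_of_int b)\<^sup>2 - of_int a * of_int c) * ((of_int c)\<^sup>2 - of_int b * of_int d))"
      by (simp add: power2_eq_square)
    have x: "x 0 = of_int a" "x (0 + 1) = of_int b" "x (0 + 2) = of_int c" "x (0 + 3) = of_int d"
      using B[of 0] B[of 1] B[of 2] B[of 3] by (auto simp: numeral_2_eq_2 numeral_3_eq_3)
    show ?thesis unfolding 0 x turan_expr_def using lt by (simp only: mult.assoc diff_gt_0_iff_gt)
  next
    case (Suc j)
    have "turan_expr (x (Suc j)) (x (Suc (j + 1))) (x (Suc (j + 2))) (x (Suc (j + 3))) > 0"
      by (rule "2.IH"[of "\<lambda>i. x (Suc i)" j]) (use t "2.prems" B[of "Suc _"] Suc in \<open>auto simp: guard_test_iff\<close>)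
    then show ?thesis unfolding Suc by simp
  qed
qed auto

section \<open>The computation up to n = 800\<close>

text \<open>The Euler product in q^2 divided by the cube of that in q, up to q^802; this part is
  common to k = 1 and k = 2. The 23 pairs of digits reach degree 805, the 17 stretched pairs degree
  884.\<close>

definition numerator_coeffs :: "int list" where
  "numerator_coeffs = rev_onto (series_mul (map digit_neg (stretch_digits 1 (pent_digits 17 0 0 DP)))
     (rev_onto (series_div (stretch_digits 0 (pent_digits 23 0 0 DP))
       (rev_onto (series_div (stretch_digits 0 (pent_digits 23 0 0 DP))
         (rev_onto (series_div (stretch_digits 0 (pent_digits 23 0 0 DP)) (1 # replicate 802 0) []) []) []) []) []) []) [] []) []"

definition diamond_coeffs :: "nat \<Rightarrow> nat \<Rightarrow> nat \<Rightarrow> nat \<Rightarrow> int list \<Rightarrow> int list" where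
  "diamond_coeffs d1 J1 d2 J2 xs = rev_onto (series_div (stretch_digits d2 (pent_digits J2 0 0 DP))
     (rev_onto (series_mul (map digit_neg (stretch_digits d1 (pent_digits J1 0 0 DP))) xs [] []) []) []) []"

text \<open>Halvings become rarer as the ratio of consecutive coefficients approaches 1. The entries
  sum to 741; with 54 exact tests this covers the 795 values n = 6, ..., 800.\<close>

definition schedule :: "nat list" where
  "schedule = replicate 30 4 @ replicate 30 6 @ replicate 30 8 @ replicate 20 10 @ [1]"

text \<open>With the list as a parameter, the common coefficients are evaluated once before both
  cases use them. Dropping 5 entries starts at the coefficient of index n - 1 for n = 6. The
  stretches 2, 5 and 4, 9 belong to the exponents 3, 6 and 5, 10.\<close>

definition check_both :: "int list \<Rightarrow> bool" where
  "check_both xs \<longleftrightarrow> run_exact 54 schedule (drop 5 (diamond_coeffs 2 14 5 10 xs)) \<and>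
     run_exact 54 schedule (drop 5 (diamond_coeffs 4 11 9 8 xs))"

lemma check_numerator: "check_both numerator_coeffs"
  by (simp only: schedule_def numerator_coeffs_def diamond_coeffs_def check_both_def eval_simps)

lemma series_div_prefix:
  assumes "digits_of cs D" "B * D = A" "prefix_of xs A" "length xs \<le> Suc (length cs)"
  shows "prefix_of (rev_onto (series_div cs xs []) []) B" "length (rev_onto (series_div cs xs []) []) = length xs"
proof -
  have "prefix_of (rev (series_div cs xs [])) B \<and> length (series_div cs xs []) = length ([] :: int list) + length xs"
    using assms by (intro series_div_correct) (auto simp: prefix_of_def)
  then show "prefix_of (rev_onto (series_div cs xs []) []) B" "length (rev_onto (series_div cs xs []) []) = length xs"
    by (auto simp: rev_onto_eq)
qed

lemma series_mul_prefix:
  assumes "digits_of cs D" "prefix_of xs A" "length xs \<le> Suc (length cs)"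
  shows "prefix_of (rev_onto (series_mul (map digit_neg cs) xs [] []) []) (A * D)"
    "length (rev_onto (series_mul (map digit_neg cs) xs [] []) []) = length xs"
proof -
  have "digit_neg (digit_neg c) = c" for c by (cases c) auto
  then have neg: "map digit_neg (map digit_neg cs) = cs" by (simp add: map_idI)
  have d': "digits_of (map digit_neg (map digit_neg cs)) D" unfolding neg by (rule assms(1))
  have "prefix_of (rev (series_mul (map digit_neg cs) xs [] [])) (A * D) \<and>
      length (series_mul (map digit_neg cs) xs [] []) = length ([] :: int list) + length xs"
    using assms by (intro series_mul_correct[OF d']) (auto simp: prefix_of_def)
  then show "prefix_of (rev_onto (series_mul (map digit_neg cs) xs [] []) []) (A * D)"
    "length (rev_onto (series_mul (map digit_neg cs) xs [] []) []) = length xs"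
    by (auto simp: rev_onto_eq)
qed

lemma tri_eq: "tri n = n * Suc n div 2"
  by (induction n) auto

lemma length_pent: "length (pent_digits J 0 0 DP) = J * J + tri J"
  using length_pent_digits[of J 0 DP] by simp

lemma numerator_coeffs_correct:
  fixes B :: "real fps"
  assumes N: "N \<ge> 805" and B: "B * euler_prod 1 N = 1"
  shows "prefix_of numerator_coeffs (B ^ 3 * euler_prod 2 N)" "length numerator_coeffs = 803"
proof -
  have d: "digits_of (stretch_digits 0 (pent_digits 23 0 0 DP)) (euler_prod 1 N)"
    using euler_prod_digits[of 23 N 0] N by (simp add: tri_eq)
  have d2: "digits_of (stretch_digits 1 (pent_digits 17 0 0 DP)) (euler_prod 2 N)"
    using euler_prod_digits[of 17 N 1] N by (simp add: tri_eq flip: numeral_2_eq_2)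
  have len: "803 \<le> Suc (length (stretch_digits 0 (pent_digits 23 0 0 DP)))"
    "803 \<le> Suc (length (stretch_digits 1 (pent_digits 17 0 0 DP)))"
    unfolding length_stretch_digits length_pent by (simp_all add: tri_eq)
  have p0: "prefix_of (1 # replicate 802 0) 1" "length (1 # replicate 802 (0 :: int)) = 803"
    by (auto simp: prefix_of_def nth_Cons' fps_one_nth)
  note p1 = series_div_prefix[OF d B p0(1), unfolded p0(2), OF len(1)]
  have B2: "B ^ 2 * euler_prod 1 N = B" "B ^ 3 * euler_prod 1 N = B ^ 2"
    using B by (simp_all add: power2_eq_square power3_eq_cube mult.assoc)
  note p2 = series_div_prefix[OF d B2(1) p1(1), unfolded p1(2), OF len(1)]
  note p3 = series_div_prefix[OF d B2(2) p2(1), unfolded p2(2), OF len(1)]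
  note p4 = series_mul_prefix[OF d2 p3(1), unfolded p3(2), OF len(2)]
  show "prefix_of numerator_coeffs (B ^ 3 * euler_prod 2 N)" "length numerator_coeffs = 803"
    unfolding numerator_coeffs_def by (rule p4)+
qed

lemma diamond_coeffs_correct:
  assumes N: "N \<ge> J1 * J1 + tri J1" "N \<ge> J2 * J2 + tri J2"
    and len: "length xs \<le> Suc (Suc d1 * (J1 * J1 + tri J1))" "length xs \<le> Suc (Suc d2 * (J2 * J2 + tri J2))"
    and xs: "prefix_of xs A" and F: "F * euler_prod (Suc d2) N = A * euler_prod (Suc d1) N"
  shows "prefix_of (diamond_coeffs d1 J1 d2 J2 xs) F" "length (diamond_coeffs d1 J1 d2 J2 xs) = length xs"
proof -
  have l: "length xs \<le> Suc (length (stretch_digits d1 (pent_digits J1 0 0 DP)))"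
    "length xs \<le> Suc (length (stretch_digits d2 (pent_digits J2 0 0 DP)))"
    unfolding length_stretch_digits length_pent using len by simp_all
  note p1 = series_mul_prefix[OF euler_prod_digits[OF N(1), of d1] xs l(1)]
  note p2 = series_div_prefix[OF euler_prod_digits[OF N(2), of d2] F p1(1), unfolded p1(2), OF l(2)]
  show "prefix_of (diamond_coeffs d1 J1 d2 J2 xs) F" "length (diamond_coeffs d1 J1 d2 J2 xs) = length xs"
    unfolding diamond_coeffs_def by (rule p2)+
qed

text \<open>Clears all denominators, so that only Euler products with known digits remain.\<close>

lemma prod_broken_diamond_factor:
  "(\<Prod>i\<le>N. broken_diamond_factor k (Suc i)) * (euler_prod 1 (Suc N) ^ 3 * euler_prod (4 * k + 2) (Suc N))
     = euler_prod 2 (Suc N) * euler_prod (2 * k + 1) (Suc N)"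
proof -
  have E: "euler_prod d (Suc N) = (\<Prod>i\<le>N. 1 - fps_X ^ (d * Suc i))" for d
    unfolding euler_prod_def by (rule prod.reindex_bij_witness[of _ Suc "\<lambda>n. n - 1"]) auto
  have "broken_diamond_factor k (Suc i) * ((1 - fps_X ^ (1 * Suc i)) ^ 3 * (1 - fps_X ^ ((4 * k + 2) * Suc i)))
     = (1 - fps_X ^ (2 * Suc i)) * (1 - fps_X ^ ((2 * k + 1) * Suc i))" for i
  proof -
    define D :: "real fps" where "D = (1 - fps_X ^ Suc i) ^ 3 * (1 - fps_X ^ ((4 * k + 2) * Suc i))"
    have "fps_nth D 0 = 1" unfolding D_def by (simp add: fps_nth_power_0)
    then have "a / D * D = a" for a
      by (simp add: fps_divide_unit mult.assoc inverse_mult_eq_1)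
    then show ?thesis unfolding broken_diamond_factor_def D_def mult_1 .
  qed
  note step = this
  have "(\<Prod>i\<le>N. broken_diamond_factor k (Suc i) * ((1 - fps_X ^ (1 * Suc i)) ^ 3 * (1 - fps_X ^ ((4 * k + 2) * Suc i))))
     = (\<Prod>i\<le>N. (1 - fps_X ^ (2 * Suc i)) * (1 - fps_X ^ ((2 * k + 1) * Suc i)))"
    by (rule prod.cong[OF refl step])
  then show ?thesis unfolding E prod.distrib prod_power_distrib .
qed

text \<open>A partial product that agrees with the generating function up to q^802 replaces it. The
  bound 805 = 23^2 + \<open>tri 23\<close> on its length makes the pentagonal digits valid for all
  Euler products involved.\<close>

lemma higher_turan_small:
  fixes k n :: nat
  assumes k: "k \<in> {1, 2}" and n: "6 \<le> n" "n \<le> 800"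
  shows "turan_expr (broken_diamond k (n - 1)) (broken_diamond k n) (broken_diamond k (n + 1)) (broken_diamond k (n + 2)) > 0"
proof -
  have "eventually (\<lambda>N. \<forall>n\<in>{..802}. fps_nth (\<Prod>i\<le>N. broken_diamond_factor k (Suc i)) n = broken_diamond k n) sequentially"
    by (intro eventually_ball_finite ballI eventually_broken_diamond_eq) simp
  moreover have "eventually (\<lambda>N. N \<ge> 805) sequentially" by (rule eventually_ge_at_top)
  ultimately have "eventually (\<lambda>N. (\<forall>n\<in>{..802}. fps_nth (\<Prod>i\<le>N. broken_diamond_factor k (Suc i)) n = broken_diamond k n) \<and> N \<ge> 805) sequentially"
    by (rule eventually_conj)
  then obtain N where N: "\<And>n. n \<le> 802 \<Longrightarrow> fps_nth (\<Prod>i\<le>N. broken_diamond_factor k (Suc i)) n = broken_diamond k n" "N \<ge> 805"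
    by (auto simp: eventually_sequentially)
  define F where "F = (\<Prod>i\<le>N. broken_diamond_factor k (Suc i))"
  define B where "B = inverse (euler_prod 1 (Suc N))"
  have B: "B * euler_prod 1 (Suc N) = 1"
    unfolding B_def by (rule inverse_mult_eq_1) (simp add: euler_prod_0_nth)
  have N': "Suc N \<ge> 805" using N by simp
  note nc = numerator_coeffs_correct[OF N' B]
  have "B ^ 3 * euler_prod 1 (Suc N) ^ 3 = 1" unfolding power_mult_distrib[symmetric] B by simp
  then have F: "F * euler_prod (4 * k + 2) (Suc N) = B ^ 3 * euler_prod 2 (Suc N) * euler_prod (2 * k + 1) (Suc N)"
    using arg_cong[OF prod_broken_diamond_factor[of k N], of "\<lambda>u. B ^ 3 * u"] unfolding F_def[symmetric]
    by (metis (no_types, lifting) mult.assoc mult.commute mult_1)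
  have "\<exists>xs. prefix_of xs F \<and> length xs = 803 \<and> run_exact 54 schedule (drop 5 xs)"
  proof (cases "k = 1")
    case True
    have "prefix_of (diamond_coeffs 2 14 5 10 numerator_coeffs) F" "length (diamond_coeffs 2 14 5 10 numerator_coeffs) = length numerator_coeffs"
      by (rule diamond_coeffs_correct[of 14 "Suc N" 10, OF _ _ _ _ nc(1)]; use F N True in \<open>simp add: nc(2) tri_eq\<close>)+
    then show ?thesis using check_numerator nc(2) unfolding check_both_def by auto
  next
    case False
    then have k2: "k = 2" using k by simp
    have "prefix_of (diamond_coeffs 4 11 9 8 numerator_coeffs) F" "length (diamond_coeffs 4 11 9 8 numerator_coeffs) = length numerator_coeffs"
      by (rule diamond_coeffs_correct[of 11 "Suc N" 8, OF _ _ _ _ nc(1)]; use F N k2 in \<open>simp add: nc(2) tri_eq\<close>)+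
    then show ?thesis using check_numerator nc(2) unfolding check_both_def by auto
  qed
  then obtain xs where xs: "prefix_of xs F" "length xs = 803" "run_exact 54 schedule (drop 5 xs)" by blast
  define x where "x = (\<lambda>i. broken_diamond k (5 + i))"
  have "turan_expr (x (n - 6)) (x (n - 6 + 1)) (x (n - 6 + 2)) (x (n - 6 + 3)) > 0"
  proof (rule run_exact_correct[OF xs(3)])
    fix i assume "i < length (drop 5 xs)"
    then have "5 + i < 803" using xs(2) by simp
    then show "x i = of_int (drop 5 xs ! i)"
      using xs(1,2) N(1)[of "5 + i"] unfolding prefix_of_def x_def F_def[symmetric] by simp
  next
    have "sum_list schedule = 741" by (simp add: schedule_def sum_list_replicate)
    then show "n - 6 < 54 + sum_list schedule" using n by simp
  qed
  moreover have "5 + (n - 6) = n - 1" "5 + (n - 6 + 1) = n" "5 + (n - 6 + 2) = n + 1" "5 + (n - 6 + 3) = n + 2"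
    using n by simp_all
  ultimately show ?thesis unfolding x_def by simp
qed

theorem theorem1p9:
  fixes k n :: nat
  assumes "k \<in> {1, 2}" and "n \<ge> 6"
  shows "4 * ((broken_diamond k n)\<^sup>2 - broken_diamond k (n - 1) * broken_diamond k (n + 1))
           * ((broken_diamond k (n + 1))\<^sup>2 - broken_diamond k n * broken_diamond k (n + 2))
         - (broken_diamond k n * broken_diamond k (n + 1)
            - broken_diamond k (n - 1) * broken_diamond k (n + 2))\<^sup>2 > 0"
proof (cases "n \<le> 800")
  case True
  then show ?thesis using higher_turan_small[OF assms] unfolding turan_expr_def by simp
next
  case False
  then show ?thesis using higher_turan_large[OF assms(1), of n] by simp
qed

end
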